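(* Let $K$ be an unstable algebra over the mod $2$ Steenrod algebra and let $M\in K\text{-}\mathcal U$. Then $$\mathbf{C}(K)=\bigcap_{k\ge 1}\mathbf{C}_k(K)\qquad\text{and}\qquad \mathbf{C}(M;K)=\bigcap_{k\ge 1}\mathbf{C}_k(M;K).$$
   Context: $\mathcal A$ is the mod $2$ Steenrod algebra; $\mathcal U$ is the category of unstable $\mathcal A$-modules and $\mathcal K$ the category of unstable $\mathcal A$-algebras (commutative unital algebras $K$ in $\mathcal U$ with $Sq^{|x|}x=x^2$). For $K\in\mathcal K$, $K\text{-}\mathcal U$ is the category of $K$-modules in $\mathcal U$. $\mathcal V^f$ is the category of finite-dimensional $\mathbb F_2$-vector spaces, and $H^*(V):=H^*(BV;\mathbb F_2)$. $T_V:\mathcal U\to\mathcal U$ (Lannes' functor) is the left adjoint of $-\otimes H^*(V)$; it is exact, commutes with tensor products, and is natural in $V$. It restricts to a functor $\mathcal K\to\mathcal K$ left adjoint to $-\otimes H^*(V)$ in $\mathcal K$, and sends $M\in K\text{-}\mathcal U$ to an object of $T_V(K)\text{-}\mathcal U$. For $N\in\mathcal U$, $\rho_{N,V}:N\cong T_0(N)\to T_V(N)$ is the map induced by $0\to V$. For $K\in\mathcal K$, $\phi\in\mathrm{Hom}_{\mathcal K}(K,H^*(V))$ and $M\in K\text{-}\mathcal U$, let $\mathbb F_2(\phi)$ be $\mathbb F_2$ with the $T_V(K)^0$-module structure induced by the ring map $T_V(K)^0\to\mathbb F_2$ adjoint to $\phi$. Put $T_{(V,\phi)}(K):=T_V(K)\otimes_{T_V(K)^0}\mathbb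 F_2(\phi)$, $T_{(V,\phi)}(M):=T_V(M)\otimes_{T_V(K)^0}\mathbb F_2(\phi)$, and let $\rho_{K,(V,\phi)}$, $\rho_{M,(V,\phi)}$ be the composites of $\rho_{K,V}$, $\rho_{M,V}$ with the canonical projections onto these. $\mathbf C(K)$ (central elements of $K$) is the set of pairs $(W,\phi)$ with $W\in\mathcal V^f$, $\phi\in\mathrm{Hom}_{\mathcal K}(K,H^*(W))$, such that $\rho_{K,(W,\phi)}:K\to T_{(W,\phi)}(K)$ is an isomorphism; $\mathbf C(M;K)$ ($M$-central elements) is the set of such pairs for which $\rho_{M,(W,\phi)}:M\to T_{(W,\phi)}(M)$ is an isomorphism. For $N\in\mathcal U$, $N^{<k}$ is the quotient of $N$ by its elements of degree $\ge k$, and $f^{<k}(N)$ is the functor $V\mapsto T_V(N)^{<k}$ on $\mathcal V^f$ (equipped with $H^*(V)^{<k}$-comodule structures); $f^{<k}(\theta)$ is an isomorphism iff $T_V(\theta)^{<k}$ is an isomorphism for every $V\in\mathcal V^f$. For $k\ge1$, $\mathbf C_k(K)$ (resp. $\mathbf C_k(M;K)$) is the set of pairs $(W,\phi)$ with $W\in\mathcal V^f$ and $\phi\in\mathrm{Hom}_{\mathcal K}(K,H^*(W))$ such that $f^{<k}(\rho_{K,(W,\phi)})$ (resp. $f^{<k}(\rho_{M,(W,\phi)})$) is an isomorphism. *)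

theory Defs
  imports "HOL-Algebra.Coset" "HOL-Algebra.FiniteProduct" "HOL-Algebra.Generated_Groups"
    "HOL-Library.Poly_Mapping" "HOL-Library.Z2"
    "HOL-Library.Infinite_Typeclass"
begin

section \<open>Vector spaces over the field with two elements\<close>

text \<open>
  An \<open>\<bbbF>\<^sub>2\<close>-vector space is the same thing as an abelian group in which every element is its own
  inverse, and an \<open>\<bbbF>\<^sub>2\<close>-linear map is the same thing as a group homomorphism.  Such groups are
  taken from HOL-Algebra and hence are written multiplicatively: \<open>\<otimes>\<close> is the addition of vectors,
  \<open>\<one>\<close> is the zero vector, and a sum of vectors is a \<open>finprod\<close>.  Minus signs disappear.
\<close>

definition F2_space :: "('a, 'x) monoid_scheme \<Rightarrow> bool" where
  "F2_space G \<longleftrightarrow> comm_group G \<and> (\<forall>x\<in>carrier G. x \<otimes>\<^bsub>G\<^esub> x = \<one>\<^bsub>G\<^esub>)"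

text \<open>The objects of \<open>\<V>\<^sup>f\<close>.  If the type \<open>'v\<close> is infinite, every finite-dimensional
  \<open>\<bbbF>\<^sub>2\<close>-vector space is isomorphic to one of these.\<close>

definition Vf :: "'v monoid set" where
  "Vf = {V. F2_space V \<and> finite (carrier V)}"

definition bilinear_map ::
  "('a, 'x) monoid_scheme \<Rightarrow> ('b, 'y) monoid_scheme \<Rightarrow> ('c, 'z) monoid_scheme \<Rightarrow> ('a \<Rightarrow> 'b \<Rightarrow> 'c) \<Rightarrow> bool"
  where
  "bilinear_map A B C f \<longleftrightarrow>
     (\<forall>x\<in>carrier A. (\<lambda>y. f x y) \<in> hom B C) \<and> (\<forall>y\<in>carrier B. (\<lambda>x. f x y) \<in> hom A C)"

text \<open>The linear dual; functionals are \<open>undefined\<close> off the carrier, so that they form a set.\<close>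

definition dual_space :: "('a, 'x) monoid_scheme \<Rightarrow> ('a \<Rightarrow> bit) set" where
  "dual_space G = {c \<in> extensional (carrier G).
     \<forall>x\<in>carrier G. \<forall>y\<in>carrier G. c (x \<otimes>\<^bsub>G\<^esub> y) = c x + c y}"

text \<open>The \<open>\<bbbF>\<^sub>2\<close>-vector space with basis \<open>S\<close>.\<close>

definition free_space :: "'s set \<Rightarrow> ('s \<Rightarrow>\<^sub>0 bit) monoid" where
  "free_space S = \<lparr>carrier = {u. Poly_Mapping.keys u \<subseteq> S}, monoid.mult = (+), one = 0\<rparr>"

abbreviation gen :: "'s \<Rightarrow> ('s \<Rightarrow>\<^sub>0 bit)" where
  "gen s \<equiv> Poly_Mapping.single s 1"

definition lin_ext :: "('b, 'x) monoid_scheme \<Rightarrow> ('s \<Rightarrow> 'b) \<Rightarrow> ('s \<Rightarrow>\<^sub>0 bit) \<Rightarrow> 'b" where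
  "lin_ext G f u = finprod G f (Poly_Mapping.keys u)"

text \<open>A linear map out of a quotient of a free space, given by its values \<open>f\<close> on the basis:
  the common value of \<open>lin_ext G f\<close> on the elements of a coset.\<close>

definition lin_ext_quot :: "('b, 'x) monoid_scheme \<Rightarrow> ('s \<Rightarrow> 'b) \<Rightarrow> ('s \<Rightarrow>\<^sub>0 bit) set \<Rightarrow> 'b" where
  "lin_ext_quot G f X = the_elem (lin_ext G f ` X)"

text \<open>A map into a quotient \<open>G Mod S\<close>, given by a map \<open>f\<close> on representatives: for well-defined maps
  all cosets in the union coincide.\<close>

definition coset_map :: "('b, 'x) monoid_scheme \<Rightarrow> 'b set \<Rightarrow> ('a \<Rightarrow> 'b) \<Rightarrow> 'a set \<Rightarrow> 'b set" where
  "coset_map G S f X = (\<Union>x\<in>X. S #>\<^bsub>G\<^esub> f x)"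


section \<open>Unstable modules over the mod 2 Steenrod algebra\<close>

text \<open>
  The Steenrod algebra is the \<open>\<bbbF>\<^sub>2\<close>-algebra generated by the \<open>Sq\<^sup>i\<close> subject to \<open>Sq\<^sup>0 = 1\<close> and the
  Adem relations; so a module over it is given by the operators \<open>Sq\<^sup>i\<close>.  Unstable modules vanish in
  negative degrees (there \<open>Sq\<^sup>0\<close> would have to be zero), hence the grading by \<open>nat\<close>.
  \<open>Sq M i n\<close> is the operator \<open>Sq\<^sup>i\<close> on the component \<open>M\<^sup>n = grade M n\<close>.
\<close>

record 'a umod =
  grade :: "nat \<Rightarrow> 'a monoid"
  Sq :: "nat \<Rightarrow> nat \<Rightarrow> 'a \<Rightarrow> 'a"

abbreviation carr :: "('a, 'x) umod_scheme \<Rightarrow> nat \<Rightarrow> 'a set" where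
  "carr M n \<equiv> carrier (grade M n)"

text \<open>\<open>adem_rhs M a b n x = \<Sum> binom(b-c-1, a-2c) Sq\<^sup>a\<^sup>+\<^sup>b\<^sup>-\<^sup>c Sq\<^sup>c x\<close>, the sum over \<open>0 \<le> c \<le> a/2\<close>.\<close>

definition adem_rhs :: "('a, 'x) umod_scheme \<Rightarrow> nat \<Rightarrow> nat \<Rightarrow> nat \<Rightarrow> 'a \<Rightarrow> 'a" where
  "adem_rhs M a b n x =
     finprod (grade M (n + a + b)) (\<lambda>c. Sq M (a + b - c) (n + c) (Sq M c n x))
       {c. c \<le> a div 2 \<and> odd ((b - c - 1) choose (a - 2 * c))}"

definition unstable_module :: "('a, 'x) umod_scheme \<Rightarrow> bool" where
  "unstable_module M \<longleftrightarrow>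
     (\<forall>n. F2_space (grade M n)) \<and>
     (\<forall>i n. Sq M i n \<in> hom (grade M n) (grade M (n + i))) \<and>
     (\<forall>n. \<forall>x\<in>carr M n. Sq M 0 n x = x) \<and>
     (\<forall>a b n. \<forall>x\<in>carr M n. 0 < a \<and> a < 2 * b \<longrightarrow>
        Sq M a (n + b) (Sq M b n x) = adem_rhs M a b n x) \<and>
     (\<forall>i n. \<forall>x\<in>carr M n. n < i \<longrightarrow> Sq M i n x = \<one>\<^bsub>grade M (n + i)\<^esub>)"

definition umod_hom :: "('a, 'x) umod_scheme \<Rightarrow> ('b, 'y) umod_scheme \<Rightarrow> (nat \<Rightarrow> 'a \<Rightarrow> 'b) \<Rightarrow> bool" where
  "umod_hom M N f \<longleftrightarrow>
     (\<forall>n. f n \<in> hom (grade M n) (grade N n)) \<and>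
     (\<forall>i n. \<forall>x\<in>carr M n. f (n + i) (Sq M i n x) = Sq N i n (f n x))"

definition umod_iso :: "('a, 'x) umod_scheme \<Rightarrow> ('b, 'y) umod_scheme \<Rightarrow> (nat \<Rightarrow> 'a \<Rightarrow> 'b) \<Rightarrow> bool" where
  "umod_iso M N f \<longleftrightarrow> umod_hom M N f \<and>
     (\<exists>g. umod_hom N M g \<and>
        (\<forall>n. \<forall>x\<in>carr M n. g n (f n x) = x) \<and> (\<forall>n. \<forall>y\<in>carr N n. f n (g n y) = y))"

text \<open>\<open>submod X R\<close> is the smallest graded subspace of \<open>X\<close> that is stable under the operators \<open>Sq\<^sup>i\<close> and
  contains those elements of \<open>R\<close> that lie in \<open>X\<close>.\<close>

inductive in_submod :: "('a, 'x) umod_scheme \<Rightarrow> (nat \<Rightarrow> 'a set) \<Rightarrow> nat \<Rightarrow> 'a \<Rightarrow> bool"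
  for X :: "('a, 'x) umod_scheme" and R :: "nat \<Rightarrow> 'a set" where
  zero: "in_submod X R n \<one>\<^bsub>grade X n\<^esub>"
| base: "r \<in> R n \<Longrightarrow> r \<in> carr X n \<Longrightarrow> in_submod X R n r"
| add: "in_submod X R n r \<Longrightarrow> in_submod X R n s \<Longrightarrow> in_submod X R n (r \<otimes>\<^bsub>grade X n\<^esub> s)"
| Sq: "in_submod X R n r \<Longrightarrow> in_submod X R (n + i) (Sq X i n r)"

definition submod :: "('a, 'x) umod_scheme \<Rightarrow> (nat \<Rightarrow> 'a set) \<Rightarrow> nat \<Rightarrow> 'a set" where
  "submod X R n = {r. in_submod X R n r}"

definition quot_umod :: "('a, 'x) umod_scheme \<Rightarrow> (nat \<Rightarrow> 'a set) \<Rightarrow> 'a set umod" where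
  "quot_umod X S =
     \<lparr>grade = (\<lambda>n. grade X n Mod S n),
      Sq = (\<lambda>i n. coset_map (grade X (n + i)) (S (n + i)) (Sq X i n))\<rparr>"


subsection \<open>Tensor products\<close>

text \<open>The basis element \<open>(p, x, q, y)\<close> stands for \<open>x \<otimes> y\<close> with \<open>x\<close> of degree \<open>p\<close> and \<open>y\<close> of degree \<open>q\<close>.\<close>

type_synonym ('a, 'b) tens = "((nat \<times> 'a \<times> nat \<times> 'b) \<Rightarrow>\<^sub>0 bit) set"

definition tensor_gens ::
  "('a, 'x) umod_scheme \<Rightarrow> ('b, 'y) umod_scheme \<Rightarrow> nat \<Rightarrow> (nat \<times> 'a \<times> nat \<times> 'b) set" where
  "tensor_gens M N n = {(p, x, q, y). p + q = n \<and> x \<in> carr M p \<and> y \<in> carr N q}"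

definition tensor_rels ::
  "('a, 'x) umod_scheme \<Rightarrow> ('b, 'y) umod_scheme \<Rightarrow> nat \<Rightarrow> ((nat \<times> 'a \<times> nat \<times> 'b) \<Rightarrow>\<^sub>0 bit) set" where
  "tensor_rels M N n =
     {gen (p, x \<otimes>\<^bsub>grade M p\<^esub> x', q, y) + gen (p, x, q, y) + gen (p, x', q, y) | p x x' q y.
        p + q = n \<and> x \<in> carr M p \<and> x' \<in> carr M p \<and> y \<in> carr N q} \<union>
     {gen (p, x, q, y \<otimes>\<^bsub>grade N q\<^esub> y') + gen (p, x, q, y) + gen (p, x, q, y') | p x q y y'.
        p + q = n \<and> x \<in> carr M p \<and> y \<in> carr N q \<and> y' \<in> carr N q}"

definition tensor_grade ::
  "('a, 'x) umod_scheme \<Rightarrow> ('b, 'y) umod_scheme \<Rightarrow> nat \<Rightarrow> ('a, 'b) tens monoid" where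
  "tensor_grade M N n =
     free_space (tensor_gens M N n) Mod
       generate (free_space (tensor_gens M N n)) (tensor_rels M N n)"

text \<open>The pure tensor \<open>x \<otimes> y\<close>.\<close>

definition pure ::
  "('a, 'x) umod_scheme \<Rightarrow> ('b, 'y) umod_scheme \<Rightarrow> nat \<Rightarrow> 'a \<Rightarrow> nat \<Rightarrow> 'b \<Rightarrow> ('a, 'b) tens" where
  "pure M N p x q y =
     generate (free_space (tensor_gens M N (p + q))) (tensor_rels M N (p + q))
       #>\<^bsub>free_space (tensor_gens M N (p + q))\<^esub> gen (p, x, q, y)"

text \<open>The operators on the tensor product are given by the Cartan formula.\<close>

definition tensor ::
  "('a, 'x) umod_scheme \<Rightarrow> ('b, 'y) umod_scheme \<Rightarrow> ('a, 'b) tens umod" where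
  "tensor M N =
     \<lparr>grade = tensor_grade M N,
      Sq = (\<lambda>i n. lin_ext_quot (tensor_grade M N (n + i)) (\<lambda>(p, x, q, y).
              finprod (tensor_grade M N (n + i))
                (\<lambda>k. pure M N (p + k) (Sq M k p x) (q + (i - k)) (Sq N (i - k) q y)) {..i}))\<rparr>"

text \<open>The unstable module \<open>\<bbbF>\<^sub>2\<close>, concentrated in degree \<open>0\<close>.\<close>

definition F2_umod :: "bit umod" where
  "F2_umod =
     \<lparr>grade = (\<lambda>n. \<lparr>carrier = (if n = 0 then UNIV else {0}), monoid.mult = (+), one = 0\<rparr>),
      Sq = (\<lambda>i n x. if i = 0 then x else 0)\<rparr>"


section \<open>Unstable algebras and their modules\<close>

record 'a ualg = "'a umod" +
  prd :: "nat \<Rightarrow> nat \<Rightarrow> 'a \<Rightarrow> 'a \<Rightarrow> 'a"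
  unt :: 'a

record ('a, 'm) kmod = "'m umod" +
  act :: "nat \<Rightarrow> nat \<Rightarrow> 'a \<Rightarrow> 'm \<Rightarrow> 'm"

definition unstable_algebra :: "('a, 'x) ualg_scheme \<Rightarrow> bool" where
  "unstable_algebra K \<longleftrightarrow>
     unstable_module K \<and>
     (\<forall>p q. bilinear_map (grade K p) (grade K q) (grade K (p + q)) (prd K p q)) \<and>
     unt K \<in> carr K 0 \<and>
     (\<forall>p. \<forall>x\<in>carr K p. prd K 0 p (unt K) x = x) \<and>
     (\<forall>p q. \<forall>x\<in>carr K p. \<forall>y\<in>carr K q. prd K p q x y = prd K q p y x) \<and>
     (\<forall>p q r. \<forall>x\<in>carr K p. \<forall>y\<in>carr K q. \<forall>z\<in>carr K r.
        prd K (p + q) r (prd K p q x y) z = prd K p (q + r) x (prd K q r y z)) \<and>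
     (\<forall>i p q. \<forall>x\<in>carr K p. \<forall>y\<in>carr K q.
        Sq K i (p + q) (prd K p q x y) =
          finprod (grade K (p + q + i))
            (\<lambda>k. prd K (p + k) (q + (i - k)) (Sq K k p x) (Sq K (i - k) q y)) {..i}) \<and>
     (\<forall>n. \<forall>x\<in>carr K n. Sq K n n x = prd K n n x x)"

text \<open>\<open>unstable_kmod K M\<close>: \<open>M\<close> is an object of \<open>K\<close>-\<open>\<U>\<close>.\<close>

definition unstable_kmod :: "('a, 'x) ualg_scheme \<Rightarrow> ('a, 'm, 'y) kmod_scheme \<Rightarrow> bool" where
  "unstable_kmod K M \<longleftrightarrow>
     unstable_module M \<and>
     (\<forall>p q. bilinear_map (grade K p) (grade M q) (grade M (p + q)) (act M p q)) \<and>
     (\<forall>p. \<forall>x\<in>carr M p. act M 0 p (unt K) x = x) \<and>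
     (\<forall>p q r. \<forall>a\<in>carr K p. \<forall>b\<in>carr K q. \<forall>x\<in>carr M r.
        act M (p + q) r (prd K p q a b) x = act M p (q + r) a (act M q r b x)) \<and>
     (\<forall>i p q. \<forall>a\<in>carr K p. \<forall>x\<in>carr M q.
        Sq M i (p + q) (act M p q a x) =
          finprod (grade M (p + q + i))
            (\<lambda>k. act M (p + k) (q + (i - k)) (Sq K k p a) (Sq M (i - k) q x)) {..i})"

text \<open>\<open>K\<close> as a module over itself.\<close>

definition self_kmod :: "('a, 'x) ualg_scheme \<Rightarrow> ('a, 'a) kmod" where
  "self_kmod K = \<lparr>grade = grade K, Sq = Sq K, act = prd K\<rparr>"

definition Hom_K :: "('a, 'x) ualg_scheme \<Rightarrow> ('b, 'y) ualg_scheme \<Rightarrow> (nat \<Rightarrow> 'a \<Rightarrow> 'b) set" where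
  "Hom_K K L = {\<phi>. umod_hom K L \<phi> \<and>
     (\<forall>n. \<phi> n \<in> extensional (carr K n)) \<and>
     \<phi> 0 (unt K) = unt L \<and>
     (\<forall>p q. \<forall>x\<in>carr K p. \<forall>y\<in>carr K q.
        \<phi> (p + q) (prd K p q x y) = prd L p q (\<phi> p x) (\<phi> q y))}"


section \<open>The mod 2 cohomology of the classifying space \<open>BV\<close>\<close>

text \<open>
  \<open>BV\<close> is the quotient by \<open>V\<close> of the simplicial set \<open>EV\<close>, whose \<open>n\<close>-simplices are the lists of \<open>n + 1\<close>
  elements of \<open>V\<close>.  Its cohomology is computed by the normalised cochains of \<open>BV\<close>, that is, by
  the \<open>V\<close>-invariant \<open>\<bbbF>\<^sub>2\<close>-valued functions on the simplices of \<open>EV\<close> that vanish on the degenerate ones.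
\<close>

definition simplices :: "'v monoid \<Rightarrow> nat \<Rightarrow> 'v list set" where
  "simplices V n = {s. length s = n + 1 \<and> set s \<subseteq> carrier V}"

definition cochains :: "'v monoid \<Rightarrow> nat \<Rightarrow> ('v list \<Rightarrow> bit) monoid" where
  "cochains V n =
     \<lparr>carrier = {f. (\<forall>s. s \<notin> simplices V n \<longrightarrow> f s = 0) \<and>
                    (\<forall>s\<in>simplices V n. \<forall>v\<in>carrier V. f (map (\<lambda>x. v \<otimes>\<^bsub>V\<^esub> x) s) = f s) \<and>
                    (\<forall>s\<in>simplices V n. (\<exists>i<n. s ! i = s ! Suc i) \<longrightarrow> f s = 0)},
      monoid.mult = (\<lambda>f g s. f s + g s), one = (\<lambda>s. 0)\<rparr>"

definition cobound :: "'v monoid \<Rightarrow> nat \<Rightarrow> ('v list \<Rightarrow> bit) \<Rightarrow> 'v list \<Rightarrow> bit" where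
  "cobound V n f = (\<lambda>s. if s \<in> simplices V (n + 1)
     then \<Sum>i\<le>n + 1. f (take i s @ drop (Suc i) s) else 0)"

definition cocycles :: "'v monoid \<Rightarrow> nat \<Rightarrow> ('v list \<Rightarrow> bit) set" where
  "cocycles V n = {f \<in> carrier (cochains V n). cobound V n f = (\<lambda>s. 0)}"

definition cobounds :: "'v monoid \<Rightarrow> nat \<Rightarrow> ('v list \<Rightarrow> bit) set" where
  "cobounds V n = (if n = 0 then {\<lambda>s. 0} else cobound V (n - 1) ` carrier (cochains V (n - 1)))"

text \<open>
  Steenrod's cup-\<open>i\<close> product.  On an \<open>m\<close>-simplex \<open>s\<close> it is the sum over all
  \<open>0 \<le> j\<^sub>0 < \<dots> < j\<^sub>i \<le> m\<close> of \<open>f (s restricted to A) * g (s restricted to B)\<close>,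
  where \<open>A\<close> and \<open>B\<close> are the unions of every other one of the overlapping intervals
  \<open>[0, j\<^sub>0], [j\<^sub>0, j\<^sub>1], \<dots>, [j\<^sub>i, m]\<close>, beginning with \<open>[0, j\<^sub>0] \<subseteq> A\<close>.  A vertex \<open>v\<close> different from
  \<open>j\<^sub>0, \<dots>, j\<^sub>i\<close> therefore lies in \<open>A\<close> iff the number of the \<open>j\<close>'s below \<open>v\<close> is even.  Since cochains are zero
  off the simplices of their own dimension, only the terms with \<open>A\<close> and \<open>B\<close> of the
  right size contribute.
\<close>

definition cup_i :: "'v monoid \<Rightarrow> nat \<Rightarrow> nat \<Rightarrow> ('v list \<Rightarrow> bit) \<Rightarrow> ('v list \<Rightarrow> bit) \<Rightarrow> 'v list \<Rightarrow> bit" where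
  "cup_i V m i f g = (\<lambda>s. if s \<in> simplices V m
     then \<Sum>J\<in>{J. J \<subseteq> {..m} \<and> card J = i + 1}.
            f (nths s {v. v \<in> J \<or> even (card {j\<in>J. j < v})}) *
            g (nths s {v. v \<in> J \<or> odd (card {j\<in>J. j < v})})
     else 0)"

type_synonym 'v coh = "('v list \<Rightarrow> bit) set"

text \<open>\<open>H\<^sup>*(V)\<close>, with \<open>Sq\<^sup>i [f] = [f \<union>\<^sub>n\<^sub>-\<^sub>i f]\<close> for \<open>f\<close> of degree \<open>n\<close>, and with the cup product \<open>\<union>\<^sub>0\<close>.\<close>

definition H :: "'v monoid \<Rightarrow> 'v coh ualg" where
  "H V =
     \<lparr>grade = (\<lambda>n. (cochains V n)\<lparr>carrier := cocycles V n\<rparr> Mod cobounds V n),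
      Sq = (\<lambda>i n. coset_map (cochains V (n + i)) (cobounds V (n + i))
              (\<lambda>f. if i \<le> n then cup_i V (n + i) (n - i) f f else (\<lambda>s. 0))),
      prd = (\<lambda>p q X Y. \<Union>g\<in>Y. coset_map (cochains V (p + q)) (cobounds V (p + q))
              (\<lambda>f. cup_i V (p + q) 0 f g) X),
      unt = cobounds V 0 #>\<^bsub>cochains V 0\<^esub> (\<lambda>s. if s \<in> simplices V 0 then 1 else 0)\<rparr>"

text \<open>The map \<open>H\<^sup>*(V) \<rightarrow> H\<^sup>*(U)\<close> induced by a linear map \<open>\<alpha> : U \<rightarrow> V\<close>.\<close>

definition H_map :: "'u monoid \<Rightarrow> ('u \<Rightarrow> 'v) \<Rightarrow> nat \<Rightarrow> 'v coh \<Rightarrow> 'u coh" where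
  "H_map U \<alpha> n = coset_map (cochains U n) (cobounds U n)
     (\<lambda>f s. if s \<in> simplices U n then f (map \<alpha> s) else 0)"


section \<open>Lannes' functor\<close>

text \<open>
  \<open>H\<^sup>*(V)\<close> is of finite type, so a linear map \<open>f : M \<rightarrow> N \<otimes> H\<^sup>*(V)\<close> of degree zero is the same thing as a
  family of elements \<open>(1 \<otimes> c)(f x) \<in> N\<^sup>p\<^sup>-\<^sup>j\<close>, bilinear in \<open>x \<in> M\<^sup>p\<close> and in the functional \<open>c\<close> on \<open>H\<^sup>j(V)\<close>, \<open>j \<le> p\<close>;
  and \<open>f\<close> commutes with the Steenrod operations iff
  \<open>(1 \<otimes> c)(f (Sq\<^sup>i x)) = \<Sum>\<^sub>l Sq\<^sup>i\<^sup>-\<^sup>l ((1 \<otimes> (c \<circ> Sq\<^sup>l))(f x))\<close>.  So \<open>T\<^sub>V(M)\<close>, the object representing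
  \<open>N \<mapsto> Hom\<^sub>\<U>(M, N \<otimes> H\<^sup>*(V))\<close>, is the unstable module presented by generators \<open>[x, c]\<close> of
  degree \<open>p - j\<close>, bilinear in \<open>x\<close> and \<open>c\<close>, with the relations
  \<open>[Sq\<^sup>i x, c] = \<Sum>\<^sub>l Sq\<^sup>i\<^sup>-\<^sup>l [x, c \<circ> Sq\<^sup>l]\<close>.

  The basis element \<open>(w, p, x, j, c)\<close> stands for \<open>Sq\<^sup>w\<^sup>1 \<dots> Sq\<^sup>w\<^sup>k [x, c]\<close> with \<open>w = [w\<^sub>1, \<dots>, w\<^sub>k]\<close>.
\<close>

type_synonym ('a, 'v) lsym = "nat list \<times> nat \<times> 'a \<times> nat \<times> ('v coh \<Rightarrow> bit)"
type_synonym ('a, 'v) lannes = "(('a, 'v) lsym \<Rightarrow>\<^sub>0 bit) set"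

definition lannes_free :: "'v monoid \<Rightarrow> ('a, 'x) umod_scheme \<Rightarrow> (('a, 'v) lsym \<Rightarrow>\<^sub>0 bit) umod" where
  "lannes_free V M =
     \<lparr>grade = (\<lambda>n. free_space {(w, p, x, j, c).
         x \<in> carr M p \<and> j \<le> p \<and> c \<in> dual_space (grade (H V) j) \<and> sum_list w + (p - j) = n}),
      Sq = (\<lambda>i n u. \<Sum>(w, r)\<in>Poly_Mapping.keys u. gen (i # w, r))\<rparr>"

text \<open>In the last family, the summands with \<open>j - l > p\<close> are omitted: \<open>[x, c \<circ> Sq\<^sup>l]\<close> has
  negative degree and so is zero.\<close>

definition lannes_rels :: "'v monoid \<Rightarrow> ('a, 'x) umod_scheme \<Rightarrow> nat \<Rightarrow> (('a, 'v) lsym \<Rightarrow>\<^sub>0 bit) set" where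
  "lannes_rels V M n =
     {gen ([], p, x \<otimes>\<^bsub>grade M p\<^esub> x', j, c) + gen ([], p, x, j, c) + gen ([], p, x', j, c) | p x x' j c.
        x \<in> carr M p \<and> x' \<in> carr M p \<and> j \<le> p \<and> c \<in> dual_space (grade (H V) j) \<and> p - j = n} \<union>
     {gen ([], p, x, j, restrict (\<lambda>h. c h + c' h) (carr (H V) j)) +
        gen ([], p, x, j, c) + gen ([], p, x, j, c') | p x j c c'.
        x \<in> carr M p \<and> j \<le> p \<and> c \<in> dual_space (grade (H V) j) \<and>
        c' \<in> dual_space (grade (H V) j) \<and> p - j = n} \<union>
     {gen ([], p + i, Sq M i p x, j, c) +
        (\<Sum>l\<in>{l. l \<le> i \<and> l \<le> j \<and> j - l \<le> p}.
           gen ([i - l], p, x, j - l, restrict (\<lambda>h. c (Sq (H V) l (j - l) h)) (carr (H V) (j - l))))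
        | i p x j c.
        x \<in> carr M p \<and> j \<le> p + i \<and> c \<in> dual_space (grade (H V) j) \<and> p + i - j = n}"

definition unstable_rels :: "('a, 'x) umod_scheme \<Rightarrow> nat \<Rightarrow> 'a set" where
  "unstable_rels X n =
     {Sq X 0 n x \<otimes>\<^bsub>grade X n\<^esub> x | x. x \<in> carr X n} \<union>
     {Sq X a (m + b) (Sq X b m x) \<otimes>\<^bsub>grade X n\<^esub> adem_rhs X a b m x | a b m x.
        x \<in> carr X m \<and> 0 < a \<and> a < 2 * b \<and> m + a + b = n} \<union>
     {Sq X i m x | i m x. x \<in> carr X m \<and> m < i \<and> m + i = n}"

definition lannes_sub :: "'v monoid \<Rightarrow> ('a, 'x) umod_scheme \<Rightarrow> nat \<Rightarrow> (('a, 'v) lsym \<Rightarrow>\<^sub>0 bit) set" where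
  "lannes_sub V M =
     submod (lannes_free V M) (\<lambda>n. lannes_rels V M n \<union> unstable_rels (lannes_free V M) n)"

definition T :: "'v monoid \<Rightarrow> ('a, 'x) umod_scheme \<Rightarrow> ('a, 'v) lannes umod" where
  "T V M = quot_umod (lannes_free V M) (lannes_sub V M)"

text \<open>The element \<open>[x, c]\<close> of \<open>T\<^sub>V(M)\<close>.\<close>

definition lannes_gen ::
  "'v monoid \<Rightarrow> ('a, 'x) umod_scheme \<Rightarrow> nat \<Rightarrow> 'a \<Rightarrow> nat \<Rightarrow> ('v coh \<Rightarrow> bit) \<Rightarrow> ('a, 'v) lannes" where
  "lannes_gen V M p x j c =
     lannes_sub V M (p - j) #>\<^bsub>grade (lannes_free V M) (p - j)\<^esub> gen ([], p, x, j, c)"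

text \<open>\<open>T\<^sub>V(f) : T\<^sub>V(M) \<rightarrow> T\<^sub>V(N)\<close> for \<open>f : M \<rightarrow> N\<close>.\<close>

definition T_map :: "'v monoid \<Rightarrow> ('a, 'x) umod_scheme \<Rightarrow> ('b, 'y) umod_scheme \<Rightarrow> (nat \<Rightarrow> 'a \<Rightarrow> 'b) \<Rightarrow>
    nat \<Rightarrow> ('a, 'v) lannes \<Rightarrow> ('b, 'v) lannes" where
  "T_map V M N f n = coset_map (grade (lannes_free V N) n) (lannes_sub V N n)
     (\<lambda>u. \<Sum>(w, p, x, j, c)\<in>Poly_Mapping.keys u. gen (w, p, f p x, j, c))"

text \<open>\<open>T\<^sub>U(N) \<rightarrow> T\<^sub>V(N)\<close> for a linear map \<open>\<alpha> : U \<rightarrow> V\<close>.\<close>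

definition T_nat :: "'u monoid \<Rightarrow> 'v monoid \<Rightarrow> ('u \<Rightarrow> 'v) \<Rightarrow> ('a, 'x) umod_scheme \<Rightarrow>
    nat \<Rightarrow> ('a, 'u) lannes \<Rightarrow> ('a, 'v) lannes" where
  "T_nat U V \<alpha> N n = coset_map (grade (lannes_free V N) n) (lannes_sub V N n)
     (\<lambda>u. \<Sum>(w, p, x, j, c)\<in>Poly_Mapping.keys u.
        gen (w, p, x, j, restrict (\<lambda>h. c (H_map U \<alpha> j h)) (carr (H V) j)))"


subsection \<open>The adjunction\<close>

text \<open>\<open>(1 \<otimes> c) z \<in> N\<^sup>p\<^sup>-\<^sup>j\<close> for \<open>z\<close> of degree \<open>p\<close> in \<open>N \<otimes> H\<^sup>*(V)\<close> and a functional \<open>c\<close> on \<open>H\<^sup>j(V)\<close>.\<close>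

definition slant :: "('b, 'y) umod_scheme \<Rightarrow> nat \<Rightarrow> nat \<Rightarrow> ('v coh \<Rightarrow> bit) \<Rightarrow> ('b, 'v coh) tens \<Rightarrow> 'b" where
  "slant N p j c = lin_ext_quot (grade N (p - j))
     (\<lambda>(a, y, b, h). if b = j \<and> c h = 1 then y else \<one>\<^bsub>grade N (p - j)\<^esub>)"

text \<open>\<open>Sq_word N d [w\<^sub>1, \<dots>, w\<^sub>k] y = Sq\<^sup>w\<^sup>1 \<dots> Sq\<^sup>w\<^sup>k y\<close> for \<open>y\<close> of degree \<open>d\<close>.\<close>

primrec Sq_word :: "('b, 'y) umod_scheme \<Rightarrow> nat \<Rightarrow> nat list \<Rightarrow> 'b \<Rightarrow> 'b" where
  "Sq_word N d [] y = y"
| "Sq_word N d (i # w) y = Sq N i (d + sum_list w) (Sq_word N d w y)"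

text \<open>The map \<open>T\<^sub>V(M) \<rightarrow> N\<close> adjoint to \<open>f : M \<rightarrow> N \<otimes> H\<^sup>*(V)\<close>; it sends \<open>[x, c]\<close> to \<open>(1 \<otimes> c)(f x)\<close>.\<close>

definition T_adj :: "('b, 'y) umod_scheme \<Rightarrow> (nat \<Rightarrow> 'a \<Rightarrow> ('b, 'v coh) tens) \<Rightarrow>
    nat \<Rightarrow> ('a, 'v) lannes \<Rightarrow> 'b" where
  "T_adj N f n = lin_ext_quot (grade N n)
     (\<lambda>(w, p, x, j, c). Sq_word N (p - j) w (slant N p j c (f p x)))"

text \<open>The unit \<open>M \<rightarrow> T\<^sub>V(M) \<otimes> H\<^sup>*(V)\<close> of the adjunction, the map whose adjoint is the identity.
  The value is unique because \<open>H\<^sup>*(V)\<close> is of finite type; it equals \<open>\<Sum> [x, b\<^sup>*] \<otimes> b\<close>, where \<open>b\<close>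
  runs through homogeneous bases of the \<open>H\<^sup>j(V)\<close>, \<open>j \<le> p\<close>.\<close>

definition T_unit :: "'v monoid \<Rightarrow> ('a, 'x) umod_scheme \<Rightarrow> nat \<Rightarrow> 'a \<Rightarrow> (('a, 'v) lannes, 'v coh) tens" where
  "T_unit V M p x = (THE z. z \<in> carr (tensor (T V M) (H V)) p \<and>
     (\<forall>j\<le>p. \<forall>c\<in>dual_space (grade (H V) j). slant (T V M) p j c z = lannes_gen V M p x j c))"


subsection \<open>Tensor products and multiplicative structures\<close>

text \<open>\<open>(u \<otimes> h, u' \<otimes> h') \<mapsto> (u \<otimes> u') \<otimes> h h'\<close>, as a map
  \<open>(P \<otimes> H\<^sup>*(V)) \<times> (Q \<otimes> H\<^sup>*(V)) \<rightarrow> (P \<otimes> Q) \<otimes> H\<^sup>*(V)\<close> on elements of degree \<open>p\<close> and \<open>q\<close>.\<close>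

definition tensor_mix :: "'v monoid \<Rightarrow> ('a, 'x) umod_scheme \<Rightarrow> ('b, 'y) umod_scheme \<Rightarrow> nat \<Rightarrow> nat \<Rightarrow>
    ('a, 'v coh) tens \<Rightarrow> ('b, 'v coh) tens \<Rightarrow> (('a, 'b) tens, 'v coh) tens" where
  "tensor_mix V P Q p q z z' =
     (let G = grade (tensor (tensor P Q) (H V)) (p + q) in
      lin_ext_quot G (\<lambda>(a, u, b, h).
        lin_ext_quot G (\<lambda>(a', u', b', h').
          pure (tensor P Q) (H V) (a + a') (pure P Q a u a' u') (b + b') (prd (H V) b b' h h')) z') z)"

text \<open>The canonical isomorphism \<open>T\<^sub>V(M \<otimes> N) \<rightarrow> T\<^sub>V(M) \<otimes> T\<^sub>V(N)\<close>, adjoint to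
  \<open>M \<otimes> N \<rightarrow> (T\<^sub>V(M) \<otimes> H\<^sup>*(V)) \<otimes> (T\<^sub>V(N) \<otimes> H\<^sup>*(V)) \<rightarrow> T\<^sub>V(M) \<otimes> T\<^sub>V(N) \<otimes> H\<^sup>*(V)\<close>.\<close>

definition T_tensor :: "'v monoid \<Rightarrow> ('a, 'x) umod_scheme \<Rightarrow> ('b, 'y) umod_scheme \<Rightarrow> nat \<Rightarrow>
    (('a, 'b) tens, 'v) lannes \<Rightarrow> (('a, 'v) lannes, ('b, 'v) lannes) tens" where
  "T_tensor V M N = T_adj (tensor (T V M) (T V N))
     (\<lambda>n. lin_ext_quot (grade (tensor (tensor (T V M) (T V N)) (H V)) n)
        (\<lambda>(p, x, q, y). tensor_mix V (T V M) (T V N) p q (T_unit V M p x) (T_unit V N q y)))"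

text \<open>The action of \<open>T\<^sub>V(K)\<close> on \<open>T\<^sub>V(M)\<close>: the composite
  \<open>T\<^sub>V(K) \<otimes> T\<^sub>V(M) \<cong> T\<^sub>V(K \<otimes> M) \<rightarrow> T\<^sub>V(M)\<close>, where the second map is \<open>T\<^sub>V\<close> of the action.
  For \<open>M = self_kmod K\<close> this is the product of \<open>T\<^sub>V(K)\<close>.\<close>

definition act_map :: "('a, 'm, 'y) kmod_scheme \<Rightarrow> nat \<Rightarrow> ('a, 'm) tens \<Rightarrow> 'm" where
  "act_map M n = lin_ext_quot (grade M n) (\<lambda>(p, a, q, x). act M p q a x)"

definition T_act :: "'v monoid \<Rightarrow> ('a, 'x) ualg_scheme \<Rightarrow> ('a, 'm, 'y) kmod_scheme \<Rightarrow> nat \<Rightarrow> nat \<Rightarrow>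
    ('a, 'v) lannes \<Rightarrow> ('m, 'v) lannes \<Rightarrow> ('m, 'v) lannes" where
  "T_act V K M p q r x = T_map V (tensor K M) M (act_map M) (p + q)
     (the_inv_into (carr (T V (tensor K M)) (p + q)) (T_tensor V K M (p + q))
        (pure (T V K) (T V M) p r q x))"


section \<open>The components \<open>T\<^sub>(\<^sub>V\<^sub>,\<^sub>\<phi>\<^sub>)\<close>\<close>

text \<open>The ring map \<open>T\<^sub>V(K)\<^sup>0 \<rightarrow> \<bbbF>\<^sub>2\<close>, the degree \<open>0\<close> part of the map \<open>T\<^sub>V(K) \<rightarrow> \<bbbF>\<^sub>2\<close> adjoint to
  \<open>\<phi> : K \<rightarrow> H\<^sup>*(V) = \<bbbF>\<^sub>2 \<otimes> H\<^sup>*(V)\<close>.\<close>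

definition char_of :: "'v monoid \<Rightarrow> (nat \<Rightarrow> 'a \<Rightarrow> 'v coh) \<Rightarrow> ('a, 'v) lannes \<Rightarrow> bit" where
  "char_of V \<phi> = T_adj F2_umod (\<lambda>n x. pure F2_umod (H V) 0 1 n (\<phi> n x)) 0"

text \<open>
  \<open>T\<^sub>V(M) \<otimes> \<bbbF>\<^sub>2(\<phi>)\<close> over \<open>T\<^sub>V(K)\<^sup>0\<close>, formed in \<open>\<U>\<close>: the coequaliser of the two maps
  \<open>T\<^sub>V(K)\<^sup>0 \<otimes> T\<^sub>V(M) \<otimes> \<bbbF>\<^sub>2 \<rightarrow> T\<^sub>V(M) \<otimes> \<bbbF>\<^sub>2\<close>.  Since \<open>T\<^sub>V(K)\<^sup>0\<close> is in degree zero, the Cartan formula shows that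
  the subspace spanned by the elements of \<open>T_phi_rels\<close> is already stable under the \<open>Sq\<^sup>i\<close>.
\<close>

definition T_phi_rels :: "'v monoid \<Rightarrow> (nat \<Rightarrow> 'a \<Rightarrow> 'v coh) \<Rightarrow> ('a, 'x) ualg_scheme \<Rightarrow>
    ('a, 'm, 'y) kmod_scheme \<Rightarrow> nat \<Rightarrow> (('m, 'v) lannes, bit) tens set" where
  "T_phi_rels V \<phi> K M n =
     {pure (T V M) F2_umod n (T_act V K M 0 n r x) 0 e
        \<otimes>\<^bsub>grade (tensor (T V M) F2_umod) n\<^esub> pure (T V M) F2_umod n x 0 (char_of V \<phi> r * e) | r x e.
      r \<in> carr (T V K) 0 \<and> x \<in> carr (T V M) n}"

definition T_phi_sub :: "'v monoid \<Rightarrow> (nat \<Rightarrow> 'a \<Rightarrow> 'v coh) \<Rightarrow> ('a, 'x) ualg_scheme \<Rightarrow>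
    ('a, 'm, 'y) kmod_scheme \<Rightarrow> nat \<Rightarrow> (('m, 'v) lannes, bit) tens set" where
  "T_phi_sub V \<phi> K M = submod (tensor (T V M) F2_umod) (T_phi_rels V \<phi> K M)"

definition T_phi :: "'v monoid \<Rightarrow> (nat \<Rightarrow> 'a \<Rightarrow> 'v coh) \<Rightarrow> ('a, 'x) ualg_scheme \<Rightarrow>
    ('a, 'm, 'y) kmod_scheme \<Rightarrow> (('m, 'v) lannes, bit) tens set umod" where
  "T_phi V \<phi> K M = quot_umod (tensor (T V M) F2_umod) (T_phi_sub V \<phi> K M)"

abbreviation zero_sub :: "'v monoid \<Rightarrow> 'v monoid" where
  "zero_sub V \<equiv> V\<lparr>carrier := {\<one>\<^bsub>V\<^esub>}\<rparr>"

text \<open>The isomorphism \<open>N \<cong> T\<^sub>0(N)\<close> sends \<open>x\<close> to \<open>[x, \<epsilon>]\<close>, where \<open>\<epsilon> : H\<^sup>0(0) \<rightarrow> \<bbbF>\<^sub>2\<close> is the isomorphism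
  that evaluates a cochain at the vertex.\<close>

definition T_zero :: "'v monoid \<Rightarrow> ('a, 'x) umod_scheme \<Rightarrow> nat \<Rightarrow> 'a \<Rightarrow> ('a, 'v) lannes" where
  "T_zero V N n x = lannes_gen (zero_sub V) N n x 0
     (restrict (\<lambda>X. the_elem ((\<lambda>f. f [\<one>\<^bsub>V\<^esub>]) ` X)) (carr (H (zero_sub V)) 0))"

definition rho :: "'v monoid \<Rightarrow> ('a, 'x) umod_scheme \<Rightarrow> nat \<Rightarrow> 'a \<Rightarrow> ('a, 'v) lannes" where
  "rho V N n x = T_nat (zero_sub V) V (\<lambda>v. v) N n (T_zero V N n x)"

definition rho_phi :: "'v monoid \<Rightarrow> (nat \<Rightarrow> 'a \<Rightarrow> 'v coh) \<Rightarrow> ('a, 'x) ualg_scheme \<Rightarrow>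
    ('a, 'm, 'y) kmod_scheme \<Rightarrow> nat \<Rightarrow> 'm \<Rightarrow> (('m, 'v) lannes, bit) tens set" where
  "rho_phi V \<phi> K M n x =
     T_phi_sub V \<phi> K M n #>\<^bsub>grade (tensor (T V M) F2_umod) n\<^esub> pure (T V M) F2_umod n (rho V M n x) 0 1"


section \<open>Truncation\<close>

definition high_part :: "nat \<Rightarrow> ('a, 'x) umod_scheme \<Rightarrow> nat \<Rightarrow> 'a set" where
  "high_part k N n = (if k \<le> n then carr N n else {\<one>\<^bsub>grade N n\<^esub>})"

definition trunc :: "nat \<Rightarrow> ('a, 'x) umod_scheme \<Rightarrow> 'a set umod" where
  "trunc k N = quot_umod N (high_part k N)"

definition trunc_map :: "nat \<Rightarrow> ('b, 'y) umod_scheme \<Rightarrow> (nat \<Rightarrow> 'a \<Rightarrow> 'b) \<Rightarrow> nat \<Rightarrow> 'a set \<Rightarrow> 'b set" where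
  "trunc_map k N f n = coset_map (grade N n) (high_part k N n) (f n)"

text \<open>\<open>f\<^sup><\<^sup>k(\<theta>)\<close> is an isomorphism, for \<open>\<theta> : M \<rightarrow> N\<close>; \<open>'v\<close> is the type over which the vector
  spaces \<open>V\<close> range.\<close>

definition f_trunc_iso :: "'v itself \<Rightarrow> nat \<Rightarrow> ('a, 'x) umod_scheme \<Rightarrow> ('b, 'y) umod_scheme \<Rightarrow>
    (nat \<Rightarrow> 'a \<Rightarrow> 'b) \<Rightarrow> bool" where
  "f_trunc_iso _ k M N \<theta> \<longleftrightarrow> (\<forall>V :: 'v monoid \<in> Vf.
     umod_iso (trunc k (T V M)) (trunc k (T V N)) (trunc_map k (T V N) (T_map V M N \<theta>)))"


section \<open>Central elements\<close>

definition M_central :: "('a, 'm, 'y) kmod_scheme \<Rightarrow> ('a, 'x) ualg_scheme \<Rightarrow>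
    ('v monoid \<times> (nat \<Rightarrow> 'a \<Rightarrow> 'v coh)) set" where
  "M_central M K = {(W, \<phi>). W \<in> Vf \<and> \<phi> \<in> Hom_K K (H W) \<and>
     umod_iso M (T_phi W \<phi> K M) (rho_phi W \<phi> K M)}"

definition M_central_k :: "nat \<Rightarrow> ('a, 'm, 'y) kmod_scheme \<Rightarrow> ('a, 'x) ualg_scheme \<Rightarrow>
    ('v monoid \<times> (nat \<Rightarrow> 'a \<Rightarrow> 'v coh)) set" where
  "M_central_k k M K = {(W, \<phi>). W \<in> Vf \<and> \<phi> \<in> Hom_K K (H W) \<and>
     f_trunc_iso TYPE('v) k M (T_phi W \<phi> K M) (rho_phi W \<phi> K M)}"

definition central :: "('a, 'x) ualg_scheme \<Rightarrow> ('v monoid \<times> (nat \<Rightarrow> 'a \<Rightarrow> 'v coh)) set" where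
  "central K = M_central (self_kmod K) K"

definition central_k :: "nat \<Rightarrow> ('a, 'x) ualg_scheme \<Rightarrow> ('v monoid \<times> (nat \<Rightarrow> 'a \<Rightarrow> 'v coh)) set" where
  "central_k k K = M_central_k k (self_kmod K) K"

end

theory Submission
  imports Defs
begin

text \<open>
  Both equalities are instances of one criterion (\<open>umod_iso_iff_f_trunc_iso\<close>): a homomorphism
  \<open>\<theta> : M \<rightarrow> N\<close> of unstable modules is an isomorphism iff \<open>T_V(\<theta>)\<close> is an isomorphism in degrees below \<open>k\<close>,
  for all \<open>k \<ge> 1\<close> and all \<open>V\<close>.  If \<open>\<theta>\<close> is an isomorphism, so are \<open>T_V(\<theta>)\<close> and its truncations, by
  functoriality (\<open>T_map_iso\<close>, \<open>trunc_map_iso\<close>).  Conversely, the truncations for all \<open>k\<close> together show that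
  \<open>T_V(\<theta>)\<close> is bijective in every degree, and it is enough to know this for \<open>V = 0\<close>, because
  \<open>T_0\<close> is naturally isomorphic to the identity functor.

  A natural retraction suffices for this.  The map \<open>x \<mapsto> [x, \<epsilon>]\<close> from \<open>N\<close> to
  \<open>T_0(N)\<close>, with \<open>\<epsilon>\<close> the evaluation at the vertex, has the left inverse
  \<open>[x, c] \<mapsto> c(1) x\<close>.  It is defined on the free module that presents \<open>T_0(N)\<close> and kills the defining
  relations, since \<open>N\<close> is unstable and since \<open>H\<^sup>*(0)\<close>, computed from normalised cochains, is \<open>\<bbbF>\<^sub>2\<close>,
  concentrated in degree zero (\<open>eval_free_kills\<close>).  A diagram chase gives the bijectivity of \<open>\<theta>\<close> (\<open>bij_if_T_zero_bij\<close>).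

  To apply the criterion to \<open>\<theta> = \<rho>\<^sub>M\<^sub>,\<^sub>(\<^sub>V\<^sub>,\<^sub>\<phi>\<^sub>)\<close>, its target has to be unstable and \<open>\<theta>\<close> has to be a
  homomorphism.  The target is a quotient of \<open>T_V(M) \<otimes> \<bbbF>\<^sub>2\<close>, and instability passes to surjective images
  (\<open>unstable_T\<close>, \<open>unstable_tensor_F2\<close>, \<open>unstable_T_phi\<close>).  The map is the composite of
  \<open>\<rho>\<^sub>M\<^sub>,\<^sub>V\<close>, of \<open>x \<mapsto> x \<otimes> 1\<close> and of a projection.  Here \<open>\<rho>\<^sub>M\<^sub>,\<^sub>V\<close> is \<open>x \<mapsto> [x, d]\<close> for a functional \<open>d\<close> on \<open>H\<^sup>0(V)\<close>; that
  this is a homomorphism, and that \<open>T_0(M) \<rightarrow> T_V(M)\<close> is well defined, comes down to the Steenrod operations on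
  \<open>H\<^sup>0(V)\<close> and on \<open>H\<^sup>*(0)\<close>, which are explicit (\<open>Sq_0_rel\<close>, \<open>Sq_rel_res_dual\<close>).
\<close>

section \<open>Vector spaces over the field with two elements\<close>

lemma F2_spaceD:
  assumes "F2_space G"
  shows "comm_group G" "group G" "comm_monoid G" "monoid G"
    "\<And>x. x \<in> carrier G \<Longrightarrow> x \<otimes>\<^bsub>G\<^esub> x = \<one>\<^bsub>G\<^esub>"
    "\<And>x y. x \<in> carrier G \<Longrightarrow> y \<in> carrier G \<Longrightarrow> x \<otimes>\<^bsub>G\<^esub> y \<in> carrier G"
    "\<one>\<^bsub>G\<^esub> \<in> carrier G"
    "\<And>x. x \<in> carrier G \<Longrightarrow> inv\<^bsub>G\<^esub> x = x"
proof -
  show c: "comm_group G" and sq: "\<And>x. x \<in> carrier G \<Longrightarrow> x \<otimes>\<^bsub>G\<^esub> x = \<one>\<^bsub>G\<^esub>"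
    using assms by (auto simp: F2_space_def)
  interpret comm_group G by (rule c)
  show "group G" "comm_monoid G" "monoid G" by unfold_locales
  show "\<And>x y. x \<in> carrier G \<Longrightarrow> y \<in> carrier G \<Longrightarrow> x \<otimes>\<^bsub>G\<^esub> y \<in> carrier G" by simp
  show "\<one>\<^bsub>G\<^esub> \<in> carrier G" by simp
  show "\<And>x. x \<in> carrier G \<Longrightarrow> inv\<^bsub>G\<^esub> x = x" using sq by (simp add: inv_equality)
qed

lemma F2_space_eq_iff:
  assumes "F2_space G" "x \<in> carrier G" "y \<in> carrier G"
  shows "x \<otimes>\<^bsub>G\<^esub> y = \<one>\<^bsub>G\<^esub> \<longleftrightarrow> x = y"
proof -
  interpret comm_group G by (rule F2_spaceD[OF assms(1)])
  show ?thesis using assms F2_spaceD(5,8)[OF assms(1)] by (metis inv_equality)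
qed

lemma F2_subgroupI:
  assumes "F2_space G" "S \<subseteq> carrier G" "\<one>\<^bsub>G\<^esub> \<in> S"
    "\<And>x y. x \<in> S \<Longrightarrow> y \<in> S \<Longrightarrow> x \<otimes>\<^bsub>G\<^esub> y \<in> S"
  shows "subgroup S G"
proof -
  interpret comm_group G by (rule F2_spaceD[OF assms(1)])
  show ?thesis
    using assms F2_spaceD(8)[OF assms(1)] by (intro subgroup.intro) (auto simp: subset_iff)
qed

lemma hom_closed: "f \<in> hom G G' \<Longrightarrow> x \<in> carrier G \<Longrightarrow> f x \<in> carrier G'"
  by (auto simp: hom_def)

lemma F2_hom_one:
  assumes "f \<in> hom G G'" "F2_space G" "F2_space G'"
  shows "f \<one>\<^bsub>G\<^esub> = \<one>\<^bsub>G'\<^esub>"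
  using hom_one[OF assms(1)] F2_spaceD(2)[OF assms(2)] F2_spaceD(2)[OF assms(3)] by simp

lemma F2_space_image:
  assumes "F2_space G" "group G'" "f \<in> hom G G'" "f ` carrier G = carrier G'"
  shows "F2_space G'"
proof -
  interpret G: comm_group G by (rule F2_spaceD[OF assms(1)])
  interpret G': group G' by (rule assms)
  have one: "f \<one>\<^bsub>G\<^esub> = \<one>\<^bsub>G'\<^esub>" using hom_one[OF assms(3)] by (simp add: G.is_group)
  have "x \<otimes>\<^bsub>G'\<^esub> y = y \<otimes>\<^bsub>G'\<^esub> x" if "x \<in> carrier G'" "y \<in> carrier G'" for x y
  proof -
    obtain a b where ab: "a \<in> carrier G" "b \<in> carrier G" "x = f a" "y = f b"
      using \<open>x \<in> carrier G'\<close> \<open>y \<in> carrier G'\<close> unfolding assms(4)[symmetric] by blast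
    then have "x \<otimes>\<^bsub>G'\<^esub> y = f (a \<otimes>\<^bsub>G\<^esub> b)" "y \<otimes>\<^bsub>G'\<^esub> x = f (b \<otimes>\<^bsub>G\<^esub> a)"
      using hom_mult[OF assms(3)] by auto
    then show ?thesis using ab G.m_comm by simp
  qed
  moreover have "x \<otimes>\<^bsub>G'\<^esub> x = \<one>\<^bsub>G'\<^esub>" if "x \<in> carrier G'" for x
  proof -
    obtain a where a: "a \<in> carrier G" "x = f a"
      using \<open>x \<in> carrier G'\<close> unfolding assms(4)[symmetric] by blast
    then have "x \<otimes>\<^bsub>G'\<^esub> x = f (a \<otimes>\<^bsub>G\<^esub> a)" using hom_mult[OF assms(3)] by auto
    then show ?thesis using a one F2_spaceD(5)[OF assms(1)] by simp
  qed
  ultimately show ?thesis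
    unfolding F2_space_def using G'.group_comm_groupI by blast
qed

lemma hom_finprod_F2:
  assumes "F2_space G" "F2_space G'" "f \<in> hom G G'" "g \<in> A \<rightarrow> carrier G"
  shows "f (finprod G g A) = finprod G' (\<lambda>x. f (g x)) A"
proof -
  interpret G: comm_group G by (rule F2_spaceD[OF assms(1)])
  interpret G': comm_group G' by (rule F2_spaceD[OF assms(2)])
  have one: "f \<one>\<^bsub>G\<^esub> = \<one>\<^bsub>G'\<^esub>" by (rule F2_hom_one[OF assms(3,1,2)])
  show ?thesis
  proof (cases "finite A")
    case True
    then show ?thesis using assms(4)
    proof induction
      case empty
      then show ?case by (simp add: one)
    next
      case (insert a A)
      have "(\<lambda>x. f (g x)) \<in> A \<rightarrow> carrier G'" "f (g a) \<in> carrier G'"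
        using insert.prems hom_closed[OF assms(3)] by auto
      then show ?case using insert hom_mult[OF assms(3)] by (simp add: Pi_iff)
    qed
  qed (simp add: one)
qed

subsection \<open>Quotients\<close>

lemma quot_hom:
  assumes "F2_space G" "subgroup S G"
  shows "(\<lambda>x. S #>\<^bsub>G\<^esub> x) \<in> hom G (G Mod S)"
proof -
  interpret comm_group G by (rule F2_spaceD[OF assms(1)])
  interpret normal S G by (rule subgroup_imp_normal[OF assms(2)])
  show ?thesis by (rule r_coset_hom_Mod)
qed

lemma carrier_quot: "carrier (G Mod S) = (\<lambda>x. S #>\<^bsub>G\<^esub> x) ` carrier G"
  by (auto simp: FactGroup_def RCOSETS_def)

lemma one_quot: "\<one>\<^bsub>G Mod S\<^esub> = S"
  by (simp add: FactGroup_def)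

lemma F2_space_quot:
  assumes "F2_space G" "subgroup S G"
  shows "F2_space (G Mod S)"
proof -
  interpret comm_group G by (rule F2_spaceD[OF assms(1)])
  interpret normal S G by (rule subgroup_imp_normal[OF assms(2)])
  show ?thesis
    by (rule F2_space_image[OF assms(1) factorgroup_is_group quot_hom[OF assms]])
      (simp add: carrier_quot)
qed

lemma coset_eq_iff:
  assumes "F2_space G" "subgroup S G" "x \<in> carrier G" "y \<in> carrier G"
  shows "S #>\<^bsub>G\<^esub> x = S #>\<^bsub>G\<^esub> y \<longleftrightarrow> x \<otimes>\<^bsub>G\<^esub> y \<in> S"
proof -
  interpret comm_group G by (rule F2_spaceD[OF assms(1)])
  have "S #>\<^bsub>G\<^esub> x = S #>\<^bsub>G\<^esub> y \<longleftrightarrow> x \<in> S #>\<^bsub>G\<^esub> y"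
    using repr_independence[OF _ assms(4,2), of x] rcos_self[OF assms(3,2)] by auto
  also have "\<dots> \<longleftrightarrow> x \<otimes>\<^bsub>G\<^esub> y \<in> S"
    using subgroup.rcos_module[OF assms(2) is_group assms(4,3)] F2_spaceD(8)[OF assms(1,4)] by simp
  finally show ?thesis .
qed

lemma coset_eq_self_iff:
  assumes "F2_space G" "subgroup S G" "x \<in> carrier G"
  shows "S #>\<^bsub>G\<^esub> x = S \<longleftrightarrow> x \<in> S"
proof -
  interpret comm_group G by (rule F2_spaceD[OF assms(1)])
  show ?thesis using coset_join1[OF _ assms(3,2)] coset_join2[OF assms(3,2)] by auto
qed

lemma coset_elem:
  assumes "F2_space G" "subgroup S G" "x \<in> carrier G" "y \<in> S #>\<^bsub>G\<^esub> x"
  shows "y \<in> carrier G" "y \<otimes>\<^bsub>G\<^esub> x \<in> S"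
proof -
  interpret comm_group G by (rule F2_spaceD[OF assms(1)])
  show y: "y \<in> carrier G" using r_coset_subset_G[OF subgroup.subset[OF assms(2)] assms(3)] assms(4) by auto
  show "y \<otimes>\<^bsub>G\<^esub> x \<in> S"
    using assms y subgroup.rcos_module[OF assms(2) is_group assms(3) y] F2_spaceD(8)[OF assms(1,3)]
    by simp
qed

lemma coset_self:
  assumes "F2_space G" "subgroup S G" "x \<in> carrier G"
  shows "x \<in> S #>\<^bsub>G\<^esub> x"
proof -
  interpret comm_group G by (rule F2_spaceD[OF assms(1)])
  show ?thesis by (rule rcos_self[OF assms(3,2)])
qed

text \<open>The maps on quotients are defined as unions over all representatives.  As \<open>f\<close> carries \<open>S\<close>
  into \<open>S'\<close>, all of them yield the same coset.\<close>

lemma coset_map_coset: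
  assumes "F2_space G" "F2_space G'" "subgroup S G" "subgroup S' G'"
    "f \<in> hom G G'" "f ` S \<subseteq> S'" "x \<in> carrier G"
  shows "coset_map G' S' f (S #>\<^bsub>G\<^esub> x) = S' #>\<^bsub>G'\<^esub> f x"
proof -
  have "S' #>\<^bsub>G'\<^esub> f y = S' #>\<^bsub>G'\<^esub> f x" if "y \<in> S #>\<^bsub>G\<^esub> x" for y
  proof -
    note y = coset_elem[OF assms(1,3,7) that]
    have "f y \<otimes>\<^bsub>G'\<^esub> f x = f (y \<otimes>\<^bsub>G\<^esub> x)" using hom_mult[OF assms(5)] y assms(7) by simp
    then have "f y \<otimes>\<^bsub>G'\<^esub> f x \<in> S'" using y assms(6) by auto
    then show ?thesis using coset_eq_iff[OF assms(2,4)] hom_closed[OF assms(5)] y assms(7) by blast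
  qed
  then show ?thesis
    unfolding coset_map_def using coset_self[OF assms(1,3,7)] by blast
qed

lemma coset_map_hom:
  assumes "F2_space G" "F2_space G'" "subgroup S G" "subgroup S' G'"
    "f \<in> hom G G'" "f ` S \<subseteq> S'"
  shows "coset_map G' S' f \<in> hom (G Mod S) (G' Mod S')"
proof (rule homI)
  note c = coset_map_coset[OF assms]
  note q = quot_hom[OF assms(1,3)] and q' = quot_hom[OF assms(2,4)]
  fix X assume "X \<in> carrier (G Mod S)"
  then obtain x where x: "x \<in> carrier G" "X = S #>\<^bsub>G\<^esub> x" by (auto simp: carrier_quot)
  then show "coset_map G' S' f X \<in> carrier (G' Mod S')"
    using hom_closed[OF assms(5)] by (auto simp: c carrier_quot)
  fix Y assume "Y \<in> carrier (G Mod S)"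
  then obtain y where y: "y \<in> carrier G" "Y = S #>\<^bsub>G\<^esub> y" by (auto simp: carrier_quot)
  have xy: "x \<otimes>\<^bsub>G\<^esub> y \<in> carrier G" using F2_spaceD(6)[OF assms(1)] x y by blast
  have "coset_map G' S' f (X \<otimes>\<^bsub>G Mod S\<^esub> Y) = coset_map G' S' f (S #>\<^bsub>G\<^esub> (x \<otimes>\<^bsub>G\<^esub> y))"
    using hom_mult[OF q] x y by simp
  also have "\<dots> = S' #>\<^bsub>G'\<^esub> (f x \<otimes>\<^bsub>G'\<^esub> f y)"
    using c[OF xy] hom_mult[OF assms(5)] x y by simp
  also have "\<dots> = coset_map G' S' f X \<otimes>\<^bsub>G' Mod S'\<^esub> coset_map G' S' f Y"
    using hom_mult[OF q'] hom_closed[OF assms(5)] x y by (simp add: c)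
  finally show "coset_map G' S' f (X \<otimes>\<^bsub>G Mod S\<^esub> Y) =
      coset_map G' S' f X \<otimes>\<^bsub>G' Mod S'\<^esub> coset_map G' S' f Y" .
qed

subsection \<open>Free spaces\<close>

lemma bit_cases: "(b :: bit) = 0 \<or> b = 1"
  by (cases b) auto

lemma poly_mapping_bit_double: "(u :: 's \<Rightarrow>\<^sub>0 bit) + u = 0"
  by (rule poly_mapping_eqI) (simp add: lookup_add)

lemma F2_space_free: "F2_space (free_space S)"
proof -
  have "comm_group (free_space S)"
  proof (rule comm_groupI)
    fix x y assume "x \<in> carrier (free_space S)" "y \<in> carrier (free_space S)"
    then show "x \<otimes>\<^bsub>free_space S\<^esub> y \<in> carrier (free_space S)"
      using Poly_Mapping.keys_add[of x y] by (auto simp: free_space_def)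
  next
    fix x assume "x \<in> carrier (free_space S)"
    then show "\<exists>y\<in>carrier (free_space S). y \<otimes>\<^bsub>free_space S\<^esub> x = \<one>\<^bsub>free_space S\<^esub>"
      by (auto simp: free_space_def poly_mapping_bit_double)
  qed (auto simp: free_space_def add_ac)
  then show ?thesis
    by (auto simp: F2_space_def free_space_def poly_mapping_bit_double)
qed

lemma free_space_simps [simp]:
  "carrier (free_space S) = {u. Poly_Mapping.keys u \<subseteq> S}"
  "u \<otimes>\<^bsub>free_space S\<^esub> v = u + v" "\<one>\<^bsub>free_space S\<^esub> = 0"
  by (auto simp: free_space_def)

text \<open>Writing the sum over a set that does not depend on \<open>u\<close> makes additivity a matter of
  comparing summands.\<close>

lemma lin_ext_superset:
  assumes "F2_space G" "finite A" "Poly_Mapping.keys u \<subseteq> A" "f ` A \<subseteq> carrier G"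
  shows "lin_ext G f u = finprod G (\<lambda>s. if Poly_Mapping.lookup u s = 1 then f s else \<one>\<^bsub>G\<^esub>) A"
proof -
  interpret comm_group G by (rule F2_spaceD[OF assms(1)])
  show ?thesis unfolding lin_ext_def
  proof (rule finprod_mono_neutral_cong_left)
    show "\<And>i. i \<in> A - Poly_Mapping.keys u \<Longrightarrow>
         (if Poly_Mapping.lookup u i = 1 then f i else \<one>\<^bsub>G\<^esub>) = \<one>\<^bsub>G\<^esub>"
      by (auto simp: in_keys_iff)
    show "f s = (if Poly_Mapping.lookup u s = 1 then f s else \<one>\<^bsub>G\<^esub>)" if "s \<in> Poly_Mapping.keys u" for s
      using that bit_cases[of "Poly_Mapping.lookup u s"] by (auto simp: in_keys_iff)
  qed (use assms in auto)
qed

lemma lin_ext_hom: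
  assumes "F2_space G" "f ` S \<subseteq> carrier G"
  shows "lin_ext G f \<in> hom (free_space S) G"
proof (rule homI)
  interpret comm_group G by (rule F2_spaceD[OF assms(1)])
  fix u assume u: "u \<in> carrier (free_space S)"
  then show "lin_ext G f u \<in> carrier G"
    unfolding lin_ext_def using assms(2) by (intro finprod_closed) auto
  fix v assume v: "v \<in> carrier (free_space S)"
  let ?A = "Poly_Mapping.keys u \<union> Poly_Mapping.keys v"
  have A: "finite ?A" "f ` ?A \<subseteq> carrier G" using assms(2) u v by auto
  let ?g = "\<lambda>u s. if Poly_Mapping.lookup u s = 1 then f s else \<one>\<^bsub>G\<^esub>"
  have g: "?g w \<in> ?A \<rightarrow> carrier G" for w using A(2) by auto
  have "lin_ext G f (u + v) = finprod G (?g (u + v)) ?A"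
    by (rule lin_ext_superset[OF assms(1) A(1) Poly_Mapping.keys_add A(2)])
  also have "\<dots> = finprod G (\<lambda>s. ?g u s \<otimes>\<^bsub>G\<^esub> ?g v s) ?A"
  proof (rule finprod_cong')
    fix s assume s: "s \<in> ?A"
    then have "f s \<in> carrier G" using A(2) by auto
    then show "?g (u + v) s = ?g u s \<otimes>\<^bsub>G\<^esub> ?g v s"
      using bit_cases[of "Poly_Mapping.lookup u s"] bit_cases[of "Poly_Mapping.lookup v s"]
      by (auto simp: lookup_add F2_spaceD(5)[OF assms(1)])
  qed (use g in auto)
  also have "\<dots> = finprod G (?g u) ?A \<otimes>\<^bsub>G\<^esub> finprod G (?g v) ?A"
    using g by (intro finprod_multf) auto
  also have "\<dots> = lin_ext G f u \<otimes>\<^bsub>G\<^esub> lin_ext G f v"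
    by (simp add: lin_ext_superset[OF assms(1) A(1) _ A(2)])
  finally show "lin_ext G f (u \<otimes>\<^bsub>free_space S\<^esub> v) = lin_ext G f u \<otimes>\<^bsub>G\<^esub> lin_ext G f v" by simp
qed

lemma lin_ext_gen:
  assumes "F2_space G" "f s \<in> carrier G"
  shows "lin_ext G f (gen s) = f s"
proof -
  interpret comm_group G by (rule F2_spaceD[OF assms(1)])
  show ?thesis using assms by (simp add: lin_ext_def)
qed

lemma free_induct [consumes 1, case_names zero add]:
  assumes "Poly_Mapping.keys (u :: 's \<Rightarrow>\<^sub>0 bit) \<subseteq> S" "P 0"
    "\<And>s u. s \<in> S \<Longrightarrow> Poly_Mapping.keys u \<subseteq> S \<Longrightarrow> P u \<Longrightarrow> P (gen s + u)"
  shows "P u"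
proof -
  have "P u" if "finite A" "Poly_Mapping.keys u = A" "A \<subseteq> S" for u A
    using that
  proof (induction A arbitrary: u)
    case empty
    then show ?case using assms(2) by simp
  next
    case (insert a A)
    \<comment> \<open>In characteristic two, adding \<open>gen a\<close> removes \<open>a\<close> from the support.\<close>
    let ?v = "gen a + u"
    have l: "Poly_Mapping.lookup u a = 1"
      using insert.prems bit_cases[of "Poly_Mapping.lookup u a"] by (auto simp: in_keys_iff)
    have "Poly_Mapping.lookup ?v s = (if s = a then 0 else Poly_Mapping.lookup u s)" for s
      using l by (auto simp: lookup_add lookup_single when_def)
    then have "Poly_Mapping.keys ?v = A"
      using insert by (auto simp: in_keys_iff set_eq_iff)
    then have "P ?v" using insert by auto
    then have "P (gen a + ?v)" using insert.prems insert.hyps \<open>Poly_Mapping.keys ?v = A\<close> assms(3) by auto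
    moreover have "gen a + ?v = u"
      by (metis add.assoc add_0 poly_mapping_bit_double)
    ultimately show ?case by simp
  qed
  from this[of "Poly_Mapping.keys u" u] show ?thesis using assms(1) by simp
qed

text \<open>The induced maps between free spaces are defined by sums in the additive type of
  finitely supported functions, so this is the additive counterpart of \<open>lin_ext_hom\<close>: symbols that
  occur in both \<open>u\<close> and \<open>v\<close> cancel on both sides.\<close>

lemma free_lin_add:
  fixes g :: "'s \<Rightarrow> ('t \<Rightarrow>\<^sub>0 bit)"
  shows "(\<Sum>s\<in>Poly_Mapping.keys (u + v :: 's \<Rightarrow>\<^sub>0 bit). g s) =
    (\<Sum>s\<in>Poly_Mapping.keys u. g s) + (\<Sum>s\<in>Poly_Mapping.keys v. g s)"
proof -
  let ?A = "Poly_Mapping.keys u \<union> Poly_Mapping.keys v"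
  let ?g = "\<lambda>u s. if Poly_Mapping.lookup u s = 1 then g s else 0"
  have *: "(\<Sum>s\<in>Poly_Mapping.keys w. g s) = sum (?g w) ?A" if "Poly_Mapping.keys w \<subseteq> ?A" for w :: "'s \<Rightarrow>\<^sub>0 bit"
  proof (rule sum.mono_neutral_cong_left)
    show "g s = ?g w s" if "s \<in> Poly_Mapping.keys w" for s
      using that bit_cases[of "Poly_Mapping.lookup w s"] by (auto simp: in_keys_iff)
  qed (use that in \<open>auto simp: in_keys_iff\<close>)
  have "?g (u + v) s = ?g u s + ?g v s" for s
    using bit_cases[of "Poly_Mapping.lookup u s"] bit_cases[of "Poly_Mapping.lookup v s"]
    by (auto simp: lookup_add poly_mapping_bit_double)
  then have "sum (?g (u + v)) ?A = sum (?g u) ?A + sum (?g v) ?A"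
    by (simp add: sum.distrib)
  then show ?thesis using Poly_Mapping.keys_add[of u v] by (simp add: *)
qed

lemma free_lin_closed:
  fixes g :: "'s \<Rightarrow> ('t \<Rightarrow>\<^sub>0 bit)"
  assumes "\<And>s. s \<in> A \<Longrightarrow> Poly_Mapping.keys (g s) \<subseteq> S'"
  shows "Poly_Mapping.keys (\<Sum>s\<in>A. g s) \<subseteq> S'"
  using assms
proof (induction A rule: infinite_finite_induct)
  case (insert a A)
  then show ?case using Poly_Mapping.keys_add[of "g a" "sum g A"] by fastforce
qed auto

lemma free_lin_hom:
  fixes g :: "'s \<Rightarrow> ('t \<Rightarrow>\<^sub>0 bit)"
  assumes "\<And>s. s \<in> S \<Longrightarrow> Poly_Mapping.keys (g s) \<subseteq> S'"
  shows "(\<lambda>u. \<Sum>s\<in>Poly_Mapping.keys u. g s) \<in> hom (free_space S) (free_space S')"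
proof (rule homI)
  fix u assume "u \<in> carrier (free_space S)"
  then have "\<And>s. s \<in> Poly_Mapping.keys u \<Longrightarrow> Poly_Mapping.keys (g s) \<subseteq> S'" using assms by auto
  from free_lin_closed[OF this] show "(\<Sum>s\<in>Poly_Mapping.keys u. g s) \<in> carrier (free_space S')"
    by simp
qed (simp add: free_lin_add)


section \<open>Modules over the free algebra on the Steenrod squares\<close>

text \<open>The structure that the free module \<open>lannes_free\<close> already has, before the Adem and
  instability relations are imposed, and which submodules and quotients inherit.  An
  unstable module is then one in which all \<open>unstable_rels\<close> vanish (\<open>unstable_module_iff\<close>).\<close>

definition pre_umod :: "('a, 'x) umod_scheme \<Rightarrow> bool" where
  "pre_umod X \<longleftrightarrow> (\<forall>n. F2_space (grade X n)) \<and> (\<forall>i n. Sq X i n \<in> hom (grade X n) (grade X (n + i)))"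

definition sub_umod :: "('a, 'x) umod_scheme \<Rightarrow> (nat \<Rightarrow> 'a set) \<Rightarrow> bool" where
  "sub_umod X S \<longleftrightarrow> (\<forall>n. subgroup (S n) (grade X n)) \<and> (\<forall>i n. \<forall>x\<in>S n. Sq X i n x \<in> S (n + i))"

lemma pre_umodD:
  assumes "pre_umod X"
  shows "F2_space (grade X n)" "Sq X i n \<in> hom (grade X n) (grade X (n + i))"
  using assms by (auto simp: pre_umod_def)

lemma sub_umodD:
  assumes "sub_umod X S"
  shows "subgroup (S n) (grade X n)" "x \<in> S n \<Longrightarrow> Sq X i n x \<in> S (n + i)"
  using assms by (auto simp: sub_umod_def)

lemma umod_homD:
  assumes "umod_hom M N f"
  shows "f n \<in> hom (grade M n) (grade N n)"
    "x \<in> carr M n \<Longrightarrow> f (n + i) (Sq M i n x) = Sq N i n (f n x)"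
    "x \<in> carr M n \<Longrightarrow> f n x \<in> carr N n"
  using assms by (auto simp: umod_hom_def hom_def Pi_iff)

lemma umod_hom_comp:
  assumes "umod_hom L M f" "umod_hom M N g"
  shows "umod_hom L N (\<lambda>n x. g n (f n x))"
  unfolding umod_hom_def
proof (intro conjI allI ballI)
  show "(\<lambda>x. g n (f n x)) \<in> hom (grade L n) (grade N n)" for n
    using hom_compose[OF umod_homD(1)[OF assms(1)] umod_homD(1)[OF assms(2)]] by (simp add: comp_def)
qed (simp add: umod_homD[OF assms(1)] umod_homD[OF assms(2)])

lemma zero_sub_umod:
  assumes "pre_umod X"
  shows "sub_umod X (\<lambda>n. {\<one>\<^bsub>grade X n\<^esub>})"
proof -
  have "subgroup {\<one>\<^bsub>grade X n\<^esub>} (grade X n)" for n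
    using F2_spaceD(2)[OF pre_umodD(1)[OF assms]] by (rule group.triv_subgroup)
  then show ?thesis
    unfolding sub_umod_def using F2_hom_one pre_umodD[OF assms] by blast
qed

subsection \<open>Generated submodules\<close>

text \<open>Closure under inverses comes for free, since every element is its own inverse.\<close>

lemma sub_umod_submod:
  assumes "pre_umod X"
  shows "sub_umod X (submod X R)"
proof -
  have c: "r \<in> carr X n" if "in_submod X R n r" for n r
    using that
  proof induction
    case (Sq n r i)
    then show ?case using hom_closed[OF pre_umodD(2)[OF assms]] by blast
  qed (use F2_spaceD(6,7)[OF pre_umodD(1)[OF assms]] in auto)
  have "subgroup (submod X R n) (grade X n)" for n
    by (rule F2_subgroupI[OF pre_umodD(1)[OF assms]])
      (auto simp: submod_def intro: c in_submod.intros)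
  then show ?thesis by (auto simp: sub_umod_def submod_def intro: in_submod.intros)
qed

lemma submod_base: "r \<in> R n \<Longrightarrow> r \<in> carr X n \<Longrightarrow> r \<in> submod X R n"
  by (simp add: submod_def in_submod.base)

text \<open>The form in which generated submodules are used: it suffices to look at the generators.
  With \<open>S\<close> a submodule to be divided out this makes \<open>f\<close> descend to quotients, with \<open>S\<close> zero it says
  that \<open>f\<close> kills the submodule.\<close>

lemma submod_map:
  assumes "pre_umod X" "pre_umod Y" "umod_hom X Y f" "sub_umod Y S"
    "\<And>n r. r \<in> R n \<Longrightarrow> r \<in> carr X n \<Longrightarrow> f n r \<in> S n"
  shows "f n ` submod X R n \<subseteq> S n"
proof -
  have c: "r \<in> carr X n" if "in_submod X R n r" for n r
    using subgroup.subset[OF sub_umodD(1)[OF sub_umod_submod[OF assms(1)]]] that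
    by (auto simp: submod_def)
  have "f n r \<in> S n" if "in_submod X R n r" for n r
    using that
  proof induction
    case (zero n)
    have "f n \<one>\<^bsub>grade X n\<^esub> = \<one>\<^bsub>grade Y n\<^esub>"
      by (rule F2_hom_one[OF umod_homD(1)[OF assms(3)] pre_umodD(1)[OF assms(1)] pre_umodD(1)[OF assms(2)]])
    then show ?case using subgroup.one_closed[OF sub_umodD(1)[OF assms(4)]] by metis
  next
    case (add n r s)
    then show ?case
      using hom_mult[OF umod_homD(1)[OF assms(3)]] c subgroup.m_closed[OF sub_umodD(1)[OF assms(4)]]
      by metis
  next
    case (Sq n r i)
    then show ?case using umod_homD(2)[OF assms(3)] sub_umodD(2)[OF assms(4)] c by metis
  qed (rule assms(5))
  then show ?thesis by (auto simp: submod_def)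
qed

subsection \<open>Quotients\<close>

lemma quot_umod_simps [simp]:
  "grade (quot_umod X S) n = grade X n Mod S n"
  "Sq (quot_umod X S) i n = coset_map (grade X (n + i)) (S (n + i)) (Sq X i n)"
  by (auto simp: quot_umod_def)

lemma quot_Sq:
  assumes "pre_umod X" "sub_umod X S" "x \<in> carr X n"
  shows "Sq (quot_umod X S) i n (S n #>\<^bsub>grade X n\<^esub> x) = S (n + i) #>\<^bsub>grade X (n + i)\<^esub> Sq X i n x"
  unfolding quot_umod_simps
  by (rule coset_map_coset[OF pre_umodD(1)[OF assms(1)] pre_umodD(1)[OF assms(1)]
    sub_umodD(1)[OF assms(2)] sub_umodD(1)[OF assms(2)] pre_umodD(2)[OF assms(1)] _ assms(3)])
    (use sub_umodD(2)[OF assms(2)] in auto)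

lemma pre_umod_quot:
  assumes "pre_umod X" "sub_umod X S"
  shows "pre_umod (quot_umod X S)"
  unfolding pre_umod_def
proof (intro conjI allI)
  show "F2_space (grade (quot_umod X S) n)" for n
    using F2_space_quot[OF pre_umodD(1)[OF assms(1)] sub_umodD(1)[OF assms(2)]] by simp
  show "Sq (quot_umod X S) i n \<in> hom (grade (quot_umod X S) n) (grade (quot_umod X S) (n + i))" for i n
    unfolding quot_umod_simps
    by (rule coset_map_hom[OF pre_umodD(1)[OF assms(1)] pre_umodD(1)[OF assms(1)]
      sub_umodD(1)[OF assms(2)] sub_umodD(1)[OF assms(2)] pre_umodD(2)[OF assms(1)]])
      (use sub_umodD(2)[OF assms(2)] in auto)
qed

lemma umod_hom_proj:
  assumes "pre_umod X" "sub_umod X S"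
  shows "umod_hom X (quot_umod X S) (\<lambda>n x. S n #>\<^bsub>grade X n\<^esub> x)"
  unfolding umod_hom_def
proof (intro conjI allI ballI)
  show "(\<lambda>x. S n #>\<^bsub>grade X n\<^esub> x) \<in> hom (grade X n) (grade (quot_umod X S) n)" for n
    using quot_hom[OF pre_umodD(1)[OF assms(1)] sub_umodD(1)[OF assms(2)]] by simp
qed (simp add: quot_Sq[OF assms] del: quot_umod_simps(2))

lemma carr_quot_umod: "carr (quot_umod X S) n = (\<lambda>x. S n #>\<^bsub>grade X n\<^esub> x) ` carr X n"
  by (simp add: carrier_quot)

abbreviation quot_map ::
  "('b, 'y) umod_scheme \<Rightarrow> (nat \<Rightarrow> 'b set) \<Rightarrow> (nat \<Rightarrow> 'a \<Rightarrow> 'b) \<Rightarrow> nat \<Rightarrow> 'a set \<Rightarrow> 'b set" where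
  "quot_map Y S f n \<equiv> coset_map (grade Y n) (S n) (f n)"

lemma quot_map_coset:
  assumes "pre_umod X" "pre_umod Y" "sub_umod X S" "sub_umod Y S'" "umod_hom X Y f"
    "f n ` S n \<subseteq> S' n" "x \<in> carr X n"
  shows "quot_map Y S' f n (S n #>\<^bsub>grade X n\<^esub> x) = S' n #>\<^bsub>grade Y n\<^esub> f n x"
  by (rule coset_map_coset[OF pre_umodD(1)[OF assms(1)] pre_umodD(1)[OF assms(2)]
    sub_umodD(1)[OF assms(3)] sub_umodD(1)[OF assms(4)] umod_homD(1)[OF assms(5)] assms(6,7)])

lemma umod_hom_quot_map:
  assumes "pre_umod X" "pre_umod Y" "sub_umod X S" "sub_umod Y S'" "umod_hom X Y f"
    "\<And>n. f n ` S n \<subseteq> S' n"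
  shows "umod_hom (quot_umod X S) (quot_umod Y S') (quot_map Y S' f)"
  unfolding umod_hom_def
proof (intro conjI allI ballI)
  show "quot_map Y S' f n \<in> hom (grade (quot_umod X S) n) (grade (quot_umod Y S') n)" for n
    unfolding quot_umod_simps
    by (rule coset_map_hom[OF pre_umodD(1)[OF assms(1)] pre_umodD(1)[OF assms(2)]
      sub_umodD(1)[OF assms(3)] sub_umodD(1)[OF assms(4)] umod_homD(1)[OF assms(5)] assms(6)])
  fix i n X' assume "X' \<in> carr (quot_umod X S) n"
  then obtain x where x: "x \<in> carr X n" "X' = S n #>\<^bsub>grade X n\<^esub> x"
    by (auto simp: carr_quot_umod simp del: quot_umod_simps)
  have Sx: "Sq X i n x \<in> carr X (n + i)" using hom_closed[OF pre_umodD(2)[OF assms(1)] x(1)] .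
  have fx: "f n x \<in> carr Y n" using umod_homD(3)[OF assms(5) x(1)] .
  show "quot_map Y S' f (n + i) (Sq (quot_umod X S) i n X') =
      Sq (quot_umod Y S') i n (quot_map Y S' f n X')"
    unfolding x(2) quot_Sq[OF assms(1,3) x(1)] quot_map_coset[OF assms(1-5) assms(6) x(1)]
      quot_map_coset[OF assms(1-5) assms(6) Sx] quot_Sq[OF assms(2,4) fx]
    by (simp add: umod_homD(2)[OF assms(5) x(1)])
qed

subsection \<open>The instability relations\<close>

text \<open>The summation condition \<open>c \<le> a div 2\<close> guarantees that the truncated subtraction in
  \<open>a + b - c\<close> is a true one, so that all summands have the same degree.\<close>

lemma adem_rhs_terms:
  assumes "pre_umod X" "x \<in> carr X m"
  shows "(\<lambda>c. Sq X (a + b - c) (m + c) (Sq X c m x)) \<in>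
    {c. c \<le> a div 2 \<and> odd ((b - c - 1) choose (a - 2 * c))} \<rightarrow> carr X (m + a + b)"
proof
  fix c assume "c \<in> {c. c \<le> a div 2 \<and> odd ((b - c - 1) choose (a - 2 * c))}"
  then have "m + c + (a + b - c) = m + a + b" by auto
  moreover have "Sq X (a + b - c) (m + c) (Sq X c m x) \<in> carr X (m + c + (a + b - c))"
    using hom_closed pre_umodD(2)[OF assms(1)] assms(2) by metis
  ultimately show "Sq X (a + b - c) (m + c) (Sq X c m x) \<in> carr X (m + a + b)" by metis
qed

lemma adem_rhs_hom:
  assumes "pre_umod X" "pre_umod Y" "umod_hom X Y f" "x \<in> carr X m"
  shows "f (m + a + b) (adem_rhs X a b m x) = adem_rhs Y a b m (f m x)"
proof -
  interpret Y: comm_group "grade Y (m + a + b)" by (rule F2_spaceD(1)[OF pre_umodD(1)[OF assms(2)]])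
  have "f (m + a + b) (Sq X (a + b - c) (m + c) (Sq X c m x)) =
      Sq Y (a + b - c) (m + c) (Sq Y c m (f m x))" if "c \<le> a div 2" for c
  proof -
    have e: "m + c + (a + b - c) = m + a + b" using that by auto
    have "Sq X c m x \<in> carr X (m + c)" using hom_closed[OF pre_umodD(2)[OF assms(1)] assms(4)] .
    from umod_homD(2)[OF assms(3) this, of "a + b - c"] show ?thesis
      by (simp add: e umod_homD(2)[OF assms(3,4)])
  qed
  then show ?thesis
    unfolding adem_rhs_def
    unfolding hom_finprod_F2[OF pre_umodD(1)[OF assms(1)] pre_umodD(1)[OF assms(2)]
        umod_homD(1)[OF assms(3)] adem_rhs_terms[OF assms(1,4)]]
    using adem_rhs_terms[OF assms(2) umod_homD(3)[OF assms(3,4)]] by (intro Y.finprod_cong') auto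
qed

lemma adem_rhs_closed:
  assumes "pre_umod X" "x \<in> carr X m"
  shows "adem_rhs X a b m x \<in> carr X (m + a + b)"
proof -
  interpret Y: comm_group "grade X (m + a + b)" by (rule F2_spaceD(1)[OF pre_umodD(1)[OF assms(1)]])
  show ?thesis unfolding adem_rhs_def by (rule Y.finprod_closed[OF adem_rhs_terms[OF assms]])
qed

lemma Sq_closed:
  assumes "pre_umod X" "x \<in> carr X n"
  shows "Sq X i n x \<in> carr X (n + i)"
  using hom_closed[OF pre_umodD(2)[OF assms(1)] assms(2)] .

lemma unstable_rels_carr:
  assumes "pre_umod X"
  shows "unstable_rels X n \<subseteq> carr X n"
proof -
  have "Sq X 0 n x \<in> carr X n" if "x \<in> carr X n" for x
    using Sq_closed[OF assms that, of 0] by simp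
  moreover have "Sq X a (m + b) (Sq X b m x) \<in> carr X (m + a + b)" if "x \<in> carr X m" for a b m x
    using Sq_closed[OF assms Sq_closed[OF assms that], of a b] by (simp add: add_ac)
  ultimately show ?thesis
    unfolding unstable_rels_def
    using F2_spaceD(6)[OF pre_umodD(1)[OF assms]] adem_rhs_closed[OF assms] Sq_closed[OF assms]
    by auto
qed

lemma unstable_module_iff:
  "unstable_module X \<longleftrightarrow> pre_umod X \<and> (\<forall>n. unstable_rels X n \<subseteq> {\<one>\<^bsub>grade X n\<^esub>})"
proof (cases "pre_umod X")
  case True
  note F = pre_umodD(1)[OF True]
  have 0: "Sq X 0 n x \<otimes>\<^bsub>grade X n\<^esub> x = \<one>\<^bsub>grade X n\<^esub> \<longleftrightarrow> Sq X 0 n x = x" if "x \<in> carr X n" for n x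
    using F2_space_eq_iff[OF F _ that] Sq_closed[OF True that, of 0] by simp
  have 1: "Sq X a (m + b) (Sq X b m x) \<otimes>\<^bsub>grade X (m + a + b)\<^esub> adem_rhs X a b m x =
      \<one>\<^bsub>grade X (m + a + b)\<^esub> \<longleftrightarrow> Sq X a (m + b) (Sq X b m x) = adem_rhs X a b m x"
    if "x \<in> carr X m" for a b m x
    using F2_space_eq_iff[OF F _ adem_rhs_closed[OF True that]]
      Sq_closed[OF True Sq_closed[OF True that], of a b] by (simp add: add_ac)
  have "(\<forall>n. unstable_rels X n \<subseteq> {\<one>\<^bsub>grade X n\<^esub>}) \<longleftrightarrow>
     (\<forall>n. \<forall>x\<in>carr X n. Sq X 0 n x = x) \<and>
     (\<forall>a b n. \<forall>x\<in>carr X n. 0 < a \<and> a < 2 * b \<longrightarrow>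
        Sq X a (n + b) (Sq X b n x) = adem_rhs X a b n x) \<and>
     (\<forall>i n. \<forall>x\<in>carr X n. n < i \<longrightarrow> Sq X i n x = \<one>\<^bsub>grade X (n + i)\<^esub>)"
    unfolding unstable_rels_def by (auto simp: 0 1 subset_iff) (metis 0 1)+
  then show ?thesis using True by (auto simp: unstable_module_def pre_umod_def)
qed (auto simp: unstable_module_def pre_umod_def)

lemma unstable_rels_values:
  assumes "pre_umod X" "pre_umod Y" "umod_hom X Y f"
  shows "x \<in> carr X n \<Longrightarrow>
      f n (Sq X 0 n x \<otimes>\<^bsub>grade X n\<^esub> x) = Sq Y 0 n (f n x) \<otimes>\<^bsub>grade Y n\<^esub> f n x"
    "x \<in> carr X m \<Longrightarrow>
      f (m + a + b) (Sq X a (m + b) (Sq X b m x) \<otimes>\<^bsub>grade X (m + a + b)\<^esub> adem_rhs X a b m x) =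
        Sq Y a (m + b) (Sq Y b m (f m x)) \<otimes>\<^bsub>grade Y (m + a + b)\<^esub> adem_rhs Y a b m (f m x)"
proof -
  note m = hom_mult[OF umod_homD(1)[OF assms(3)]]
  show "f n (Sq X 0 n x \<otimes>\<^bsub>grade X n\<^esub> x) = Sq Y 0 n (f n x) \<otimes>\<^bsub>grade Y n\<^esub> f n x"
    if "x \<in> carr X n"
    using m[of _ n x] Sq_closed[OF assms(1) that, of 0] umod_homD(2)[OF assms(3) that, of 0] that by simp
  show "f (m + a + b) (Sq X a (m + b) (Sq X b m x) \<otimes>\<^bsub>grade X (m + a + b)\<^esub> adem_rhs X a b m x) =
      Sq Y a (m + b) (Sq Y b m (f m x)) \<otimes>\<^bsub>grade Y (m + a + b)\<^esub> adem_rhs Y a b m (f m x)"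
    if "x \<in> carr X m"
  proof -
    note S = Sq_closed[OF assms(1) that, of b]
    have "Sq X a (m + b) (Sq X b m x) \<in> carr X (m + a + b)"
      "f (m + a + b) (Sq X a (m + b) (Sq X b m x)) = Sq Y a (m + b) (Sq Y b m (f m x))"
      using Sq_closed[OF assms(1) S, of a] umod_homD(2)[OF assms(3) S, of a]
        umod_homD(2)[OF assms(3) that, of b] by (simp_all add: add_ac)
    then show ?thesis using m adem_rhs_closed[OF assms(1) that] adem_rhs_hom[OF assms that] by simp
  qed
qed

lemma unstable_relsI:
  "x \<in> carr X n \<Longrightarrow> Sq X 0 n x \<otimes>\<^bsub>grade X n\<^esub> x \<in> unstable_rels X n"
  "x \<in> carr X m \<Longrightarrow> 0 < a \<Longrightarrow> a < 2 * b \<Longrightarrow>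
    Sq X a (m + b) (Sq X b m x) \<otimes>\<^bsub>grade X (m + a + b)\<^esub> adem_rhs X a b m x
      \<in> unstable_rels X (m + a + b)"
  "x \<in> carr X m \<Longrightarrow> m < i \<Longrightarrow> Sq X i m x \<in> unstable_rels X (m + i)"
  unfolding unstable_rels_def by blast+

lemma unstable_relsE:
  assumes "r \<in> unstable_rels X n"
  obtains (unit) x where "x \<in> carr X n" "r = Sq X 0 n x \<otimes>\<^bsub>grade X n\<^esub> x"
  | (adem) a b m x where "x \<in> carr X m" "0 < a" "a < 2 * b" "n = m + a + b"
      "r = Sq X a (m + b) (Sq X b m x) \<otimes>\<^bsub>grade X (m + a + b)\<^esub> adem_rhs X a b m x"
  | (excess) i m x where "x \<in> carr X m" "m < i" "n = m + i" "r = Sq X i m x"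
  using assms unfolding unstable_rels_def by blast

lemma unstable_rels_hom:
  assumes "pre_umod X" "pre_umod Y" "umod_hom X Y f" "r \<in> unstable_rels X n"
  shows "f n r \<in> unstable_rels Y n"
  using assms(4)
proof (cases rule: unstable_relsE)
  case (unit x)
  then show ?thesis
    using unstable_rels_values(1)[OF assms(1-3)] unstable_relsI(1) umod_homD(3)[OF assms(3)] by metis
next
  case (adem a b m x)
  then show ?thesis
    using unstable_rels_values(2)[OF assms(1-3)] unstable_relsI(2) umod_homD(3)[OF assms(3)] by metis
next
  case (excess i m x)
  then show ?thesis
    using unstable_relsI(3) umod_homD(2,3)[OF assms(3)] by metis
qed

lemma unstable_rels_surj:
  assumes "pre_umod X" "pre_umod Y" "umod_hom X Y f" "\<And>n. f n ` carr X n = carr Y n"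
    "r \<in> unstable_rels Y n"
  shows "\<exists>r'\<in>unstable_rels X n. r = f n r'"
  using assms(5)
proof (cases rule: unstable_relsE)
  case (unit y)
  then obtain x where "x \<in> carr X n" "y = f n x" unfolding assms(4)[symmetric] by blast
  then show ?thesis
    using unit unstable_rels_values(1)[OF assms(1-3)] unstable_relsI(1) by metis
next
  case (adem a b m y)
  then obtain x where "x \<in> carr X m" "y = f m x" unfolding assms(4)[symmetric] by blast
  then show ?thesis
    using adem unstable_rels_values(2)[OF assms(1-3)] unstable_relsI(2) by metis
next
  case (excess i m y)
  then obtain x where "x \<in> carr X m" "y = f m x" unfolding assms(4)[symmetric] by blast
  then show ?thesis
    using excess unstable_relsI(3) umod_homD(2)[OF assms(3)] by metis
qed

text \<open>Since homomorphisms carry the defining relations to each other, instability passes to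
  the target of a surjection as soon as the relations of the source are killed.  For
  \<open>T V M\<close> the source is the free module of its presentation.\<close>

lemma unstable_module_surj:
  assumes "pre_umod X" "pre_umod Y" "umod_hom X Y f" "\<And>n. f n ` carr X n = carr Y n"
    "\<And>n r. r \<in> unstable_rels X n \<Longrightarrow> f n r = \<one>\<^bsub>grade Y n\<^esub>"
  shows "unstable_module Y"
  unfolding unstable_module_iff
  using assms(2) unstable_rels_surj[OF assms(1-4)] assms(5) by blast

lemma unstable_module_image:
  assumes "unstable_module X" "pre_umod Y" "umod_hom X Y f" "\<And>n. f n ` carr X n = carr Y n"
  shows "unstable_module Y"
proof -
  have X: "pre_umod X" "\<And>n r. r \<in> unstable_rels X n \<Longrightarrow> r = \<one>\<^bsub>grade X n\<^esub>"
    using assms(1) unfolding unstable_module_iff by blast+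
  show ?thesis
    using F2_hom_one[OF umod_homD(1)[OF assms(3)] pre_umodD(1)[OF X(1)] pre_umodD(1)[OF assms(2)]] X(2)
    by (intro unstable_module_surj[OF X(1) assms(2-4)]) metis
qed

subsection \<open>Isomorphisms and truncation\<close>

lemma umod_isoI:
  assumes "umod_hom M N f" "umod_hom N M g" "\<And>n x. x \<in> carr M n \<Longrightarrow> g n (f n x) = x"
    "\<And>n y. y \<in> carr N n \<Longrightarrow> f n (g n y) = y"
  shows "umod_iso M N f"
  unfolding umod_iso_def using assms by blast

lemma umod_iso_if_bij:
  assumes "pre_umod M" "pre_umod N" "umod_hom M N f" "\<And>n. bij_betw (f n) (carr M n) (carr N n)"
  shows "umod_iso M N f"
proof (rule umod_isoI[OF assms(3)])
  let ?g = "\<lambda>n. the_inv_into (carr M n) (f n)"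
  have inj: "inj_on (f n) (carr M n)" and im: "f n ` carr M n = carr N n" for n
    using assms(4)[of n] by (auto simp: bij_betw_def)
  show gf: "?g n (f n x) = x" if "x \<in> carr M n" for n x
    by (rule the_inv_into_f_f[OF inj that])
  show "f n (?g n y) = y" if "y \<in> carr N n" for n y
    using f_the_inv_into_f[OF inj] that im by metis
  show "umod_hom N M ?g"
    unfolding umod_hom_def
  proof (intro conjI allI ballI)
    show "?g n \<in> hom (grade N n) (grade M n)" for n
    proof (rule homI)
      fix y assume "y \<in> carr N n"
      then obtain x where x: "x \<in> carr M n" "y = f n x" using im by blast
      then show "?g n y \<in> carr M n" by (simp add: gf)
      fix y' assume "y' \<in> carr N n"
      then obtain x' where x': "x' \<in> carr M n" "y' = f n x'" using im by blast
      have "y \<otimes>\<^bsub>grade N n\<^esub> y' = f n (x \<otimes>\<^bsub>grade M n\<^esub> x')"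
        using hom_mult[OF umod_homD(1)[OF assms(3)]] x x' by simp
      then show "?g n (y \<otimes>\<^bsub>grade N n\<^esub> y') = ?g n y \<otimes>\<^bsub>grade M n\<^esub> ?g n y'"
        using x x' gf F2_spaceD(6)[OF pre_umodD(1)[OF assms(1)]] by simp
    qed
    fix i n y assume "y \<in> carr N n"
    then obtain x where x: "x \<in> carr M n" "y = f n x" using im by blast
    have "Sq N i n y = f (n + i) (Sq M i n x)" using umod_homD(2)[OF assms(3) x(1)] x by simp
    then show "?g (n + i) (Sq N i n y) = Sq M i n (?g n y)"
      using gf[OF Sq_closed[OF assms(1) x(1), of i]] gf[OF x(1)] x by simp
  qed
qed

text \<open>The Steenrod operations raise degrees and therefore cannot leave the part of degree at
  least \<open>k\<close>.\<close>

lemma sub_umod_high_part: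
  assumes "pre_umod X"
  shows "sub_umod X (high_part k X)"
proof -
  note F = pre_umodD(1)[OF assms] and Z = zero_sub_umod[OF assms]
  have "subgroup (high_part k X n) (grade X n)" for n
    using group.subgroup_self[OF F2_spaceD(2)[OF F]] sub_umodD(1)[OF Z] by (simp add: high_part_def)
  moreover have "Sq X i n x \<in> high_part k X (n + i)" if "x \<in> high_part k X n" for i n x
  proof (cases "k \<le> n + i")
    case True
    have "x \<in> carr X n" using that F2_spaceD(7)[OF F] by (auto simp: high_part_def split: if_splits)
    then show ?thesis using True Sq_closed[OF assms] by (simp add: high_part_def)
  next
    case False
    then show ?thesis using that sub_umodD(2)[OF Z] by (simp add: high_part_def)
  qed
  ultimately show ?thesis by (simp add: sub_umod_def)
qed

text \<open>Used for two kinds of functoriality: \<open>T_map\<close> and \<open>trunc_map\<close> are both maps induced on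
  quotients, so both send isomorphisms to isomorphisms.\<close>

lemma umod_iso_quot_map:
  assumes "pre_umod X" "pre_umod Y" "sub_umod X S" "sub_umod Y S'" "umod_hom X Y f" "umod_hom Y X g"
    "\<And>n. f n ` S n \<subseteq> S' n" "\<And>n. g n ` S' n \<subseteq> S n"
    "\<And>n x. x \<in> carr X n \<Longrightarrow> g n (f n x) = x" "\<And>n y. y \<in> carr Y n \<Longrightarrow> f n (g n y) = y"
  shows "umod_iso (quot_umod X S) (quot_umod Y S') (quot_map Y S' f)"
proof (rule umod_isoI[where g = "quot_map X S g"])
  show "umod_hom (quot_umod X S) (quot_umod Y S') (quot_map Y S' f)"
    by (rule umod_hom_quot_map[OF assms(1-5,7)])
  show "umod_hom (quot_umod Y S') (quot_umod X S) (quot_map X S g)"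
    by (rule umod_hom_quot_map[OF assms(2,1,4,3,6,8)])
  note qf = quot_map_coset[OF assms(1-5,7)] and qg = quot_map_coset[OF assms(2,1,4,3,6,8)]
  show "quot_map X S g n (quot_map Y S' f n x) = x" if "x \<in> carr (quot_umod X S) n" for n x
    using that unfolding carr_quot_umod
    using qf qg umod_homD(3)[OF assms(5)] assms(9) by auto
  show "quot_map Y S' f n (quot_map X S g n y) = y" if "y \<in> carr (quot_umod Y S') n" for n y
    using that unfolding carr_quot_umod
    using qf qg umod_homD(3)[OF assms(6)] assms(10) by auto
qed

lemma high_part_hom:
  assumes "pre_umod X" "pre_umod Y" "umod_hom X Y f"
  shows "f n ` high_part k X n \<subseteq> high_part k Y n"
  using umod_homD(3)[OF assms(3)]
    F2_hom_one[OF umod_homD(1)[OF assms(3)] pre_umodD(1)[OF assms(1)] pre_umodD(1)[OF assms(2)]]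
  by (auto simp: high_part_def)

lemma trunc_map_iso:
  assumes "pre_umod X" "pre_umod Y" "umod_iso X Y f"
  shows "umod_iso (trunc k X) (trunc k Y) (trunc_map k Y f)"
proof -
  obtain g where g: "umod_hom X Y f" "umod_hom Y X g"
    "\<forall>n. \<forall>x\<in>carr X n. g n (f n x) = x" "\<forall>n. \<forall>y\<in>carr Y n. f n (g n y) = y"
    using assms(3) unfolding umod_iso_def by auto
  show ?thesis
    unfolding trunc_def trunc_map_def
    by (rule umod_iso_quot_map[OF assms(1,2) sub_umod_high_part[OF assms(1)]
      sub_umod_high_part[OF assms(2)] g(1,2) high_part_hom[OF assms(1,2) g(1)]
      high_part_hom[OF assms(2,1) g(2)] g(3,4)[rule_format]])
qed

lemma carr_trunc: "carr (trunc k X) n = (\<lambda>x. high_part k X n #>\<^bsub>grade X n\<^esub> x) ` carr X n"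
  unfolding trunc_def by (rule carr_quot_umod)

text \<open>In degrees below \<open>k\<close> the truncation divides by the zero subspace and so loses nothing.\<close>

lemma trunc_iso_imp_bij:
  assumes "pre_umod X" "pre_umod Y" "umod_hom X Y f"
    "umod_iso (trunc k X) (trunc k Y) (trunc_map k Y f)" "n < k"
  shows "bij_betw (f n) (carr X n) (carr Y n)"
proof -
  note hX = sub_umod_high_part[OF assms(1), of k] and hY = sub_umod_high_part[OF assms(2), of k]
  have eqX: "high_part k X n #>\<^bsub>grade X n\<^esub> x = high_part k X n #>\<^bsub>grade X n\<^esub> y \<longleftrightarrow> x = y"
    if "x \<in> carr X n" "y \<in> carr X n" for x y
    using coset_eq_iff[OF pre_umodD(1)[OF assms(1)] sub_umodD(1)[OF hX] that] assms(5)
      F2_space_eq_iff[OF pre_umodD(1)[OF assms(1)] that] by (simp add: high_part_def)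
  have eqY: "high_part k Y n #>\<^bsub>grade Y n\<^esub> x = high_part k Y n #>\<^bsub>grade Y n\<^esub> y \<longleftrightarrow> x = y"
    if "x \<in> carr Y n" "y \<in> carr Y n" for x y
    using coset_eq_iff[OF pre_umodD(1)[OF assms(2)] sub_umodD(1)[OF hY] that] assms(5)
      F2_space_eq_iff[OF pre_umodD(1)[OF assms(2)] that] by (simp add: high_part_def)
  have tm: "trunc_map k Y f n (high_part k X n #>\<^bsub>grade X n\<^esub> x) = high_part k Y n #>\<^bsub>grade Y n\<^esub> f n x"
    if "x \<in> carr X n" for x
    unfolding trunc_map_def
    by (rule quot_map_coset[OF assms(1,2) hX hY assms(3) high_part_hom[OF assms(1-3)] that])
  obtain g where g: "umod_hom (trunc k Y) (trunc k X) g"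
    "\<forall>n. \<forall>x\<in>carr (trunc k X) n. g n (trunc_map k Y f n x) = x"
    "\<forall>n. \<forall>y\<in>carr (trunc k Y) n. trunc_map k Y f n (g n y) = y"
    using assms(4) unfolding umod_iso_def by auto
  show ?thesis
  proof (rule bij_betw_imageI)
    show "inj_on (f n) (carr X n)"
    proof (rule inj_onI)
      fix x y assume xy: "x \<in> carr X n" "y \<in> carr X n" "f n x = f n y"
      then have "trunc_map k Y f n (high_part k X n #>\<^bsub>grade X n\<^esub> x) =
        trunc_map k Y f n (high_part k X n #>\<^bsub>grade X n\<^esub> y)" by (simp add: tm)
      moreover have "high_part k X n #>\<^bsub>grade X n\<^esub> z \<in> carr (trunc k X) n" if "z \<in> carr X n" for z
        using that unfolding carr_trunc by blast
      ultimately have "high_part k X n #>\<^bsub>grade X n\<^esub> x = high_part k X n #>\<^bsub>grade X n\<^esub> y"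
        using g(2) xy(1,2) by metis
      then show "x = y" using eqX xy by blast
    qed
    have "y \<in> f n ` carr X n" if y: "y \<in> carr Y n" for y
    proof -
      let ?y = "high_part k Y n #>\<^bsub>grade Y n\<^esub> y"
      have yc: "?y \<in> carr (trunc k Y) n" using y unfolding carr_trunc by blast
      then have "g n ?y \<in> carr (trunc k X) n" by (rule umod_homD(3)[OF g(1)])
      then obtain x where x: "x \<in> carr X n" "g n ?y = high_part k X n #>\<^bsub>grade X n\<^esub> x"
        unfolding carr_trunc by blast
      then have "high_part k Y n #>\<^bsub>grade Y n\<^esub> f n x = ?y" using g(3)[rule_format, OF yc] tm by simp
      then show ?thesis using eqY[OF umod_homD(3)[OF assms(3) x(1)] y] x(1) by blast
    qed
    then show "f n ` carr X n = carr Y n" using umod_homD(3)[OF assms(3)] by blast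
  qed
qed


section \<open>Functoriality of Lannes' construction\<close>

lemma free_hom_eq:
  assumes "F2_space G" "f \<in> hom (free_space S) G" "g \<in> hom (free_space S) G"
    "\<And>s. s \<in> S \<Longrightarrow> f (gen s) = g (gen s)" "u \<in> carrier (free_space S)"
  shows "f u = g u"
proof -
  have "Poly_Mapping.keys u \<subseteq> S" using assms(5) by simp
  then show ?thesis
  proof (induction rule: free_induct)
    case zero
    then show ?case
      using F2_hom_one[OF assms(2) F2_space_free assms(1)] F2_hom_one[OF assms(3) F2_space_free assms(1)]
      by simp
  next
    case (add s u)
    then show ?case
      using hom_mult[OF assms(2), of "gen s" u] hom_mult[OF assms(3), of "gen s" u] assms(4) by simp
  qed
qed

text \<open>The linear map between free spaces induced by a map of bases; all maps between the
  presentations of Lannes modules, and the operations on \<open>lannes_free\<close>, are of this form.\<close>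

definition relabel :: "('s \<Rightarrow> 't) \<Rightarrow> ('s \<Rightarrow>\<^sub>0 bit) \<Rightarrow> ('t \<Rightarrow>\<^sub>0 bit)" where
  "relabel h u = (\<Sum>s\<in>Poly_Mapping.keys u. gen (h s))"

lemma relabel_add: "relabel h (u + v) = relabel h u + relabel h v"
  unfolding relabel_def by (rule free_lin_add)

lemma relabel_zero [simp]: "relabel h 0 = 0"
  by (simp add: relabel_def)

lemma relabel_gen [simp]: "relabel h (gen s) = gen (h s)"
  by (simp add: relabel_def)

lemma relabel_sum: "relabel h (sum g A) = (\<Sum>a\<in>A. relabel h (g a))"
  by (induction A rule: infinite_finite_induct) (auto simp: relabel_add)

lemma relabel_hom:
  assumes "\<And>s. s \<in> S \<Longrightarrow> h s \<in> S'"
  shows "relabel h \<in> hom (free_space S) (free_space S')"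
  unfolding relabel_def by (rule free_lin_hom) (use assms in simp)

lemma relabel_relabel: "relabel h (relabel k u) = relabel (\<lambda>s. h (k s)) u"
  unfolding relabel_def[of k] by (simp add: relabel_sum) (simp add: relabel_def)

lemma relabel_cong:
  assumes "\<And>s. s \<in> Poly_Mapping.keys u \<Longrightarrow> h s = k s"
  shows "relabel h u = relabel k u"
  unfolding relabel_def using assms by simp

lemma relabel_id: "relabel (\<lambda>s. s) u = u"
proof -
  have "Poly_Mapping.keys u \<subseteq> UNIV" by simp
  then show ?thesis by (induction rule: free_induct) (auto simp: relabel_add)
qed

definition lannes_syms :: "'v monoid \<Rightarrow> ('a, 'x) umod_scheme \<Rightarrow> nat \<Rightarrow> ('a, 'v) lsym set" where
  "lannes_syms V M n = {(w, p, x, j, c).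
     x \<in> carr M p \<and> j \<le> p \<and> c \<in> dual_space (grade (H V) j) \<and> sum_list w + (p - j) = n}"

lemma lannes_free_simps:
  "grade (lannes_free V M) n = free_space (lannes_syms V M n)"
  "Sq (lannes_free V M) i n = relabel (\<lambda>(w, r). (i # w, r))"
  by (auto simp: lannes_free_def lannes_syms_def relabel_def fun_eq_iff case_prod_unfold)

lemma carr_lannes_free:
  "u \<in> carr (lannes_free V M) n \<longleftrightarrow> Poly_Mapping.keys u \<subseteq> lannes_syms V M n"
  by (simp add: lannes_free_simps)

lemma pre_umod_lannes_free: "pre_umod (lannes_free V M)"
  unfolding pre_umod_def lannes_free_simps
  by (intro conjI allI F2_space_free relabel_hom) (auto simp: lannes_syms_def)

lemma sub_umod_lannes: "sub_umod (lannes_free V M) (lannes_sub V M)"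
  unfolding lannes_sub_def by (rule sub_umod_submod[OF pre_umod_lannes_free])

lemma pre_umod_T: "pre_umod (T V M)"
  unfolding T_def by (rule pre_umod_quot[OF pre_umod_lannes_free sub_umod_lannes])

lemma lannes_rel_in_sub:
  "r \<in> lannes_rels V M n \<Longrightarrow> r \<in> carr (lannes_free V M) n \<Longrightarrow> r \<in> lannes_sub V M n"
  "r \<in> unstable_rels (lannes_free V M) n \<Longrightarrow> r \<in> lannes_sub V M n"
  unfolding lannes_sub_def using unstable_rels_carr[OF pre_umod_lannes_free]
  by (auto intro!: submod_base)

lemma lannes_sub_zero: "0 \<in> lannes_sub V M n"
  using subgroup.one_closed[OF sub_umodD(1)[OF sub_umod_lannes], of V M n]
  by (simp add: lannes_free_simps)

lemma lannes_sub_add: "u \<in> lannes_sub V M n \<Longrightarrow> v \<in> lannes_sub V M n \<Longrightarrow> u + v \<in> lannes_sub V M n"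
  using subgroup.m_closed[OF sub_umodD(1)[OF sub_umod_lannes], of u V M n v]
  by (simp add: lannes_free_simps)

lemma lannes_sub_sum:
  "(\<And>a. a \<in> A \<Longrightarrow> g a \<in> lannes_sub V M n) \<Longrightarrow> sum g A \<in> lannes_sub V M n"
  by (induction A rule: infinite_finite_induct) (auto intro: lannes_sub_zero lannes_sub_add)

text \<open>The instability relations are among the relations divided out.\<close>

lemma unstable_T: "unstable_module (T V M)"
proof (rule unstable_module_surj[OF pre_umod_lannes_free pre_umod_T])
  show "umod_hom (lannes_free V M) (T V M)
      (\<lambda>n x. lannes_sub V M n #>\<^bsub>grade (lannes_free V M) n\<^esub> x)"
    unfolding T_def by (rule umod_hom_proj[OF pre_umod_lannes_free sub_umod_lannes])
  show "(\<lambda>x. lannes_sub V M n #>\<^bsub>grade (lannes_free V M) n\<^esub> x) ` carr (lannes_free V M) n = carr (T V M) n" for n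
    unfolding T_def carr_quot_umod ..
  show "lannes_sub V M n #>\<^bsub>grade (lannes_free V M) n\<^esub> r = \<one>\<^bsub>grade (T V M) n\<^esub>"
    if "r \<in> unstable_rels (lannes_free V M) n" for n r
  proof -
    have "r \<in> carr (lannes_free V M) n" using that unstable_rels_carr[OF pre_umod_lannes_free] by blast
    then have "lannes_sub V M n #>\<^bsub>grade (lannes_free V M) n\<^esub> r = lannes_sub V M n"
      using coset_eq_self_iff[OF pre_umodD(1)[OF pre_umod_lannes_free] sub_umodD(1)[OF sub_umod_lannes]]
        lannes_rel_in_sub(2)[OF that] by blast
    then show ?thesis by (simp add: T_def one_quot)
  qed
qed

text \<open>The universal property of the presentation: the defining relations have to be checked on
  \<open>lannes_rels\<close> alone, because every homomorphism carries the relations that express instability to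
  such relations in \<open>Y\<close>, which lie in \<open>S\<close>.\<close>

lemma lannes_sub_map:
  assumes "pre_umod Y" "umod_hom (lannes_free V M) Y f" "sub_umod Y S"
    "\<And>n r. r \<in> lannes_rels V M n \<Longrightarrow> r \<in> carr (lannes_free V M) n \<Longrightarrow> f n r \<in> S n"
    "\<And>n r. r \<in> unstable_rels Y n \<Longrightarrow> r \<in> S n"
  shows "f n ` lannes_sub V M n \<subseteq> S n"
  unfolding lannes_sub_def
  by (rule submod_map[OF pre_umod_lannes_free assms(1-3)])
    (use assms(4,5) unstable_rels_hom[OF pre_umod_lannes_free assms(1,2)] in blast)

text \<open>\<open>[x, c] \<mapsto> [f x, \<gamma> c]\<close>, the common form of \<open>T_V(f)\<close> (where \<open>\<gamma>\<close> is the identity) and of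
  the map \<open>T_U(N) \<rightarrow> T_V(N)\<close> (where \<open>\<gamma>\<close> is the transpose of \<open>H\<^sup>*(V) \<rightarrow> H\<^sup>*(U)\<close>).\<close>

definition lsym_map :: "(nat \<Rightarrow> 'a \<Rightarrow> 'b) \<Rightarrow> (nat \<Rightarrow> ('u coh \<Rightarrow> bit) \<Rightarrow> ('v coh \<Rightarrow> bit)) \<Rightarrow>
    ('a, 'u) lsym \<Rightarrow> ('b, 'v) lsym" where
  "lsym_map f \<gamma> = (\<lambda>(w, p, x, j, c). (w, p, f p x, j, \<gamma> j c))"

lemma lsym_map_simp [simp]: "lsym_map f \<gamma> (w, p, x, j, c) = (w, p, f p x, j, \<gamma> j c)"
  by (simp add: lsym_map_def)

lemma umod_hom_lsym_map:
  assumes "umod_hom M N f" "\<And>j c. c \<in> dual_space (grade (H U) j) \<Longrightarrow> \<gamma> j c \<in> dual_space (grade (H V) j)"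
  shows "umod_hom (lannes_free U M) (lannes_free V N) (\<lambda>n. relabel (lsym_map f \<gamma>))"
  unfolding umod_hom_def lannes_free_simps
proof (intro conjI allI ballI)
  show "relabel (lsym_map f \<gamma>) \<in> hom (free_space (lannes_syms U M n)) (free_space (lannes_syms V N n))" for n
    by (rule relabel_hom) (use assms(2) umod_homD(3)[OF assms(1)] in \<open>auto simp: lannes_syms_def\<close>)
qed (auto simp: relabel_relabel case_prod_unfold lsym_map_def)

text \<open>The two bilinearity relations go to relations of the same shape.  Where the relation
  for \<open>[Sq\<^sup>i x, c]\<close> goes depends on how \<open>\<gamma>\<close> interacts with the operations on cohomology, hence the
  separate hypothesis.\<close>

lemma lannes_sub_lsym_map:
  assumes "umod_hom M N f"
    and dual: "\<And>j c. c \<in> dual_space (grade (H U) j) \<Longrightarrow> \<gamma> j c \<in> dual_space (grade (H V) j)"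
    and add: "\<And>j c c'. c \<in> dual_space (grade (H U) j) \<Longrightarrow> c' \<in> dual_space (grade (H U) j) \<Longrightarrow>
      \<gamma> j (restrict (\<lambda>h. c h + c' h) (carr (H U) j)) =
        restrict (\<lambda>h. \<gamma> j c h + \<gamma> j c' h) (carr (H V) j)"
    and Sq: "\<And>i p x j c. x \<in> carr N p \<Longrightarrow> j \<le> p + i \<Longrightarrow> c \<in> dual_space (grade (H U) j) \<Longrightarrow>
      gen ([], p + i, Sq N i p x, j, \<gamma> j c) +
        (\<Sum>l\<in>{l. l \<le> i \<and> l \<le> j \<and> j - l \<le> p}. gen ([i - l], p, x, j - l,
           \<gamma> (j - l) (restrict (\<lambda>h. c (Sq (H U) l (j - l) h)) (carr (H U) (j - l)))))
      \<in> carr (lannes_free V N) (p + i - j) \<Longrightarrow>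
      gen ([], p + i, Sq N i p x, j, \<gamma> j c) +
        (\<Sum>l\<in>{l. l \<le> i \<and> l \<le> j \<and> j - l \<le> p}. gen ([i - l], p, x, j - l,
           \<gamma> (j - l) (restrict (\<lambda>h. c (Sq (H U) l (j - l) h)) (carr (H U) (j - l)))))
      \<in> lannes_sub V N (p + i - j)"
  shows "relabel (lsym_map f \<gamma>) ` lannes_sub U M n \<subseteq> lannes_sub V N n"
proof (rule lannes_sub_map[OF pre_umod_lannes_free umod_hom_lsym_map[OF assms(1) dual] sub_umod_lannes])
  show "\<And>n r. r \<in> unstable_rels (lannes_free V N) n \<Longrightarrow> r \<in> lannes_sub V N n"
    by (rule lannes_rel_in_sub(2))
  note fc = umod_homD(3)[OF assms(1)]
  fix n r assume r: "r \<in> lannes_rels U M n" "r \<in> carr (lannes_free U M) n"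
  have rc: "relabel (lsym_map f \<gamma>) r \<in> carr (lannes_free V N) n"
    using umod_homD(3)[OF umod_hom_lsym_map[OF assms(1) dual] r(2)] .
  from r(1) consider
    (1) p x x' j c where "r = gen ([], p, x \<otimes>\<^bsub>grade M p\<^esub> x', j, c) + gen ([], p, x, j, c) + gen ([], p, x', j, c)"
        "x \<in> carr M p" "x' \<in> carr M p" "j \<le> p" "c \<in> dual_space (grade (H U) j)" "p - j = n"
  | (2) p x j c c' where "r = gen ([], p, x, j, restrict (\<lambda>h. c h + c' h) (carr (H U) j)) +
        gen ([], p, x, j, c) + gen ([], p, x, j, c')"
        "x \<in> carr M p" "j \<le> p" "c \<in> dual_space (grade (H U) j)"
        "c' \<in> dual_space (grade (H U) j)" "p - j = n"
  | (3) i p x j c where "r = gen ([], p + i, Sq M i p x, j, c) +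
        (\<Sum>l\<in>{l. l \<le> i \<and> l \<le> j \<and> j - l \<le> p}.
           gen ([i - l], p, x, j - l, restrict (\<lambda>h. c (Sq (H U) l (j - l) h)) (carr (H U) (j - l))))"
        "x \<in> carr M p" "j \<le> p + i" "c \<in> dual_space (grade (H U) j)" "p + i - j = n"
    unfolding lannes_rels_def by blast
  then show "relabel (lsym_map f \<gamma>) r \<in> lannes_sub V N n"
  proof cases
    case 1
    then have "relabel (lsym_map f \<gamma>) r = gen ([], p, f p x \<otimes>\<^bsub>grade N p\<^esub> f p x', j, \<gamma> j c) +
        gen ([], p, f p x, j, \<gamma> j c) + gen ([], p, f p x', j, \<gamma> j c)"
      using hom_mult[OF umod_homD(1)[OF assms(1)]] by (simp add: relabel_add)
    then have "relabel (lsym_map f \<gamma>) r \<in> lannes_rels V N n"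
      unfolding lannes_rels_def using 1 fc dual by blast
    then show ?thesis using rc by (rule lannes_rel_in_sub(1))
  next
    case 2
    then have "relabel (lsym_map f \<gamma>) r =
        gen ([], p, f p x, j, restrict (\<lambda>h. \<gamma> j c h + \<gamma> j c' h) (carr (H V) j)) +
        gen ([], p, f p x, j, \<gamma> j c) + gen ([], p, f p x, j, \<gamma> j c')"
      by (simp only: 2(1) relabel_add relabel_gen lsym_map_simp add[OF 2(4,5)])
    then have "relabel (lsym_map f \<gamma>) r \<in> lannes_rels V N n"
      unfolding lannes_rels_def using 2 fc dual by blast
    then show ?thesis using rc by (rule lannes_rel_in_sub(1))
  next
    case 3
    then have "relabel (lsym_map f \<gamma>) r = gen ([], p + i, Sq N i p (f p x), j, \<gamma> j c) +
        (\<Sum>l\<in>{l. l \<le> i \<and> l \<le> j \<and> j - l \<le> p}. gen ([i - l], p, f p x, j - l,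
           \<gamma> (j - l) (restrict (\<lambda>h. c (Sq (H U) l (j - l) h)) (carr (H U) (j - l)))))"
      by (simp add: relabel_add relabel_sum umod_homD(2)[OF assms(1)])
    then show ?thesis using Sq[OF fc[OF 3(2)] 3(3,4)] rc 3(5) by metis
  qed
qed

lemma T_map_eq:
  "T_map V M N f n = quot_map (lannes_free V N) (lannes_sub V N) (\<lambda>n. relabel (lsym_map f (\<lambda>j c. c))) n"
  by (simp add: T_map_def relabel_def[abs_def] lsym_map_def case_prod_unfold)

lemma lannes_sub_T_map:
  fixes V :: "'v monoid"
  assumes "umod_hom M N f"
  shows "relabel (lsym_map f (\<lambda>j c. c)) ` lannes_sub V M n \<subseteq> lannes_sub V N n"
proof (rule lannes_sub_lsym_map[OF assms])
  fix i p x j and c :: "'v coh \<Rightarrow> bit"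
  assume *: "x \<in> carr N p" "j \<le> p + i" "c \<in> dual_space (grade (H V) j)"
    "gen ([], p + i, Sq N i p x, j, c) +
        (\<Sum>l\<in>{l. l \<le> i \<and> l \<le> j \<and> j - l \<le> p}. gen ([i - l], p, x, j - l,
           restrict (\<lambda>h. c (Sq (H V) l (j - l) h)) (carr (H V) (j - l))))
      \<in> carr (lannes_free V N) (p + i - j)" (is "?r \<in> _")
  have "?r \<in> lannes_rels V N (p + i - j)"
    unfolding lannes_rels_def using *(1-3) by blast
  then show "?r \<in> lannes_sub V N (p + i - j)" using *(4) by (rule lannes_rel_in_sub(1))
qed auto

lemma T_map_coset:
  assumes "umod_hom M N f" "u \<in> carr (lannes_free V M) n"
  shows "T_map V M N f n (lannes_sub V M n #>\<^bsub>grade (lannes_free V M) n\<^esub> u) =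
    lannes_sub V N n #>\<^bsub>grade (lannes_free V N) n\<^esub> relabel (lsym_map f (\<lambda>j c. c)) u"
  unfolding T_map_eq
  by (rule quot_map_coset[OF pre_umod_lannes_free pre_umod_lannes_free sub_umod_lannes sub_umod_lannes
    umod_hom_lsym_map[OF assms(1)] lannes_sub_T_map[OF assms(1)] assms(2)])

lemma umod_hom_T_map:
  assumes "umod_hom M N f"
  shows "umod_hom (T V M) (T V N) (T_map V M N f)"
  unfolding T_map_eq T_def
  by (rule umod_hom_quot_map[OF pre_umod_lannes_free pre_umod_lannes_free sub_umod_lannes sub_umod_lannes
    umod_hom_lsym_map[OF assms] lannes_sub_T_map[OF assms]])

lemma T_map_iso:
  assumes "umod_iso M N f"
  shows "umod_iso (T V M) (T V N) (T_map V M N f)"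
proof -
  obtain g where g: "umod_hom M N f" "umod_hom N M g"
    "\<forall>n. \<forall>x\<in>carr M n. g n (f n x) = x" "\<forall>n. \<forall>y\<in>carr N n. f n (g n y) = y"
    using assms unfolding umod_iso_def by auto
  have gf: "relabel (lsym_map g' (\<lambda>j c. c)) (relabel (lsym_map f' (\<lambda>j c. c)) u) = u"
    if "u \<in> carr (lannes_free V L) n" "\<forall>n. \<forall>x\<in>carr L n. g' n (f' n x) = x"
    for u L n and f' :: "nat \<Rightarrow> 'l \<Rightarrow> 'k" and g'
  proof -
    have "relabel (lsym_map g' (\<lambda>j c. c)) (relabel (lsym_map f' (\<lambda>j c. c)) u) = relabel (\<lambda>s. s) u"
      unfolding relabel_relabel
      by (rule relabel_cong) (use that in \<open>auto simp: carr_lannes_free lannes_syms_def\<close>)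
    then show ?thesis by (simp add: relabel_id)
  qed
  show ?thesis
    unfolding T_map_eq T_def
    by (rule umod_iso_quot_map[OF pre_umod_lannes_free pre_umod_lannes_free sub_umod_lannes sub_umod_lannes
      umod_hom_lsym_map[OF g(1)] umod_hom_lsym_map[OF g(2)] lannes_sub_T_map[OF g(1)] lannes_sub_T_map[OF g(2)]])
      (use gf g(3,4) in blast)+
qed


section \<open>Restriction to the cohomology of the trivial group\<close>

text \<open>Sums in \<open>\<bbbF>\<^sub>2\<close> have to stay sums below, where additivity is at stake.\<close>

declare add_bit_eq_xor [simp del]

lemma dual_spaceD:
  assumes "c \<in> dual_space G"
  shows "c \<in> extensional (carrier G)"
    "x \<in> carrier G \<Longrightarrow> y \<in> carrier G \<Longrightarrow> c (x \<otimes>\<^bsub>G\<^esub> y) = c x + c y"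
  using assms by (auto simp: dual_space_def)

lemma dual_space_restrictI:
  assumes "\<And>x y. x \<in> carrier G \<Longrightarrow> y \<in> carrier G \<Longrightarrow> x \<otimes>\<^bsub>G\<^esub> y \<in> carrier G"
    "\<And>x y. x \<in> carrier G \<Longrightarrow> y \<in> carrier G \<Longrightarrow> c (x \<otimes>\<^bsub>G\<^esub> y) = c x + c y"
  shows "restrict c (carrier G) \<in> dual_space G"
  unfolding dual_space_def using assms by simp

lemma cochains_add:
  assumes "f \<in> carrier (cochains V n)" "g \<in> carrier (cochains V n)"
  shows "(\<lambda>s. f s + g s) \<in> carrier (cochains V n)"
  using assms by (simp add: cochains_def)

lemma cobound_add: "cobound V n (\<lambda>s. f s + g s) = (\<lambda>s. cobound V n f s + cobound V n g s)"
  by (auto simp: cobound_def fun_eq_iff sum.distrib)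

lemma cocycles_add:
  assumes "f \<in> cocycles V n" "g \<in> cocycles V n"
  shows "(\<lambda>s. f s + g s) \<in> cocycles V n"
  using assms by (auto simp: cocycles_def cochains_add cobound_add)

lemma cobounds_zero: "(\<lambda>s. 0) \<in> cobounds V n"
proof (cases "n = 0")
  case False
  have "(\<lambda>s. 0) \<in> carrier (cochains V (n - 1))" by (simp add: cochains_def)
  moreover have "cobound V (n - 1) (\<lambda>s. 0) = (\<lambda>s. 0)" by (simp add: cobound_def fun_eq_iff)
  ultimately show ?thesis using False by (simp add: cobounds_def image_iff) metis
qed (simp add: cobounds_def)

lemma cobounds_add:
  assumes "f \<in> cobounds V n" "g \<in> cobounds V n"
  shows "(\<lambda>s. f s + g s) \<in> cobounds V n"
proof (cases "n = 0")
  case False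
  then obtain f' g' where "f' \<in> carrier (cochains V (n - 1))" "f = cobound V (n - 1) f'"
    "g' \<in> carrier (cochains V (n - 1))" "g = cobound V (n - 1) g'"
    using assms by (auto simp: cobounds_def)
  then have "(\<lambda>s. f s + g s) = cobound V (n - 1) (\<lambda>s. f' s + g' s)"
    "(\<lambda>s. f' s + g' s) \<in> carrier (cochains V (n - 1))"
    by (simp_all only: cobound_add cochains_add)
  then show ?thesis using False by (simp add: cobounds_def)
qed (use assms in \<open>simp add: cobounds_def\<close>)

definition coh_class :: "'v monoid \<Rightarrow> nat \<Rightarrow> ('v list \<Rightarrow> bit) \<Rightarrow> 'v coh" where
  "coh_class V n f = (\<lambda>b s. b s + f s) ` cobounds V n"

lemma carr_H: "carr (H V) n = coh_class V n ` cocycles V n"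
  by (auto simp: H_def FactGroup_def RCOSETS_def r_coset_def coh_class_def cochains_def)

lemma cochains_coset: "cobounds V n #>\<^bsub>cochains V n\<^esub> f = coh_class V n f"
  by (auto simp: r_coset_def coh_class_def cochains_def)

text \<open>The coboundaries form a subspace \<open>B\<close>, so that \<open>B + B = B\<close>.\<close>

lemma coh_class_add:
  "coh_class V n f \<otimes>\<^bsub>grade (H V) n\<^esub> coh_class V n g = coh_class V n (\<lambda>s. f s + g s)"
proof -
  have "coh_class V n f \<otimes>\<^bsub>grade (H V) n\<^esub> coh_class V n g =
    (\<Union>x\<in>coh_class V n f. \<Union>y\<in>coh_class V n g. {\<lambda>s. x s + y s})"
    by (simp add: H_def FactGroup_def set_mult_def cochains_def)
  also have "\<dots> = coh_class V n (\<lambda>s. f s + g s)"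
  proof (intro equalityI subsetI)
    fix z assume "z \<in> (\<Union>x\<in>coh_class V n f. \<Union>y\<in>coh_class V n g. {\<lambda>s. x s + y s})"
    then obtain b b' where b: "b \<in> cobounds V n" "b' \<in> cobounds V n"
      "z = (\<lambda>s. (b s + f s) + (b' s + g s))" by (auto simp: coh_class_def)
    then have "z = (\<lambda>s. (b s + b' s) + (f s + g s))" by (simp add: add_ac)
    then show "z \<in> coh_class V n (\<lambda>s. f s + g s)"
      unfolding coh_class_def using cobounds_add[OF b(1,2)] by (rule image_eqI)
  next
    fix z assume "z \<in> coh_class V n (\<lambda>s. f s + g s)"
    then obtain b where b: "b \<in> cobounds V n" "z = (\<lambda>s. b s + (f s + g s))"
      by (auto simp: coh_class_def)
    have "z = (\<lambda>s. (b s + f s) + (0 + g s))" by (simp add: b(2) add_ac)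
    moreover have "(\<lambda>s. b s + f s) \<in> coh_class V n f"
      unfolding coh_class_def using b(1) by blast
    moreover have "(\<lambda>s. 0 + g s) \<in> coh_class V n g"
      unfolding coh_class_def using cobounds_zero by (rule image_eqI[OF refl])
    ultimately show "z \<in> (\<Union>x\<in>coh_class V n f. \<Union>y\<in>coh_class V n g. {\<lambda>s. x s + y s})" by blast
  qed
  finally show ?thesis .
qed

lemma carr_H_add:
  assumes "x \<in> carr (H V) n" "y \<in> carr (H V) n"
  shows "x \<otimes>\<^bsub>grade (H V) n\<^esub> y \<in> carr (H V) n"
  using assms unfolding carr_H by (auto simp: coh_class_add cocycles_add)

lemma zero_dual: "restrict (\<lambda>h. 0) (carr (H V) n) \<in> dual_space (grade (H V) n)"
  by (rule dual_space_restrictI[OF carr_H_add]) auto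

lemma coh_class_0: "coh_class V 0 f = {f}"
  by (simp add: coh_class_def cobounds_def)

lemma carr_H_0: "carr (H V) 0 = (\<lambda>f. {f}) ` cocycles V 0"
  by (simp add: carr_H coh_class_0)

lemma add_H_0: "{f} \<otimes>\<^bsub>grade (H V) 0\<^esub> {g} = {\<lambda>s. f s + g s}"
  using coh_class_add[of V 0 f g] by (simp only: coh_class_0)

lemma cup_0_0:
  assumes "\<And>s. s \<notin> simplices V 0 \<Longrightarrow> f s = 0"
  shows "cup_i V 0 0 f f = f"
proof
  fix s
  show "cup_i V 0 0 f f s = f s"
  proof (cases "s \<in> simplices V 0")
    case True
    then obtain v where s: "s = [v]" by (auto simp: simplices_def length_Suc_conv)
    have "J \<subseteq> {..0} \<and> card J = 0 + 1 \<longleftrightarrow> J = {0}" for J :: "nat set"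
      by (auto simp: card_Suc_eq)
    then have J: "{J. J \<subseteq> {..0} \<and> card J = 0 + 1} = {{0 :: nat}}" by auto
    show ?thesis using True unfolding cup_i_def J
      using bit_cases[of "f [v]"] by (auto simp: s nths_singleton)
  qed (use assms in \<open>simp add: cup_i_def\<close>)
qed

text \<open>In degree zero there are no coboundaries, and the square of a function with values in
  \<open>\<bbbF>\<^sub>2\<close> is the function itself.\<close>

lemma Sq_0_H_0:
  assumes "h \<in> carr (H V) 0"
  shows "Sq (H V) 0 0 h = h"
proof -
  obtain f where f: "f \<in> cocycles V 0" "h = {f}" using assms by (auto simp: carr_H_0)
  have "cup_i V 0 0 f f = f" by (rule cup_0_0) (use f(1) in \<open>auto simp: cocycles_def cochains_def\<close>)
  moreover have "Sq (H V) 0 0 {f} = coh_class V 0 (cup_i V 0 0 f f)"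
    using cochains_coset[of V 0] by (simp add: H_def coset_map_def)
  ultimately show ?thesis by (simp add: f coh_class_0)
qed

lemma Sq_H_0_high:
  assumes "h \<in> carr (H V) 0" "0 < i"
  shows "Sq (H V) i 0 h = coh_class V i (\<lambda>s. 0)"
proof -
  obtain f where f: "h = {f}" using assms(1) by (auto simp: carr_H_0)
  show ?thesis using assms(2) cochains_coset[of V i] by (simp add: f H_def coset_map_def)
qed

text \<open>Constant simplices of positive dimension are degenerate, and normalised cochains vanish on
  those.  This is what makes the cohomology of the trivial group, and the restriction to it, explicit.\<close>

lemma cochain_const:
  assumes "f \<in> carrier (cochains V n)" "0 < n" "v \<in> carrier V"
  shows "f (replicate (Suc n) v) = 0"
proof -
  have "replicate (Suc n) v \<in> simplices V n" using assms by (auto simp: simplices_def)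
  moreover have "replicate (Suc n) v ! 0 = replicate (Suc n) v ! Suc 0"
    using assms by (simp add: nth_Cons')
  ultimately show ?thesis using assms by (fastforce simp: cochains_def)
qed

text \<open>All \<open>n + 2\<close> faces of a constant simplex agree.  For \<open>n = 0\<close> they are two and cancel, for
  \<open>n > 0\<close> they are degenerate.\<close>

lemma cobound_const:
  assumes "f \<in> carrier (cochains V n)" "v \<in> carrier V"
  shows "cobound V n f (replicate (n + 2) v) = 0"
proof -
  have *: "take i (replicate (n + 2) v) @ drop (Suc i) (replicate (n + 2) v) = replicate (Suc n) v"
    if "i \<le> n + 1" for i
    using that by (simp add: replicate_add[symmetric] min_def del: replicate_Suc)
  have "(\<Sum>i\<le>n + 1. f (take i (replicate (n + 2) v) @ drop (Suc i) (replicate (n + 2) v))) =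
     (\<Sum>i\<le>n + 1. f (replicate (Suc n) v))"
    by (rule sum.cong) (use * in auto)
  also have "\<dots> = 0"
    using cochain_const[OF assms(1) _ assms(2)] by (cases "n = 0") auto
  finally show ?thesis by (simp add: cobound_def)
qed

lemma cobounds_const:
  assumes "f \<in> cobounds V n" "v \<in> carrier V"
  shows "f (replicate (Suc n) v) = 0"
proof (cases "n = 0")
  case False
  then obtain f' where "f' \<in> carrier (cochains V (n - 1))" "f = cobound V (n - 1) f'"
    using assms by (auto simp: cobounds_def)
  then show ?thesis using cobound_const[of f' V "n - 1" v] assms False by simp
qed (use assms in \<open>simp add: cobounds_def\<close>)

lemma simplices_zero_sub: "simplices (zero_sub V) n = {replicate (Suc n) \<one>\<^bsub>V\<^esub>}"
proof -
  have "s = replicate (Suc n) \<one>\<^bsub>V\<^esub>" if "length s = Suc n" "set s \<subseteq> {\<one>\<^bsub>V\<^esub>}" for s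
    by (rule replicate_eqI) (use that in auto)
  then show ?thesis by (auto simp: simplices_def simp del: replicate_Suc)
qed

lemma cobounds_zero_sub: "cobounds (zero_sub V) n = {\<lambda>s. 0}"
proof -
  have "f = (\<lambda>s. 0)" if f: "f \<in> cobounds (zero_sub V) n" for f
  proof
    fix s
    show "f s = 0"
    proof (cases "s \<in> simplices (zero_sub V) n")
      case True
      then show ?thesis using cobounds_const[OF f] by (simp add: simplices_zero_sub)
    next
      case False
      then show ?thesis using f by (auto simp: cobounds_def cobound_def split: if_splits)
    qed
  qed
  then show ?thesis using cobounds_zero[of "zero_sub V" n] by blast
qed

lemma coh_class_zero_sub: "coh_class (zero_sub V) n f = {f}"
  by (simp add: coh_class_def cobounds_zero_sub)

lemma carr_H_zero_sub:
  assumes "0 < n"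
  shows "carr (H (zero_sub V)) n = {{\<lambda>s. 0}}"
proof -
  have "f = (\<lambda>s. 0)" if "f \<in> cocycles (zero_sub V) n" for f
  proof
    fix s
    have f: "f \<in> carrier (cochains (zero_sub V) n)" using that by (simp add: cocycles_def)
    show "f s = 0"
    proof (cases "s \<in> simplices (zero_sub V) n")
      case True
      then show ?thesis using cochain_const[OF f assms] by (simp add: simplices_zero_sub)
    qed (use f in \<open>simp add: cochains_def\<close>)
  qed
  moreover have "(\<lambda>s. 0) \<in> cocycles (zero_sub V) n"
    by (simp add: cocycles_def cochains_def cobound_def fun_eq_iff)
  ultimately have "cocycles (zero_sub V) n = {\<lambda>s. 0}" by blast
  then show ?thesis by (simp add: carr_H coh_class_zero_sub)
qed

lemma dual_H_zero_sub:
  assumes "c \<in> dual_space (grade (H (zero_sub V)) n)" "0 < n"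
  shows "c {\<lambda>s. 0} = 0"
proof -
  have "c ({\<lambda>s. 0} \<otimes>\<^bsub>grade (H (zero_sub V)) n\<^esub> {\<lambda>s. 0}) = c {\<lambda>s. 0} + c {\<lambda>s. 0}"
    by (rule dual_spaceD(2)[OF assms(1)]) (simp_all add: carr_H_zero_sub[OF assms(2)])
  moreover have "{\<lambda>s. 0} \<otimes>\<^bsub>grade (H (zero_sub V)) n\<^esub> {\<lambda>s. 0} = {\<lambda>s. 0 :: bit}"
    using coh_class_add[of "zero_sub V" n "\<lambda>s. 0" "\<lambda>s. 0"] by (simp add: coh_class_zero_sub)
  ultimately show ?thesis by (cases "c {\<lambda>s. 0}") auto
qed

lemma cocycles_zero_sub_0:
  assumes "monoid V"
  shows "cocycles (zero_sub V) 0 = {f. \<forall>s. s \<noteq> [\<one>\<^bsub>V\<^esub>] \<longrightarrow> f s = 0}"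
proof -
  interpret monoid V by (rule assms)
  have *: "carrier (cochains (zero_sub V) 0) = {f. \<forall>s. s \<noteq> [\<one>\<^bsub>V\<^esub>] \<longrightarrow> f s = 0}"
    by (auto simp: cochains_def simplices_zero_sub)
  have "cobound (zero_sub V) 0 f = (\<lambda>s. 0)" if "f \<in> carrier (cochains (zero_sub V) 0)" for f
  proof
    fix s
    show "cobound (zero_sub V) 0 f s = 0"
      using cobound_const[OF that, of "\<one>\<^bsub>V\<^esub>"]
      by (cases "s \<in> simplices (zero_sub V) 1") (auto simp: simplices_zero_sub cobound_def numeral_2_eq_2)
  qed
  then show ?thesis by (auto simp: cocycles_def *)
qed

text \<open>Restriction of cohomology classes along \<open>0 \<rightarrow> V\<close>.\<close>

definition res0 :: "'v monoid \<Rightarrow> nat \<Rightarrow> 'v coh \<Rightarrow> 'v coh" where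
  "res0 V = H_map (zero_sub V) (\<lambda>v. v)"

lemma res0_pos:
  assumes "monoid V" "0 < n" "h \<in> carr (H V) n"
  shows "res0 V n h = {\<lambda>s. 0}"
proof -
  interpret monoid V by (rule assms)
  obtain z where z: "z \<in> cocycles V n" "h = coh_class V n z" using assms(3) by (auto simp: carr_H)
  have zero: "(if s \<in> simplices (zero_sub V) n then f (map (\<lambda>v. v) s) else 0) = 0" if "f \<in> h" for f s
  proof -
    obtain b where b: "b \<in> cobounds V n" "f = (\<lambda>s. b s + z s)" using \<open>f \<in> h\<close> z by (auto simp: coh_class_def)
    have "z (replicate (Suc n) \<one>\<^bsub>V\<^esub>) = 0"
      using z(1) cochain_const[of z V n] assms(2) by (simp add: cocycles_def)
    then show ?thesis using cobounds_const[OF b(1) one_closed] by (simp add: b(2) simplices_zero_sub)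
  qed
  have "h \<noteq> {}" using z(2) cobounds_zero[of V n] by (auto simp: coh_class_def)
  then show ?thesis
    using zero unfolding res0_def H_map_def coset_map_def cochains_coset coh_class_zero_sub by auto
qed

lemma res0_0: "res0 V 0 {f} = {\<lambda>s. if s = [\<one>\<^bsub>V\<^esub>] then f s else 0}"
  unfolding res0_def H_map_def coset_map_def cochains_coset coh_class_zero_sub
  by (auto simp: simplices_zero_sub fun_eq_iff)

lemma res0_closed:
  assumes "monoid V" "h \<in> carr (H V) n"
  shows "res0 V n h \<in> carr (H (zero_sub V)) n"
proof (cases "n = 0")
  case True
  then obtain f where "h = {f}" using assms(2) by (auto simp: carr_H_0)
  then show ?thesis
    using True assms(1) by (auto simp: res0_0 carr_H_0 cocycles_zero_sub_0)
qed (use assms res0_pos[of V n h] carr_H_zero_sub[of n V] in auto)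

lemma res0_add:
  assumes "monoid V" "g \<in> carr (H V) n" "h \<in> carr (H V) n"
  shows "res0 V n (g \<otimes>\<^bsub>grade (H V) n\<^esub> h) = res0 V n g \<otimes>\<^bsub>grade (H (zero_sub V)) n\<^esub> res0 V n h"
proof (cases "n = 0")
  case True
  obtain f f' where f: "g = {f}" "h = {f'}" using assms True by (auto simp: carr_H_0)
  show ?thesis by (auto simp: True f add_H_0 res0_0 fun_eq_iff)
next
  case False
  then show ?thesis
    using assms coh_class_add[of "zero_sub V" n "\<lambda>s. 0" "\<lambda>s. 0"]
    by (simp add: res0_pos carr_H_add coh_class_zero_sub)
qed


section \<open>The map from a module to its Lannes module\<close>

definition res_dual :: "'v monoid \<Rightarrow> nat \<Rightarrow> ('v coh \<Rightarrow> bit) \<Rightarrow> ('v coh \<Rightarrow> bit)" where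
  "res_dual V j c = restrict (\<lambda>h. c (res0 V j h)) (carr (H V) j)"

lemma res_dual_dual:
  assumes "monoid V" "c \<in> dual_space (grade (H (zero_sub V)) j)"
  shows "res_dual V j c \<in> dual_space (grade (H V) j)"
  unfolding res_dual_def
  by (rule dual_space_restrictI[OF carr_H_add])
    (auto simp: res0_add[OF assms(1)] intro!: dual_spaceD(2)[OF assms(2)] res0_closed[OF assms(1)])

lemma res_dual_add:
  assumes "monoid V"
  shows "res_dual V j (restrict (\<lambda>h. c h + c' h) (carr (H (zero_sub V)) j)) =
    restrict (\<lambda>h. res_dual V j c h + res_dual V j c' h) (carr (H V) j)"
  by (auto simp: res_dual_def fun_eq_iff res0_closed[OF assms])

lemma res_dual_pos:
  assumes "monoid V" "c \<in> dual_space (grade (H (zero_sub V)) j)" "0 < j"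
  shows "res_dual V j c = restrict (\<lambda>h. 0) (carr (H V) j)"
  unfolding res_dual_def
  by (rule restrict_ext) (simp add: res0_pos[OF assms(1,3)] dual_H_zero_sub[OF assms(2,3)])

text \<open>The additivity relation for \<open>0 + 0 = 0\<close> consists of three equal summands, two of which
  cancel.\<close>

lemma gen_zero_functional:
  fixes V :: "'v monoid" and M :: "('a, 'x) umod_scheme"
  assumes "x \<in> carr M p" "j \<le> p"
  shows "gen ([], p, x, j, restrict (\<lambda>h. 0) (carr (H V) j)) \<in> lannes_sub V M (p - j)"
proof -
  let ?z = "restrict (\<lambda>h. 0 :: bit) (carr (H V) j)"
  let ?g = "gen ([], p, x, j, ?z) :: ('a, 'v) lsym \<Rightarrow>\<^sub>0 bit"
  have z: "?z \<in> dual_space (grade (H V) j)" by (rule zero_dual)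
  have "restrict (\<lambda>h. ?z h + ?z h) (carr (H V) j) = ?z" by (auto simp: fun_eq_iff)
  then have "?g = gen ([], p, x, j, restrict (\<lambda>h. ?z h + ?z h) (carr (H V) j)) + ?g + ?g"
    by (simp add: add.assoc poly_mapping_bit_double)
  then have "?g \<in> lannes_rels V M (p - j)"
    unfolding lannes_rels_def using assms z by blast
  moreover have "?g \<in> carr (lannes_free V M) (p - j)"
    using assms z by (simp add: carr_lannes_free lannes_syms_def)
  ultimately show ?thesis by (rule lannes_rel_in_sub(1))
qed

lemma gen_zero_functional_Sq:
  assumes "x \<in> carr M p" "j \<le> p"
  shows "gen ([i], p, x, j, restrict (\<lambda>h. 0) (carr (H V) j)) \<in> lannes_sub V M (p - j + i)"
  using sub_umodD(2)[OF sub_umod_lannes gen_zero_functional[OF assms], where i = i]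
  by (simp add: lannes_free_simps)

lemma restrict_Sq_0:
  assumes "c \<in> dual_space (grade (H V) 0)"
  shows "restrict (\<lambda>h. c (Sq (H V) 0 0 h)) (carr (H V) 0) = c"
proof -
  have "restrict (\<lambda>h. c (Sq (H V) 0 0 h)) (carr (H V) 0) = restrict c (carr (H V) 0)"
    by (rule restrict_ext) (simp add: Sq_0_H_0)
  then show ?thesis using extensional_restrict[OF dual_spaceD(1)[OF assms]] by simp
qed

lemma cup_i_zero: "cup_i V m i (\<lambda>s. 0) g = (\<lambda>s. 0)"
  by (simp add: cup_i_def fun_eq_iff)

text \<open>All positive degrees of \<open>H\<^sup>*(0)\<close> vanish.\<close>

lemma Sq_H_zero_sub:
  assumes "0 < j" "l \<le> j" "h \<in> carr (H (zero_sub V)) (j - l)"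
  shows "Sq (H (zero_sub V)) l (j - l) h = {\<lambda>s. 0}"
proof (cases "l = j")
  case True
  then show ?thesis using Sq_H_0_high[of h "zero_sub V" j] assms by (simp add: coh_class_zero_sub)
next
  case False
  then have "h = {\<lambda>s. 0}" using assms carr_H_zero_sub[of "j - l" V] by auto
  then show ?thesis
    using cochains_coset[of "zero_sub V" j] assms(2)
    by (simp add: H_def coset_map_def cup_i_zero coh_class_zero_sub)
qed

lemma res_dual_zero:
  assumes "monoid V"
  shows "res_dual V j (restrict (\<lambda>h. 0) (carr (H (zero_sub V)) j)) = restrict (\<lambda>h. 0) (carr (H V) j)"
  unfolding res_dual_def by (rule restrict_ext) (simp add: res0_closed[OF assms])

text \<open>For \<open>d\<close> of degree zero only the summand \<open>l = 0\<close> remains in the relation for \<open>[Sq\<^sup>i x, d]\<close>, and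
  \<open>d \<circ> Sq\<^sup>0 = d\<close>.  So \<open>x \<mapsto> [x, d]\<close> commutes with the Steenrod operations.\<close>

lemma Sq_0_rel:
  assumes "unstable_module N" "x \<in> carr N p" "d \<in> dual_space (grade (H V) 0)"
  shows "gen ([], p + i, Sq N i p x, 0, d) + gen ([i], p, x, 0, d) \<in> lannes_sub V N (p + i)"
proof (rule lannes_rel_in_sub(1))
  have N: "pre_umod N" using assms(1) by (simp add: unstable_module_iff)
  let ?r = "gen ([], p + i, Sq N i p x, 0, d) + gen ([i], p, x, 0, d)"
  have "{l. l \<le> i \<and> l \<le> 0 \<and> 0 - l \<le> p} = {0 :: nat}" by auto
  then have "?r = gen ([], p + i, Sq N i p x, 0, d) +
        (\<Sum>l\<in>{l. l \<le> i \<and> l \<le> 0 \<and> 0 - l \<le> p}.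
           gen ([i - l], p, x, 0 - l, restrict (\<lambda>h. d (Sq (H V) l (0 - l) h)) (carr (H V) (0 - l))))"
    using restrict_Sq_0[OF assms(3)] by simp
  moreover have "p + i - 0 = p + i" "0 \<le> p + i" by simp_all
  ultimately show "?r \<in> lannes_rels V N (p + i)"
    unfolding lannes_rels_def using assms(2,3) by blast
  have "gen ([], p + i, Sq N i p x, 0, d) \<in> carr (lannes_free V N) (p + i)"
    "gen ([i], p, x, 0, d) \<in> carr (lannes_free V N) (p + i)"
    using assms(2,3) Sq_closed[OF N assms(2)] by (simp_all add: carr_lannes_free lannes_syms_def)
  then show "?r \<in> carr (lannes_free V N) (p + i)"
    using F2_spaceD(6)[OF pre_umodD(1)[OF pre_umod_lannes_free], of _ V N "p + i"]
    by (simp add: lannes_free_simps)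
qed

text \<open>Compatibility of the restriction \<open>H\<^sup>*(V) \<rightarrow> H\<^sup>*(0)\<close> with the operations, in the form needed for
  \<open>T_0(N) \<rightarrow> T_V(N)\<close>.  For \<open>j > 0\<close> every functional in the relation vanishes, because \<open>H\<^sup>j(0) = 0\<close> and
  each summand is \<open>c\<close> composed with a map that passes through \<open>H\<^sup>j(0)\<close>; for \<open>j = 0\<close> the relation is that
  of \<open>Sq_0_rel\<close>.\<close>

lemma Sq_rel_res_dual:
  fixes V :: "'v monoid"
  assumes "monoid V" "unstable_module N" "x \<in> carr N p" "j \<le> p + i"
    "c \<in> dual_space (grade (H (zero_sub V)) j)"
  shows "gen ([], p + i, Sq N i p x, j, res_dual V j c) +
        (\<Sum>l\<in>{l. l \<le> i \<and> l \<le> j \<and> j - l \<le> p}. gen ([i - l], p, x, j - l,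
           res_dual V (j - l) (restrict (\<lambda>h. c (Sq (H (zero_sub V)) l (j - l) h)) (carr (H (zero_sub V)) (j - l)))))
      \<in> lannes_sub V N (p + i - j)"
proof (cases "j = 0")
  case True
  have "{l. l \<le> i \<and> l \<le> 0 \<and> 0 - l \<le> p} = {0 :: nat}" by auto
  then show ?thesis
    using Sq_0_rel[OF assms(2,3) res_dual_dual[OF assms(1,5)[unfolded True]]]
      restrict_Sq_0[OF assms(5)[unfolded True]] by (simp add: True)
next
  case False
  have N: "pre_umod N" using assms(2) by (simp add: unstable_module_iff)
  have "gen ([i - l], p, x, j - l,
      res_dual V (j - l) (restrict (\<lambda>h. c (Sq (H (zero_sub V)) l (j - l) h)) (carr (H (zero_sub V)) (j - l))))
      \<in> lannes_sub V N (p + i - j)" if "l \<le> i" "l \<le> j" "j - l \<le> p" for l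
  proof -
    have "restrict (\<lambda>h. c (Sq (H (zero_sub V)) l (j - l) h)) (carr (H (zero_sub V)) (j - l)) =
        restrict (\<lambda>h. 0) (carr (H (zero_sub V)) (j - l))"
      by (rule restrict_ext)
        (use Sq_H_zero_sub[of j l _ V] that False dual_H_zero_sub[OF assms(5)] in simp)
    moreover have "p - (j - l) + (i - l) = p + i - j" using that by auto
    ultimately show ?thesis
      using gen_zero_functional_Sq[OF assms(3) that(3), of "i - l" V]
      by (simp add: res_dual_zero[OF assms(1)])
  qed
  then have "(\<Sum>l\<in>{l. l \<le> i \<and> l \<le> j \<and> j - l \<le> p}. gen ([i - l], p, x, j - l,
           res_dual V (j - l) (restrict (\<lambda>h. c (Sq (H (zero_sub V)) l (j - l) h)) (carr (H (zero_sub V)) (j - l)))))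
      \<in> lannes_sub V N (p + i - j)" by (intro lannes_sub_sum) blast
  moreover have "gen ([], p + i, Sq N i p x, j, res_dual V j c) \<in> lannes_sub V N (p + i - j)"
    using gen_zero_functional[OF Sq_closed[OF N assms(3)] assms(4)] False
    by (simp add: res_dual_pos[OF assms(1,5)])
  ultimately show ?thesis by (rule lannes_sub_add[rotated])
qed

lemma umod_hom_id: "umod_hom N N (\<lambda>n x. x)"
  by (simp add: umod_hom_def hom_def)

lemma T_nat_coset:
  assumes "monoid V" "unstable_module N" "u \<in> carr (lannes_free (zero_sub V) N) n"
  shows "T_nat (zero_sub V) V (\<lambda>v. v) N n
      (lannes_sub (zero_sub V) N n #>\<^bsub>grade (lannes_free (zero_sub V) N) n\<^esub> u) =
    lannes_sub V N n #>\<^bsub>grade (lannes_free V N) n\<^esub> relabel (lsym_map (\<lambda>p x. x) (res_dual V)) u"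
proof -
  have "T_nat (zero_sub V) V (\<lambda>v. v) N n =
      quot_map (lannes_free V N) (lannes_sub V N) (\<lambda>n. relabel (lsym_map (\<lambda>p x. x) (res_dual V))) n"
    by (simp add: T_nat_def relabel_def[abs_def] lsym_map_def res_dual_def[abs_def] res0_def case_prod_unfold)
  then show ?thesis
    using quot_map_coset[OF pre_umod_lannes_free pre_umod_lannes_free sub_umod_lannes sub_umod_lannes
      umod_hom_lsym_map[OF umod_hom_id res_dual_dual[OF assms(1)]]
      lannes_sub_lsym_map[OF umod_hom_id res_dual_dual[OF assms(1)] res_dual_add[OF assms(1)]
        Sq_rel_res_dual[OF assms(1,2)]] assms(3)] by simp
qed

lemma gen_carr:
  assumes "x \<in> carr N n" "d \<in> dual_space (grade (H V) 0)"
  shows "gen ([], n, x, 0, d) \<in> carr (lannes_free V N) n"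
  using assms by (simp add: carr_lannes_free lannes_syms_def)

lemma coset_lannes_eq_iff:
  assumes "u \<in> carr (lannes_free V N) n" "v \<in> carr (lannes_free V N) n"
  shows "lannes_sub V N n #>\<^bsub>grade (lannes_free V N) n\<^esub> u = lannes_sub V N n #>\<^bsub>grade (lannes_free V N) n\<^esub> v
    \<longleftrightarrow> u + v \<in> lannes_sub V N n"
  using coset_eq_iff[OF pre_umodD(1)[OF pre_umod_lannes_free] sub_umodD(1)[OF sub_umod_lannes] assms]
  by (simp add: lannes_free_simps)

lemma lannes_rels_addI:
  assumes "x \<in> carr M p" "x' \<in> carr M p" "j \<le> p" "c \<in> dual_space (grade (H V) j)"
  shows "gen ([], p, x \<otimes>\<^bsub>grade M p\<^esub> x', j, c) + gen ([], p, x, j, c) + gen ([], p, x', j, c)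
    \<in> lannes_rels V M (p - j)"
  unfolding lannes_rels_def using assms by blast

text \<open>Additivity is the first bilinearity relation of the presentation.\<close>

lemma umod_hom_lannes_gen:
  assumes "unstable_module N" "d \<in> dual_space (grade (H V) 0)"
  shows "umod_hom N (T V N) (\<lambda>n x. lannes_gen V N n x 0 d)"
  unfolding umod_hom_def
proof (intro conjI allI ballI)
  have N: "pre_umod N" using assms(1) by (simp add: unstable_module_iff)
  let ?q = "\<lambda>n u. lannes_sub V N n #>\<^bsub>grade (lannes_free V N) n\<^esub> u"
  have g: "lannes_gen V N n x 0 d = ?q n (gen ([], n, x, 0, d))" for n x
    by (simp add: lannes_gen_def)
  note q = umod_homD(1)[OF umod_hom_proj[OF pre_umod_lannes_free sub_umod_lannes], of V N, folded T_def]
  note qS = quot_Sq[OF pre_umod_lannes_free sub_umod_lannes, of _ V N, folded T_def]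
  show "(\<lambda>x. lannes_gen V N n x 0 d) \<in> hom (grade N n) (grade (T V N) n)" for n
  proof (rule homI)
    fix x assume x: "x \<in> carr N n"
    show "lannes_gen V N n x 0 d \<in> carr (T V N) n"
      unfolding g by (rule hom_closed[OF q gen_carr[OF x assms(2)]])
    fix y assume y: "y \<in> carr N n"
    have xy: "x \<otimes>\<^bsub>grade N n\<^esub> y \<in> carr N n" by (rule F2_spaceD(6)[OF pre_umodD(1)[OF N] x y])
    let ?gx = "gen ([], n, x, 0, d)" and ?gy = "gen ([], n, y, 0, d)"
    note c = gen_carr[OF x assms(2)] gen_carr[OF y assms(2)] gen_carr[OF xy assms(2)]
    have s: "?gx + ?gy \<in> carr (lannes_free V N) n" "gen ([], n, x \<otimes>\<^bsub>grade N n\<^esub> y, 0, d) + (?gx + ?gy) \<in> carr (lannes_free V N) n"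
      using c F2_spaceD(6)[OF pre_umodD(1)[OF pre_umod_lannes_free], of _ V N n]
      by (simp_all add: lannes_free_simps)
    have "gen ([], n, x \<otimes>\<^bsub>grade N n\<^esub> y, 0, d) + (?gx + ?gy) \<in> lannes_rels V N n"
      using lannes_rels_addI[OF x y le0 assms(2)] by (simp add: add.assoc)
    then have "?q n (gen ([], n, x \<otimes>\<^bsub>grade N n\<^esub> y, 0, d)) = ?q n (?gx + ?gy)"
      using s lannes_rel_in_sub(1) coset_lannes_eq_iff[OF c(3) s(1)] by blast
    also have "\<dots> = ?q n ?gx \<otimes>\<^bsub>grade (T V N) n\<^esub> ?q n ?gy"
      using hom_mult[OF q c(1,2)] by (simp add: lannes_free_simps)
    finally show "lannes_gen V N n (x \<otimes>\<^bsub>grade N n\<^esub> y) 0 d =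
        lannes_gen V N n x 0 d \<otimes>\<^bsub>grade (T V N) n\<^esub> lannes_gen V N n y 0 d" unfolding g .
  qed
  fix i n x assume x: "x \<in> carr N n"
  have c: "gen ([i], n, x, 0, d) \<in> carr (lannes_free V N) (n + i)"
    using x assms(2) by (simp add: carr_lannes_free lannes_syms_def)
  have "?q (n + i) (gen ([], n + i, Sq N i n x, 0, d)) = ?q (n + i) (gen ([i], n, x, 0, d))"
    using coset_lannes_eq_iff[OF gen_carr[OF Sq_closed[OF N x] assms(2)] c] Sq_0_rel[OF assms(1) x assms(2)]
    by blast
  then show "lannes_gen V N (n + i) (Sq N i n x) 0 d = Sq (T V N) i n (lannes_gen V N n x 0 d)"
    unfolding g qS[OF gen_carr[OF x assms(2)]] by (simp add: lannes_free_simps)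
qed

text \<open>The functional \<open>\<epsilon>\<close> in the isomorphism \<open>N \<cong> T_0(N)\<close>, \<open>x \<mapsto> [x, \<epsilon>]\<close>.\<close>

definition vertex_eval :: "'v monoid \<Rightarrow> 'v coh \<Rightarrow> bit" where
  "vertex_eval V = restrict (\<lambda>X. the_elem ((\<lambda>f. f [\<one>\<^bsub>V\<^esub>]) ` X)) (carr (H (zero_sub V)) 0)"

lemma vertex_eval_dual: "vertex_eval V \<in> dual_space (grade (H (zero_sub V)) 0)"
  unfolding vertex_eval_def
  by (rule dual_space_restrictI[OF carr_H_add]) (auto simp: carr_H_0 add_H_0)

lemma vertex_eval_unt:
  assumes "monoid V"
  shows "unt (H (zero_sub V)) \<in> carr (H (zero_sub V)) 0" "vertex_eval V (unt (H (zero_sub V))) = 1"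
proof -
  have u: "unt (H (zero_sub V)) = {\<lambda>s. if s = [\<one>\<^bsub>V\<^esub>] then 1 else 0}"
    using cochains_coset[of "zero_sub V" 0] by (simp add: H_def coh_class_zero_sub simplices_zero_sub)
  then show c: "unt (H (zero_sub V)) \<in> carr (H (zero_sub V)) 0"
    by (simp add: carr_H_0 cocycles_zero_sub_0[OF assms])
  show "vertex_eval V (unt (H (zero_sub V))) = 1"
    using c by (simp add: vertex_eval_def u)
qed

lemma T_zero_eq: "T_zero V N n x = lannes_gen (zero_sub V) N n x 0 (vertex_eval V)"
  by (simp add: T_zero_def vertex_eval_def)

text \<open>The image of \<open>[x, \<epsilon>]\<close> under \<open>T_0(N) \<rightarrow> T_V(N)\<close> is \<open>[x, d]\<close> for the functional
  \<open>d = \<epsilon> \<circ> res\<close> of degree zero.\<close>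

lemma umod_hom_rho:
  assumes "monoid V" "unstable_module N"
  shows "umod_hom N (T V N) (rho V N)"
proof -
  have "rho V N n x = lannes_gen V N n x 0 (res_dual V 0 (vertex_eval V))" if "x \<in> carr N n" for n x
    unfolding rho_def T_zero_eq lannes_gen_def
    using T_nat_coset[OF assms gen_carr[OF that vertex_eval_dual]] by simp
  moreover have "pre_umod N" using assms(2) by (simp add: unstable_module_iff)
  ultimately show ?thesis
    using umod_hom_lannes_gen[OF assms(2) res_dual_dual[OF assms(1) vertex_eval_dual]]
    by (auto simp: umod_hom_def hom_def Pi_iff Sq_closed F2_spaceD(6)[OF pre_umodD(1)])
qed


section \<open>Recovering a module from its Lannes module at the trivial group\<close>

lemma Sq_word_closed:
  assumes "pre_umod N" "x \<in> carr N p"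
  shows "Sq_word N p w x \<in> carr N (p + sum_list w)"
proof (induction w)
  case (Cons i w)
  then show ?case using Sq_closed[OF assms(1) Cons, of i] by (simp add: add_ac)
qed (use assms in simp)

lemma Sq_word_hom:
  assumes "pre_umod M" "umod_hom M N f" "x \<in> carr M p"
  shows "f (p + sum_list w) (Sq_word M p w x) = Sq_word N p w (f p x)"
proof (induction w)
  case (Cons i w)
  then show ?case
    using umod_homD(2)[OF assms(2) Sq_word_closed[OF assms(1,3)], of w i] by (simp add: add_ac)
qed simp

text \<open>The map \<open>T_0(N) \<rightarrow> N\<close> adjoint to the isomorphism \<open>N \<cong> N \<otimes> H\<^sup>*(0)\<close>, on the basis of the
  presentation, for \<open>V = 0\<close>: \<open>Sq\<^sup>w [x, c]\<close> goes to \<open>c(1) Sq\<^sup>w x\<close> for \<open>c\<close> of degree zero and to zero otherwise.\<close>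

definition eval_sym :: "'v monoid \<Rightarrow> ('a, 'x) umod_scheme \<Rightarrow> nat \<Rightarrow> ('a, 'v) lsym \<Rightarrow> 'a" where
  "eval_sym V N n = (\<lambda>(w, p, x, j, c).
     if j = 0 \<and> c (unt (H V)) = 1 then Sq_word N p w x else \<one>\<^bsub>grade N n\<^esub>)"

definition eval_free :: "'v monoid \<Rightarrow> ('a, 'x) umod_scheme \<Rightarrow> nat \<Rightarrow> (('a, 'v) lsym \<Rightarrow>\<^sub>0 bit) \<Rightarrow> 'a" where
  "eval_free V N n = lin_ext (grade N n) (eval_sym V N n)"

text \<open>The symbols whose value lies in \<open>N\<^sup>n\<close>.  They include, with arbitrary functionals \<open>c \<circ> Sq\<^sup>l\<close>,
  all single terms of the defining relations, so that evaluation can be computed term by term.\<close>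

definition eval_dom :: "('a, 'x) umod_scheme \<Rightarrow> nat \<Rightarrow> ('a, 'v) lsym set" where
  "eval_dom N n = {(w, p, x, j, c). x \<in> carr N p \<and> (j = 0 \<longrightarrow> sum_list w + p = n)}"

lemma eval_sym_closed:
  assumes "pre_umod N" "s \<in> eval_dom N n"
  shows "eval_sym V N n s \<in> carr N n"
proof -
  obtain w p x j c where s: "s = (w, p, x, j, c)" by (cases s) auto
  show ?thesis
    using assms(2) Sq_word_closed[OF assms(1), of x p w] F2_spaceD(7)[OF pre_umodD(1)[OF assms(1)]]
    by (auto simp: s eval_sym_def eval_dom_def add.commute)
qed

lemma lannes_syms_eval_dom: "lannes_syms V N n \<subseteq> eval_dom N n"
  by (auto simp: lannes_syms_def eval_dom_def)

lemma eval_free_hom: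
  assumes "pre_umod N"
  shows "eval_free V N n \<in> hom (free_space (eval_dom N n)) (grade N n)"
  unfolding eval_free_def
  by (rule lin_ext_hom[OF pre_umodD(1)[OF assms]]) (use eval_sym_closed[OF assms] in blast)

lemma eval_free_hom_lannes:
  assumes "pre_umod N"
  shows "eval_free V N n \<in> hom (grade (lannes_free V N) n) (grade N n)"
  unfolding eval_free_def lannes_free_simps
  by (rule lin_ext_hom[OF pre_umodD(1)[OF assms]])
    (use eval_sym_closed[OF assms] lannes_syms_eval_dom in blast)

lemma eval_free_gen:
  assumes "pre_umod N" "s \<in> eval_dom N n"
  shows "eval_free V N n (gen s) = eval_sym V N n s"
  unfolding eval_free_def
  using pre_umodD(1)[OF assms(1)] eval_sym_closed[OF assms] by (rule lin_ext_gen)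

lemma umod_hom_eval_free:
  assumes "pre_umod N"
  shows "umod_hom (lannes_free V N) N (eval_free V N)"
  unfolding umod_hom_def
proof (intro conjI allI ballI eval_free_hom_lannes[OF assms])
  fix i n u assume u: "u \<in> carr (lannes_free V N) n"
  show "eval_free V N (n + i) (Sq (lannes_free V N) i n u) = Sq N i n (eval_free V N n u)"
  proof (rule free_hom_eq[OF pre_umodD(1)[OF assms]])
    show "u \<in> carrier (free_space (lannes_syms V N n))" using u by (simp add: lannes_free_simps)
    show "(\<lambda>u. eval_free V N (n + i) (Sq (lannes_free V N) i n u)) \<in>
        hom (free_space (lannes_syms V N n)) (grade N (n + i))"
      using hom_compose[OF pre_umodD(2)[OF pre_umod_lannes_free] eval_free_hom_lannes[OF assms]]
      by (simp add: comp_def lannes_free_simps)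
    show "(\<lambda>u. Sq N i n (eval_free V N n u)) \<in> hom (free_space (lannes_syms V N n)) (grade N (n + i))"
      using hom_compose[OF eval_free_hom_lannes[OF assms] pre_umodD(2)[OF assms]]
      by (simp add: comp_def lannes_free_simps)
    fix s assume s: "s \<in> lannes_syms V N n"
    obtain w p x j c where sym: "s = (w, p, x, j, c)" by (cases s) auto
    have "(i # w, p, x, j, c) \<in> eval_dom N (n + i)" "s \<in> eval_dom N n" "j = 0 \<Longrightarrow> n = p + sum_list w"
      using s by (auto simp: sym lannes_syms_def eval_dom_def)
    then show "eval_free V N (n + i) (Sq (lannes_free V N) i n (gen s)) =
        Sq N i n (eval_free V N n (gen s))"
      using F2_hom_one[OF pre_umodD(2)[OF assms] pre_umodD(1)[OF assms] pre_umodD(1)[OF assms]]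
      by (simp add: lannes_free_simps sym eval_free_gen[OF assms] eval_sym_def)
  qed
qed

lemma hom_sum_one:
  assumes "F2_space G" "f \<in> hom (free_space S) G"
    "\<And>a. a \<in> A \<Longrightarrow> g a \<in> carrier (free_space S) \<and> f (g a) = \<one>\<^bsub>G\<^esub>"
  shows "sum g A \<in> carrier (free_space S) \<and> f (sum g A) = \<one>\<^bsub>G\<^esub>"
proof -
  have 0: "f 0 = \<one>\<^bsub>G\<^esub>" using F2_hom_one[OF assms(2) F2_space_free assms(1)] by simp
  show ?thesis using assms(3)
  proof (induction A rule: infinite_finite_induct)
    case (insert a A)
    then have IH: "sum g A \<in> carrier (free_space S)" "f (sum g A) = \<one>\<^bsub>G\<^esub>"
      "g a \<in> carrier (free_space S)" "f (g a) = \<one>\<^bsub>G\<^esub>" by auto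
    then show ?case
      using hom_mult[OF assms(2) IH(3,1)] F2_spaceD(6)[OF F2_space_free IH(3,1)]
        F2_spaceD(5,7)[OF assms(1)] insert.hyps by simp
  qed (auto simp: 0)
qed

text \<open>Evaluation descends to \<open>T_0(N)\<close>.  For the bilinearity relations this is linearity in \<open>x\<close> and
  of \<open>c \<mapsto> c(1)\<close>.  In the relation for \<open>[Sq\<^sup>i x, c]\<close>, if \<open>c\<close> has degree zero both terms go to
  \<open>c(1) Sq\<^sup>i x\<close>, and otherwise \<open>Sq\<^sup>j 1 = 0\<close> in \<open>H\<^sup>j(0)\<close>, so all terms go to zero.  The relations that express
  instability hold in \<open>N\<close>.\<close>

lemma eval_free_kills:
  assumes "monoid V" "unstable_module N" "r \<in> lannes_sub (zero_sub V) N n"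
  shows "eval_free (zero_sub V) N n r = \<one>\<^bsub>grade N n\<^esub>"
proof -
  let ?Z = "zero_sub V"
  let ?e = "unt (H ?Z)"
  note e = vertex_eval_unt(1)[OF assms(1)]
  have N: "pre_umod N" and rels: "\<And>n r. r \<in> unstable_rels N n \<Longrightarrow> r = \<one>\<^bsub>grade N n\<^esub>"
    using assms(2) unfolding unstable_module_iff by blast+
  have ker: "eval_free ?Z N n r \<in> {\<one>\<^bsub>grade N n\<^esub>}" if "r \<in> lannes_rels ?Z N n" for n r
  proof -
    note F = pre_umodD(1)[OF N, of n] and h = eval_free_hom[OF N, of ?Z n]
    note m = hom_mult[OF h, simplified] and g = eval_free_gen[OF N, of _ n ?Z]
    note one = F2_spaceD(7)[OF F] and sq = F2_spaceD(5)[OF F]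
    interpret comm_group "grade N n" by (rule F2_spaceD(1)[OF F])
    have m3: "eval_free ?Z N n (gen a + gen b + gen c) =
        (eval_sym ?Z N n a \<otimes>\<^bsub>grade N n\<^esub> eval_sym ?Z N n b) \<otimes>\<^bsub>grade N n\<^esub> eval_sym ?Z N n c"
      if "a \<in> eval_dom N n" "b \<in> eval_dom N n" "c \<in> eval_dom N n" for a b c
    proof -
      have "Poly_Mapping.keys (gen a + gen b :: _ \<Rightarrow>\<^sub>0 bit) \<subseteq> eval_dom N n"
        using Poly_Mapping.keys_add[of "gen a :: _ \<Rightarrow>\<^sub>0 bit" "gen b"] that by auto
      then show ?thesis using that by (simp add: m g)
    qed
    from that consider
      (1) p x x' j c where "r = gen ([], p, x \<otimes>\<^bsub>grade N p\<^esub> x', j, c) + gen ([], p, x, j, c) + gen ([], p, x', j, c)"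
          "x \<in> carr N p" "x' \<in> carr N p" "j \<le> p" "c \<in> dual_space (grade (H ?Z) j)" "p - j = n"
    | (2) p x j c c' where "r = gen ([], p, x, j, restrict (\<lambda>h. c h + c' h) (carr (H ?Z) j)) +
          gen ([], p, x, j, c) + gen ([], p, x, j, c')"
          "x \<in> carr N p" "j \<le> p" "c \<in> dual_space (grade (H ?Z) j)"
          "c' \<in> dual_space (grade (H ?Z) j)" "p - j = n"
    | (3) i p x j c where "r = gen ([], p + i, Sq N i p x, j, c) +
          (\<Sum>l\<in>{l. l \<le> i \<and> l \<le> j \<and> j - l \<le> p}.
             gen ([i - l], p, x, j - l, restrict (\<lambda>h. c (Sq (H ?Z) l (j - l) h)) (carr (H ?Z) (j - l))))"
          "x \<in> carr N p" "j \<le> p + i" "c \<in> dual_space (grade (H ?Z) j)" "p + i - j = n"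
      unfolding lannes_rels_def by blast
    then show ?thesis
    proof cases
      case 1
      have xx: "x \<otimes>\<^bsub>grade N p\<^esub> x' \<in> carr N p" using F2_spaceD(6)[OF pre_umodD(1)[OF N]] 1 by blast
      then have d: "([], p, x \<otimes>\<^bsub>grade N p\<^esub> x', j, c) \<in> eval_dom N n"
        "([], p, x, j, c) \<in> eval_dom N n" "([], p, x', j, c) \<in> eval_dom N n"
        using 1 by (auto simp: eval_dom_def)
      show ?thesis
      proof (cases "j = 0 \<and> c ?e = 1")
        case True
        then have "x \<in> carr N n" "x' \<in> carr N n" "p = n" using 1 by auto
        moreover have "eval_free ?Z N n r = (x \<otimes>\<^bsub>grade N p\<^esub> x') \<otimes>\<^bsub>grade N n\<^esub> x \<otimes>\<^bsub>grade N n\<^esub> x'"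
          unfolding 1(1) m3[OF d] using True by (simp add: eval_sym_def)
        ultimately show ?thesis using sq[of "x \<otimes>\<^bsub>grade N n\<^esub> x'"] by (simp add: m_assoc)
      next
        case False
        then show ?thesis using 1 by (auto simp: m3[OF d] eval_sym_def)
      qed
    next
      case 2
      then have d: "([], p, x, j, restrict (\<lambda>h. c h + c' h) (carr (H ?Z) j)) \<in> eval_dom N n"
        "([], p, x, j, c) \<in> eval_dom N n" "([], p, x, j, c') \<in> eval_dom N n"
        by (auto simp: eval_dom_def)
      show ?thesis
      proof (cases "j = 0")
        case True
        then have "x \<in> carr N n" using 2 by simp
        then show ?thesis
          unfolding 2(1) m3[OF d] using True e sq bit_cases[of "c ?e"] bit_cases[of "c' ?e"]
          by (auto simp: eval_sym_def)
      next
        case False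
        then show ?thesis using 2(1) by (simp add: m3[OF d] eval_sym_def)
      qed
    next
      case 3
      have Sx: "Sq N i p x \<in> carr N (p + i)" by (rule Sq_closed[OF N 3(2)])
      then have d: "([], p + i, Sq N i p x, j, c) \<in> eval_dom N n" using 3 by (auto simp: eval_dom_def)
      show ?thesis
      proof (cases "j = 0")
        case True
        have "{l. l \<le> i \<and> l \<le> 0 \<and> 0 - l \<le> p} = {0 :: nat}" by auto
        then have r: "r = gen ([], p + i, Sq N i p x, 0, c) + gen ([i], p, x, 0, c)"
          using 3(1) restrict_Sq_0[OF 3(4)[unfolded True]] by (simp add: True)
        have d': "([i], p, x, 0, c) \<in> eval_dom N n" using 3 True by (auto simp: eval_dom_def)
        have "eval_free ?Z N n r = eval_sym ?Z N n ([], p + i, Sq N i p x, 0, c) \<otimes>\<^bsub>grade N n\<^esub> eval_sym ?Z N n ([i], p, x, 0, c)"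
          using d d' True by (simp add: r m g)
        then show ?thesis using Sx 3(5) True sq by (auto simp: eval_sym_def)
      next
        case False
        let ?g = "\<lambda>l. gen ([i - l], p, x, j - l, restrict (\<lambda>h. c (Sq (H ?Z) l (j - l) h)) (carr (H ?Z) (j - l)))"
        have "?g l \<in> carrier (free_space (eval_dom N n)) \<and> eval_free ?Z N n (?g l) = \<one>\<^bsub>grade N n\<^esub>"
          if "l \<in> {l. l \<le> i \<and> l \<le> j \<and> j - l \<le> p}" for l
        proof -
          have d': "([i - l], p, x, j - l, restrict (\<lambda>h. c (Sq (H ?Z) l (j - l) h)) (carr (H ?Z) (j - l))) \<in> eval_dom N n"
            using that 3(2,5) by (auto simp: eval_dom_def)
          have "c (Sq (H ?Z) l (j - l) ?e) = 0" if "l = j"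
            using Sq_H_zero_sub[of j j ?e V] dual_H_zero_sub[OF 3(4)] False that e by simp
          then have "eval_sym ?Z N n ([i - l], p, x, j - l, restrict (\<lambda>h. c (Sq (H ?Z) l (j - l) h)) (carr (H ?Z) (j - l))) = \<one>\<^bsub>grade N n\<^esub>"
            using that e by (auto simp: eval_sym_def)
          then show ?thesis using d' g[OF d'] by simp
        qed
        then have "sum ?g {l. l \<le> i \<and> l \<le> j \<and> j - l \<le> p} \<in> carrier (free_space (eval_dom N n)) \<and>
            eval_free ?Z N n (sum ?g {l. l \<le> i \<and> l \<le> j \<and> j - l \<le> p}) = \<one>\<^bsub>grade N n\<^esub>"
          by (rule hom_sum_one[OF F h])
        then have s: "Poly_Mapping.keys (sum ?g {l. l \<le> i \<and> l \<le> j \<and> j - l \<le> p}) \<subseteq> eval_dom N n"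
          "eval_free ?Z N n (sum ?g {l. l \<le> i \<and> l \<le> j \<and> j - l \<le> p}) = \<one>\<^bsub>grade N n\<^esub>" by simp_all
        have "eval_free ?Z N n r = eval_sym ?Z N n ([], p + i, Sq N i p x, j, c) \<otimes>\<^bsub>grade N n\<^esub> \<one>\<^bsub>grade N n\<^esub>"
          unfolding 3(1) using d m[OF _ s(1)] s(2) g[OF d] by simp
        then show ?thesis using False by (simp add: eval_sym_def)
      qed
    qed
  qed
  have "eval_free ?Z N n ` lannes_sub ?Z N n \<subseteq> {\<one>\<^bsub>grade N n\<^esub>}"
    by (rule lannes_sub_map[OF N umod_hom_eval_free[OF N] zero_sub_umod[OF N]]) (use ker rels in auto)
  then show ?thesis using assms(3) by blast
qed

lemma eval_free_natural:
  assumes "pre_umod M" "pre_umod N" "umod_hom M N f" "u \<in> carr (lannes_free V M) n"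
  shows "eval_free V N n (relabel (lsym_map f (\<lambda>j c. c)) u) = f n (eval_free V M n u)"
proof (rule free_hom_eq[OF pre_umodD(1)[OF assms(2)]])
  show "u \<in> carrier (free_space (lannes_syms V M n))" using assms(4) by (simp add: lannes_free_simps)
  have "umod_hom (lannes_free V M) (lannes_free V N) (\<lambda>n. relabel (lsym_map f (\<lambda>j c. c)))"
    by (rule umod_hom_lsym_map[OF assms(3)])
  from hom_compose[OF umod_homD(1)[OF this] eval_free_hom_lannes[OF assms(2)]]
  show "(\<lambda>u. eval_free V N n (relabel (lsym_map f (\<lambda>j c. c)) u)) \<in>
      hom (free_space (lannes_syms V M n)) (grade N n)"
    by (simp add: comp_def lannes_free_simps)
  show "(\<lambda>u. f n (eval_free V M n u)) \<in> hom (free_space (lannes_syms V M n)) (grade N n)"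
    using hom_compose[OF eval_free_hom_lannes[OF assms(1)] umod_homD(1)[OF assms(3)]]
    by (simp add: comp_def lannes_free_simps)
  fix s assume s: "s \<in> lannes_syms V M n"
  obtain w p x j c where sym: "s = (w, p, x, j, c)" by (cases s) auto
  have *: "(w, p, f p x, j, c) \<in> eval_dom N n" "s \<in> eval_dom M n" "j = 0 \<Longrightarrow> n = p + sum_list w" "x \<in> carr M p"
    using s umod_homD(3)[OF assms(3)] by (auto simp: sym lannes_syms_def eval_dom_def)
  then show "eval_free V N n (relabel (lsym_map f (\<lambda>j c. c)) (gen s)) = f n (eval_free V M n (gen s))"
    using F2_hom_one[OF umod_homD(1)[OF assms(3)] pre_umodD(1)[OF assms(1)] pre_umodD(1)[OF assms(2)]]
      Sq_word_hom[OF assms(1,3) *(4), of w]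
    by (simp add: sym eval_free_gen[OF assms(1)] eval_free_gen[OF assms(2)] eval_sym_def)
qed

lemma eval_free_vertex:
  assumes "monoid V" "pre_umod N" "x \<in> carr N n"
  shows "eval_free (zero_sub V) N n (gen ([], n, x, 0, vertex_eval V)) = x"
  using assms(3) by (subst eval_free_gen[OF assms(2)])
    (simp_all add: eval_dom_def eval_sym_def vertex_eval_unt(2)[OF assms(1)])

text \<open>Evaluation is natural and is a left inverse of \<open>x \<mapsto> [x, \<epsilon>]\<close>.  If \<open>f x = f y\<close>, then \<open>T_0(f)\<close> takes the
  same value on \<open>[x, \<epsilon>]\<close> and \<open>[y, \<epsilon>]\<close>, so these are equal, and evaluation gives \<open>x = y\<close>.  If
  \<open>[y, \<epsilon>] = T_0(f)(X)\<close>, then \<open>y\<close> is the value of \<open>f\<close> on the evaluation of \<open>X\<close>.\<close>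

lemma bij_if_T_zero_bij:
  assumes "monoid V" "unstable_module M" "unstable_module N" "umod_hom M N f"
    "bij_betw (T_map (zero_sub V) M N f n) (carr (T (zero_sub V) M) n) (carr (T (zero_sub V) N) n)"
  shows "bij_betw (f n) (carr M n) (carr N n)"
proof (rule bij_betw_imageI)
  let ?Z = "zero_sub V"
  let ?g = "\<lambda>x. gen ([], n, x, 0, vertex_eval V)"
  have M: "pre_umod M" and N: "pre_umod N" using assms(2,3) by (simp_all add: unstable_module_iff)
  note fc = umod_homD(3)[OF assms(4)]
  note gM = gen_carr[OF _ vertex_eval_dual, of _ M n V] and gN = gen_carr[OF _ vertex_eval_dual, of _ N n V]
  have carr: "carr (T ?Z L) n = (\<lambda>u. lannes_sub ?Z L n #>\<^bsub>grade (lannes_free ?Z L) n\<^esub> u) ` carr (lannes_free ?Z L) n"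
    for L :: "('l, 'k) umod_scheme"
    unfolding T_def by (rule carr_quot_umod)
  have ev_eq: "eval_free ?Z L n u = eval_free ?Z L n v"
    if "unstable_module L" "u \<in> carr (lannes_free ?Z L) n" "v \<in> carr (lannes_free ?Z L) n"
      "lannes_sub ?Z L n #>\<^bsub>grade (lannes_free ?Z L) n\<^esub> u = lannes_sub ?Z L n #>\<^bsub>grade (lannes_free ?Z L) n\<^esub> v"
    for L :: "('l, 'k) umod_scheme" and u v
  proof -
    have L: "pre_umod L" using that(1) by (simp add: unstable_module_iff)
    note h = eval_free_hom_lannes[OF L, of ?Z n]
    have "u + v \<in> lannes_sub ?Z L n" using that coset_lannes_eq_iff by blast
    then have "eval_free ?Z L n (u + v) = \<one>\<^bsub>grade L n\<^esub>" by (rule eval_free_kills[OF assms(1) that(1)])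
    then have "eval_free ?Z L n u \<otimes>\<^bsub>grade L n\<^esub> eval_free ?Z L n v = \<one>\<^bsub>grade L n\<^esub>"
      using hom_mult[OF h that(2,3)] by (simp add: lannes_free_simps)
    then show ?thesis
      using F2_space_eq_iff[OF pre_umodD(1)[OF L] hom_closed[OF h that(2)] hom_closed[OF h that(3)]] by blast
  qed
  show "inj_on (f n) (carr M n)"
  proof (rule inj_onI)
    fix x y assume xy: "x \<in> carr M n" "y \<in> carr M n" "f n x = f n y"
    let ?q = "\<lambda>u. lannes_sub ?Z M n #>\<^bsub>grade (lannes_free ?Z M) n\<^esub> u"
    have "T_map ?Z M N f n (?q (?g x)) = T_map ?Z M N f n (?q (?g y))"
      using T_map_coset[OF assms(4) gM[OF xy(1)]] T_map_coset[OF assms(4) gM[OF xy(2)]] xy(3) by simp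
    moreover have "?q (?g x) \<in> carr (T ?Z M) n" "?q (?g y) \<in> carr (T ?Z M) n"
      unfolding carr using gM xy by blast+
    ultimately have "?q (?g x) = ?q (?g y)"
      using bij_betw_imp_inj_on[OF assms(5)] by (auto dest: inj_onD)
    from ev_eq[OF assms(2) gM[OF xy(1)] gM[OF xy(2)] this] show "x = y"
      using eval_free_vertex[OF assms(1) M] xy by simp
  qed
  have "y \<in> f n ` carr M n" if y: "y \<in> carr N n" for y
  proof -
    let ?q = "\<lambda>u. lannes_sub ?Z N n #>\<^bsub>grade (lannes_free ?Z N) n\<^esub> u"
    have "?q (?g y) \<in> carr (T ?Z N) n" unfolding carr using gN[OF y] by blast
    then obtain X where X: "X \<in> carr (T ?Z M) n" "?q (?g y) = T_map ?Z M N f n X"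
      using bij_betw_imp_surj_on[OF assms(5)] by blast
    then obtain u where u: "u \<in> carr (lannes_free ?Z M) n"
      "X = lannes_sub ?Z M n #>\<^bsub>grade (lannes_free ?Z M) n\<^esub> u" unfolding carr by blast
    let ?u = "relabel (lsym_map f (\<lambda>j c. c)) u"
    have c: "?u \<in> carr (lannes_free ?Z N) n"
      using umod_homD(3)[OF umod_hom_lsym_map[OF assms(4)] u(1)] .
    have "?q (?g y) = ?q ?u" using X(2) u T_map_coset[OF assms(4) u(1)] by simp
    from ev_eq[OF assms(3) gN[OF y] c this] have "y = f n (eval_free ?Z M n u)"
      using eval_free_vertex[OF assms(1) N y] eval_free_natural[OF M N assms(4) u(1)] by simp
    then show ?thesis using hom_closed[OF eval_free_hom_lannes[OF M] u(1)] by blast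
  qed
  then show "f n ` carr M n = carr N n" using fc by blast
qed

lemma zero_sub_Vf:
  assumes "V \<in> Vf"
  shows "zero_sub V \<in> Vf"
proof -
  have V: "F2_space V" using assms by (simp add: Vf_def)
  interpret comm_group V by (rule F2_spaceD(1)[OF V])
  have "comm_group (zero_sub V)" by (rule comm_groupI) auto
  then show ?thesis by (simp add: Vf_def F2_space_def)
qed

text \<open>The heart of the matter, for an arbitrary map of unstable modules: \<open>T_V\<close> and truncation
  are functors, and conversely the zero space alone detects isomorphisms, degree by degree.\<close>

theorem umod_iso_iff_f_trunc_iso:
  fixes V :: "'v monoid"
  assumes "V \<in> Vf" "unstable_module M" "unstable_module N" "umod_hom M N f"
  shows "umod_iso M N f \<longleftrightarrow> (\<forall>k\<in>{1..}. f_trunc_iso TYPE('v) k M N f)"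
proof
  assume "umod_iso M N f"
  then show "\<forall>k\<in>{1..}. f_trunc_iso TYPE('v) k M N f"
    unfolding f_trunc_iso_def using trunc_map_iso[OF pre_umod_T pre_umod_T T_map_iso] by blast
next
  assume iso: "\<forall>k\<in>{1..}. f_trunc_iso TYPE('v) k M N f"
  have V: "monoid V" using assms(1) F2_spaceD(4) by (auto simp: Vf_def)
  have M: "pre_umod M" and N: "pre_umod N" using assms(2,3) by (simp_all add: unstable_module_iff)
  show "umod_iso M N f"
  proof (rule umod_iso_if_bij[OF M N assms(4)])
    fix n
    \<comment> \<open>Truncation at \<open>k = n + 1\<close> is the first one that sees degree \<open>n\<close>.\<close>
    have "f_trunc_iso TYPE('v) (Suc n) M N f" using iso by simp
    then have "umod_iso (trunc (Suc n) (T (zero_sub V) M)) (trunc (Suc n) (T (zero_sub V) N))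
        (trunc_map (Suc n) (T (zero_sub V) N) (T_map (zero_sub V) M N f))"
      using zero_sub_Vf[OF assms(1)] unfolding f_trunc_iso_def by blast
    from trunc_iso_imp_bij[OF pre_umod_T pre_umod_T umod_hom_T_map[OF assms(4)] this lessI]
    show "bij_betw (f n) (carr M n) (carr N n)"
      by (rule bij_if_T_zero_bij[OF V assms(2-4)])
  qed
qed


section \<open>Tensor products\<close>

lemma pre_umod_F2: "pre_umod F2_umod"
proof -
  have double: "b + b = 0" for b :: bit using bit_cases[of b] by auto
  have "comm_group (grade F2_umod n)" for n
  proof (rule comm_groupI)
    fix x assume "x \<in> carr F2_umod n"
    then show "\<exists>y\<in>carr F2_umod n. y \<otimes>\<^bsub>grade F2_umod n\<^esub> x = \<one>\<^bsub>grade F2_umod n\<^esub>"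
      using double by (intro bexI[of _ x]) (auto simp: F2_umod_def)
  qed (auto simp: F2_umod_def add_ac)
  then have "F2_space (grade F2_umod n)" for n
    using double by (auto simp: F2_space_def F2_umod_def)
  moreover have "Sq F2_umod i n \<in> hom (grade F2_umod n) (grade F2_umod (n + i))" for i n
    by (auto simp: F2_umod_def hom_def)
  ultimately show ?thesis by (simp add: pre_umod_def)
qed

lemma F2_umod_simps:
  "carr F2_umod n = (if n = 0 then UNIV else {0})"
  "x \<otimes>\<^bsub>grade F2_umod n\<^esub> y = x + y" "\<one>\<^bsub>grade F2_umod n\<^esub> = 0"
  "Sq F2_umod i n x = (if i = 0 then x else 0)"
  by (auto simp: F2_umod_def)

lemma tensor_rels_carr:
  assumes "pre_umod M" "pre_umod N"
  shows "tensor_rels M N n \<subseteq> carrier (free_space (tensor_gens M N n))"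
proof -
  have 3: "gen a + gen b + gen c \<in> carrier (free_space S)" if "a \<in> S" "b \<in> S" "c \<in> S" for a b c :: 's and S
  proof -
    have "gen a \<in> carrier (free_space S)" "gen b \<in> carrier (free_space S)" "gen c \<in> carrier (free_space S)"
      using that by auto
    then show ?thesis using F2_spaceD(6)[OF F2_space_free, of _ S] by (metis free_space_simps(2))
  qed
  note mM = F2_spaceD(6)[OF pre_umodD(1)[OF assms(1)]] and mN = F2_spaceD(6)[OF pre_umodD(1)[OF assms(2)]]
  show ?thesis
    unfolding tensor_rels_def
    by (auto simp del: free_space_simps(1) intro!: 3) (auto simp: tensor_gens_def mM mN)
qed

abbreviation tensor_kernel where
  "tensor_kernel M N n \<equiv> generate (free_space (tensor_gens M N n)) (tensor_rels M N n)"

lemma subgroup_tensor_kernel: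
  assumes "pre_umod M" "pre_umod N"
  shows "subgroup (tensor_kernel M N n) (free_space (tensor_gens M N n))"
  by (rule group.generate_is_subgroup[OF F2_spaceD(2)[OF F2_space_free] tensor_rels_carr[OF assms]])

lemma F2_space_tensor:
  assumes "pre_umod M" "pre_umod N"
  shows "F2_space (tensor_grade M N n)"
  unfolding tensor_grade_def by (rule F2_space_quot[OF F2_space_free subgroup_tensor_kernel[OF assms]])

lemma pure_closed:
  assumes "x \<in> carr M p" "y \<in> carr N q"
  shows "pure M N p x q y \<in> carrier (tensor_grade M N (p + q))"
  unfolding pure_def tensor_grade_def carrier_quot using assms
  by (intro imageI) (simp add: tensor_gens_def)

text \<open>In characteristic two, a relation with three summands says that the first is the sum of
  the others.\<close>

lemma pure_rel:
  assumes "pre_umod M" "pre_umod N" "gen a + gen b + gen c \<in> tensor_rels M N n"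
    "a \<in> tensor_gens M N n" "b \<in> tensor_gens M N n" "c \<in> tensor_gens M N n"
  shows "tensor_kernel M N n #>\<^bsub>free_space (tensor_gens M N n)\<^esub> gen a =
    (tensor_kernel M N n #>\<^bsub>free_space (tensor_gens M N n)\<^esub> gen b)
      \<otimes>\<^bsub>tensor_grade M N n\<^esub> (tensor_kernel M N n #>\<^bsub>free_space (tensor_gens M N n)\<^esub> gen c)"
proof -
  let ?G = "free_space (tensor_gens M N n)" and ?K = "tensor_kernel M N n"
  note K = subgroup_tensor_kernel[OF assms(1,2), of n]
  have g: "gen a \<in> carrier ?G" "gen b \<in> carrier ?G" "gen c \<in> carrier ?G" using assms(4-6) by auto
  have bc: "gen b + gen c \<in> carrier ?G"
    using F2_spaceD(6)[OF F2_space_free g(2,3)] by (simp only: free_space_simps(2))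
  have "gen a + gen b + gen c \<in> ?K" using assms(3) by (rule generate.incl)
  then have "?K #>\<^bsub>?G\<^esub> gen a = ?K #>\<^bsub>?G\<^esub> (gen b + gen c)"
    using coset_eq_iff[OF F2_space_free K g(1) bc] by (simp add: add.assoc)
  also have "\<dots> = (?K #>\<^bsub>?G\<^esub> gen b) \<otimes>\<^bsub>tensor_grade M N n\<^esub> (?K #>\<^bsub>?G\<^esub> gen c)"
    using hom_mult[OF quot_hom[OF F2_space_free K] g(2,3)] by (simp add: tensor_grade_def)
  finally show ?thesis .
qed

lemma pure_add:
  assumes "pre_umod M" "pre_umod N"
  shows "x \<in> carr M p \<Longrightarrow> x' \<in> carr M p \<Longrightarrow> y \<in> carr N q \<Longrightarrow>
      pure M N p (x \<otimes>\<^bsub>grade M p\<^esub> x') q y =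
        pure M N p x q y \<otimes>\<^bsub>tensor_grade M N (p + q)\<^esub> pure M N p x' q y"
    "x \<in> carr M p \<Longrightarrow> y \<in> carr N q \<Longrightarrow> y' \<in> carr N q \<Longrightarrow>
      pure M N p x q (y \<otimes>\<^bsub>grade N q\<^esub> y') =
        pure M N p x q y \<otimes>\<^bsub>tensor_grade M N (p + q)\<^esub> pure M N p x q y'"
proof -
  note mM = F2_spaceD(6)[OF pre_umodD(1)[OF assms(1)]] and mN = F2_spaceD(6)[OF pre_umodD(1)[OF assms(2)]]
  show "pure M N p (x \<otimes>\<^bsub>grade M p\<^esub> x') q y =
        pure M N p x q y \<otimes>\<^bsub>tensor_grade M N (p + q)\<^esub> pure M N p x' q y"
    if "x \<in> carr M p" "x' \<in> carr M p" "y \<in> carr N q"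
    unfolding pure_def
  proof (rule pure_rel[OF assms])
    show "gen (p, x \<otimes>\<^bsub>grade M p\<^esub> x', q, y) + gen (p, x, q, y) + gen (p, x', q, y) \<in> tensor_rels M N (p + q)"
      unfolding tensor_rels_def using that by blast
  qed (use that mM in \<open>auto simp: tensor_gens_def\<close>)
  show "pure M N p x q (y \<otimes>\<^bsub>grade N q\<^esub> y') =
        pure M N p x q y \<otimes>\<^bsub>tensor_grade M N (p + q)\<^esub> pure M N p x q y'"
    if "x \<in> carr M p" "y \<in> carr N q" "y' \<in> carr N q"
    unfolding pure_def
  proof (rule pure_rel[OF assms])
    show "gen (p, x, q, y \<otimes>\<^bsub>grade N q\<^esub> y') + gen (p, x, q, y) + gen (p, x, q, y') \<in> tensor_rels M N (p + q)"
      unfolding tensor_rels_def using that by blast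
  qed (use that mN in \<open>auto simp: tensor_gens_def\<close>)
qed

lemma pure_one:
  assumes "pre_umod M" "pre_umod N" "x \<in> carr M p"
  shows "pure M N p x q \<one>\<^bsub>grade N q\<^esub> = \<one>\<^bsub>tensor_grade M N (p + q)\<^esub>"
proof -
  have "(\<lambda>y. pure M N p x q y) \<in> hom (grade N q) (tensor_grade M N (p + q))"
  proof (rule homI)
    fix y assume y: "y \<in> carr N q"
    show "pure M N p x q y \<in> carrier (tensor_grade M N (p + q))" by (rule pure_closed[OF assms(3) y])
    fix y' assume "y' \<in> carr N q"
    then show "pure M N p x q (y \<otimes>\<^bsub>grade N q\<^esub> y') =
        pure M N p x q y \<otimes>\<^bsub>tensor_grade M N (p + q)\<^esub> pure M N p x q y'"
      by (rule pure_add(2)[OF assms(1,2,3) y])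
  qed
  from F2_hom_one[OF this pre_umodD(1)[OF assms(2)] F2_space_tensor[OF assms(1,2)]]
  show ?thesis .
qed

text \<open>A bilinear map defines a linear map on the tensor product, which \<open>lin_ext_quot\<close> computes.\<close>

lemma lin_ext_quot_tensor:
  assumes "pre_umod M" "pre_umod N" "F2_space G" "f ` tensor_gens M N n \<subseteq> carrier G"
    "\<And>p x x' q y. p + q = n \<Longrightarrow> x \<in> carr M p \<Longrightarrow> x' \<in> carr M p \<Longrightarrow> y \<in> carr N q \<Longrightarrow>
      f (p, x \<otimes>\<^bsub>grade M p\<^esub> x', q, y) = f (p, x, q, y) \<otimes>\<^bsub>G\<^esub> f (p, x', q, y)"
    "\<And>p x q y y'. p + q = n \<Longrightarrow> x \<in> carr M p \<Longrightarrow> y \<in> carr N q \<Longrightarrow> y' \<in> carr N q \<Longrightarrow>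
      f (p, x, q, y \<otimes>\<^bsub>grade N q\<^esub> y') = f (p, x, q, y) \<otimes>\<^bsub>G\<^esub> f (p, x, q, y')"
    "p + q = n" "x \<in> carr M p" "y \<in> carr N q"
  shows "lin_ext_quot G f (pure M N p x q y) = f (p, x, q, y)"
proof -
  let ?F = "free_space (tensor_gens M N n)" and ?K = "tensor_kernel M N n"
  interpret comm_group G by (rule F2_spaceD(1)[OF assms(3)])
  note K = subgroup_tensor_kernel[OF assms(1,2), of n]
  note h = lin_ext_hom[OF assms(3,4)]
  note mM = F2_spaceD(6)[OF pre_umodD(1)[OF assms(1)]] and mN = F2_spaceD(6)[OF pre_umodD(1)[OF assms(2)]]
  have fc: "f s \<in> carrier G" if "s \<in> tensor_gens M N n" for s using assms(4) that by blast
  have hg: "lin_ext G f (gen s) = f s" if "s \<in> tensor_gens M N n" for s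
    using assms(3) fc[OF that] by (rule lin_ext_gen)
  have ker3: "lin_ext G f (gen a + gen b + gen c) = \<one>\<^bsub>G\<^esub>"
    if "a \<in> tensor_gens M N n" "b \<in> tensor_gens M N n" "c \<in> tensor_gens M N n"
      "f a = f b \<otimes>\<^bsub>G\<^esub> f c" for a b c
  proof -
    have g: "gen a \<in> carrier ?F" "gen b \<in> carrier ?F" "gen c \<in> carrier ?F" using that by auto
    have "lin_ext G f (gen a + gen b + gen c) = f a \<otimes>\<^bsub>G\<^esub> f b \<otimes>\<^bsub>G\<^esub> f c"
      using hom_mult[OF h g(1,2)] hom_mult[OF h F2_spaceD(6)[OF F2_space_free g(1,2)] g(3)]
        hg[OF that(1)] hg[OF that(2)] hg[OF that(3)] by simp
    also have "\<dots> = \<one>\<^bsub>G\<^esub>"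
      using fc[OF that(2)] fc[OF that(3)] F2_spaceD(5)[OF assms(3), of "f b \<otimes>\<^bsub>G\<^esub> f c"]
      by (simp add: that(4) m_assoc)
    finally show ?thesis .
  qed
  have "tensor_rels M N n \<subseteq> {u \<in> carrier ?F. lin_ext G f u = \<one>\<^bsub>G\<^esub>}"
  proof
    fix r assume r: "r \<in> tensor_rels M N n"
    then have "lin_ext G f r = \<one>\<^bsub>G\<^esub>"
      unfolding tensor_rels_def using assms(5,6) mM mN
      by (auto intro!: ker3) (auto simp: tensor_gens_def)
    then show "r \<in> {u \<in> carrier ?F. lin_ext G f u = \<one>\<^bsub>G\<^esub>}" using r tensor_rels_carr[OF assms(1,2)] by blast
  qed
  moreover have "subgroup {u \<in> carrier ?F. lin_ext G f u = \<one>\<^bsub>G\<^esub>} ?F"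
    by (rule F2_subgroupI[OF F2_space_free])
      (use F2_hom_one[OF h F2_space_free assms(3)] F2_spaceD(6)[OF F2_space_free, of _ "tensor_gens M N n"]
        F2_spaceD(7)[OF F2_space_free, of "tensor_gens M N n"]
        hom_mult[OF h] in \<open>auto simp del: free_space_simps\<close>)
  ultimately have kill: "?K \<subseteq> {u \<in> carrier ?F. lin_ext G f u = \<one>\<^bsub>G\<^esub>}"
    by (rule group.generate_subgroup_incl[OF F2_spaceD(2)[OF F2_space_free]])
  have s: "(p, x, q, y) \<in> tensor_gens M N n" using assms(7-9) by (simp add: tensor_gens_def)
  then have g: "gen (p, x, q, y) \<in> carrier ?F" by simp
  have "lin_ext G f u = f (p, x, q, y)" if "u \<in> ?K #>\<^bsub>?F\<^esub> gen (p, x, q, y)" for u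
  proof -
    note u = coset_elem[OF F2_space_free K g that]
    have "lin_ext G f u \<otimes>\<^bsub>G\<^esub> lin_ext G f (gen (p, x, q, y)) = \<one>\<^bsub>G\<^esub>"
      using kill u(2) hom_mult[OF h u(1) g] by auto
    then have "lin_ext G f u = lin_ext G f (gen (p, x, q, y))"
      using F2_space_eq_iff[OF assms(3) hom_closed[OF h u(1)] hom_closed[OF h g]] by blast
    then show ?thesis using hg[OF s] by simp
  qed
  then have "lin_ext G f ` (?K #>\<^bsub>?F\<^esub> gen (p, x, q, y)) =
      (\<lambda>_. f (p, x, q, y)) ` (?K #>\<^bsub>?F\<^esub> gen (p, x, q, y))"
    by (rule image_cong[OF refl])
  also have "\<dots> = {f (p, x, q, y)}" using coset_self[OF F2_space_free K g] by auto
  finally have "lin_ext G f ` (?K #>\<^bsub>?F\<^esub> gen (p, x, q, y)) = {f (p, x, q, y)}" .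
  then show ?thesis using assms(7) by (simp add: lin_ext_quot_def pure_def)
qed

lemma tensor_simps:
  "grade (tensor M N) n = tensor_grade M N n"
  "Sq (tensor M N) i n = lin_ext_quot (tensor_grade M N (n + i)) (\<lambda>(p, x, q, y).
     finprod (tensor_grade M N (n + i))
       (\<lambda>k. pure M N (p + k) (Sq M k p x) (q + (i - k)) (Sq N (i - k) q y)) {..i})"
  by (simp_all add: tensor_def)

text \<open>The right-hand side of the Cartan formula is bilinear, so the operations are well defined on
  the tensor product.\<close>

lemma Sq_pure:
  assumes "pre_umod M" "pre_umod N" "x \<in> carr M p" "y \<in> carr N q"
  shows "Sq (tensor M N) i (p + q) (pure M N p x q y) =
    finprod (tensor_grade M N (p + q + i))
      (\<lambda>k. pure M N (p + k) (Sq M k p x) (q + (i - k)) (Sq N (i - k) q y)) {..i}"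
proof -
  let ?G = "tensor_grade M N (p + q + i)"
  let ?t = "\<lambda>p x q y k. pure M N (p + k) (Sq M k p x) (q + (i - k)) (Sq N (i - k) q y)"
  let ?f = "\<lambda>(p, x, q, y). finprod ?G (?t p x q y) {..i}"
  note G = F2_space_tensor[OF assms(1,2), of "p + q + i"]
  interpret comm_group ?G by (rule F2_spaceD(1)[OF G])
  have deg: "p' + k + (q' + (i - k)) = p + q + i" if "p' + q' = p + q" "k \<le> i" for p' q' k
    using that by auto
  have tc: "?t p' x' q' y' \<in> {..i} \<rightarrow> carrier ?G" if "p' + q' = p + q" "x' \<in> carr M p'" "y' \<in> carr N q'" for p' x' q' y'
  proof
    fix k assume "k \<in> {..i}"
    then have "k \<le> i" by simp
    from pure_closed[OF Sq_closed[OF assms(1) that(2), of k] Sq_closed[OF assms(2) that(3), of "i - k"]]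
    show "?t p' x' q' y' k \<in> carrier ?G" unfolding deg[OF that(1) \<open>k \<le> i\<close>] .
  qed
  have "lin_ext_quot ?G ?f (pure M N p x q y) = ?f (p, x, q, y)"
  proof (rule lin_ext_quot_tensor[OF assms(1,2) G _ _ _ refl assms(3,4)])
    show "?f ` tensor_gens M N (p + q) \<subseteq> carrier ?G"
      unfolding tensor_gens_def using finprod_closed[OF tc] by auto
  next
    fix p' z z' q' w assume *: "p' + q' = p + q" "z \<in> carr M p'" "z' \<in> carr M p'" "w \<in> carr N q'"
    have "?t p' (z \<otimes>\<^bsub>grade M p'\<^esub> z') q' w k = ?t p' z q' w k \<otimes>\<^bsub>?G\<^esub> ?t p' z' q' w k" if "k \<le> i" for k
      using pure_add(1)[OF assms(1,2) Sq_closed[OF assms(1) *(2), of k] Sq_closed[OF assms(1) *(3), of k]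
        Sq_closed[OF assms(2) *(4), of "i - k"]] hom_mult[OF pre_umodD(2)[OF assms(1)] *(2,3)]
      unfolding deg[OF *(1) that] by simp
    then have "finprod ?G (?t p' (z \<otimes>\<^bsub>grade M p'\<^esub> z') q' w) {..i} =
        finprod ?G (\<lambda>k. ?t p' z q' w k \<otimes>\<^bsub>?G\<^esub> ?t p' z' q' w k) {..i}"
      using tc[OF *(1,2,4)] tc[OF *(1,3,4)] by (intro finprod_cong') auto
    then show "?f (p', z \<otimes>\<^bsub>grade M p'\<^esub> z', q', w) = ?f (p', z, q', w) \<otimes>\<^bsub>?G\<^esub> ?f (p', z', q', w)"
      using finprod_multf[OF tc[OF *(1,2,4)] tc[OF *(1,3,4)]] by simp
  next
    fix p' z q' w w' assume *: "p' + q' = p + q" "z \<in> carr M p'" "w \<in> carr N q'" "w' \<in> carr N q'"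
    have "?t p' z q' (w \<otimes>\<^bsub>grade N q'\<^esub> w') k = ?t p' z q' w k \<otimes>\<^bsub>?G\<^esub> ?t p' z q' w' k" if "k \<le> i" for k
      using pure_add(2)[OF assms(1,2) Sq_closed[OF assms(1) *(2), of k] Sq_closed[OF assms(2) *(3), of "i - k"]
        Sq_closed[OF assms(2) *(4), of "i - k"]] hom_mult[OF pre_umodD(2)[OF assms(2)] *(3,4)]
      unfolding deg[OF *(1) that] by simp
    then have "finprod ?G (?t p' z q' (w \<otimes>\<^bsub>grade N q'\<^esub> w')) {..i} =
        finprod ?G (\<lambda>k. ?t p' z q' w k \<otimes>\<^bsub>?G\<^esub> ?t p' z q' w' k) {..i}"
      using tc[OF *(1,2,3)] tc[OF *(1,2,4)] by (intro finprod_cong') auto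
    then show "?f (p', z, q', w \<otimes>\<^bsub>grade N q'\<^esub> w') = ?f (p', z, q', w) \<otimes>\<^bsub>?G\<^esub> ?f (p', z, q', w')"
      using finprod_multf[OF tc[OF *(1,2,3)] tc[OF *(1,2,4)]] by simp
  qed
  then show ?thesis by (simp add: tensor_simps)
qed

subsection \<open>Tensoring with the ground field\<close>

lemma tensor_F2_hom:
  assumes "pre_umod M"
  shows "(\<lambda>x. pure M F2_umod n x 0 1) \<in> hom (grade M n) (tensor_grade M F2_umod n)"
proof (rule homI)
  have 1: "1 \<in> carr F2_umod 0" by (simp add: F2_umod_simps)
  fix x assume x: "x \<in> carr M n"
  show "pure M F2_umod n x 0 1 \<in> carrier (tensor_grade M F2_umod n)"
    using pure_closed[OF x 1] by simp
  fix y assume y: "y \<in> carr M n"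
  show "pure M F2_umod n (x \<otimes>\<^bsub>grade M n\<^esub> y) 0 1 =
      pure M F2_umod n x 0 1 \<otimes>\<^bsub>tensor_grade M F2_umod n\<^esub> pure M F2_umod n y 0 1"
    using pure_add(1)[OF assms pre_umod_F2 x y 1] by simp
qed

text \<open>A pure tensor \<open>x \<otimes> y\<close> is zero unless \<open>y\<close> is the one non-zero element of \<open>\<bbbF>\<^sub>2\<close>, in degree
  zero.\<close>

lemma tensor_F2_surj:
  assumes "pre_umod M"
  shows "(\<lambda>x. pure M F2_umod n x 0 1) ` carr M n = carrier (tensor_grade M F2_umod n)"
proof (intro equalityI subsetI)
  let ?F = "free_space (tensor_gens M F2_umod n)" and ?K = "tensor_kernel M F2_umod n"
  let ?b = "\<lambda>x. pure M F2_umod n x 0 1"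
  note h = tensor_F2_hom[OF assms, of n]
  note K = subgroup_tensor_kernel[OF assms pre_umod_F2, of n]
  note q = quot_hom[OF F2_space_free K, folded tensor_grade_def]
  have one: "?b \<one>\<^bsub>grade M n\<^esub> = \<one>\<^bsub>tensor_grade M F2_umod n\<^esub>"
    by (rule F2_hom_one[OF h pre_umodD(1)[OF assms] F2_space_tensor[OF assms pre_umod_F2]])
  note M1 = F2_spaceD(7)[OF pre_umodD(1)[OF assms], of n]
  show "X \<in> carrier (tensor_grade M F2_umod n)" if "X \<in> ?b ` carr M n" for X
    using that hom_closed[OF h] by blast
  fix X assume "X \<in> carrier (tensor_grade M F2_umod n)"
  then obtain u where u: "Poly_Mapping.keys u \<subseteq> tensor_gens M F2_umod n" "X = ?K #>\<^bsub>?F\<^esub> u"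
    unfolding tensor_grade_def carrier_quot by auto
  from u(1) have "?K #>\<^bsub>?F\<^esub> u \<in> ?b ` carr M n"
  proof (induction rule: free_induct)
    case zero
    have "?K #>\<^bsub>?F\<^esub> 0 = ?b \<one>\<^bsub>grade M n\<^esub>"
      using F2_hom_one[OF q F2_space_free F2_space_tensor[OF assms pre_umod_F2]] one by simp
    then show ?case using M1 by blast
  next
    case (add s u)
    obtain z where z: "z \<in> carr M n" "?K #>\<^bsub>?F\<^esub> u = ?b z" using add.IH by blast
    obtain p x r y where s: "s = (p, x, r, y)" "p + r = n" "x \<in> carr M p" "y \<in> carr F2_umod r"
      using add.hyps by (auto simp: tensor_gens_def)
    have "pure M F2_umod p x r y \<in> ?b ` carr M n"
    proof (cases "r = 0 \<and> y = 1")
      case True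
      then show ?thesis using s by auto
    next
      case False
      then have "y = \<one>\<^bsub>grade F2_umod r\<^esub>"
        using s(4) bit_cases[of y] by (auto simp: F2_umod_simps split: if_splits)
      then have "pure M F2_umod p x r y = ?b \<one>\<^bsub>grade M n\<^esub>"
        using pure_one[OF assms pre_umod_F2 s(3), of r] one s(2) by simp
      then show ?thesis using M1 by blast
    qed
    then obtain z' where z': "z' \<in> carr M n" "?K #>\<^bsub>?F\<^esub> gen s = ?b z'"
      using s(2) by (auto simp: pure_def s(1))
    have "?K #>\<^bsub>?F\<^esub> (gen s + u) = ?b z' \<otimes>\<^bsub>tensor_grade M F2_umod n\<^esub> ?b z"
      using hom_mult[OF q, of "gen s" u] add.hyps z(2) z'(2) by simp
    also have "\<dots> = ?b (z' \<otimes>\<^bsub>grade M n\<^esub> z)" using hom_mult[OF h z'(1) z(1)] by simp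
    finally show ?case using F2_spaceD(6)[OF pre_umodD(1)[OF assms] z'(1) z(1)] by blast
  qed
  then show "X \<in> ?b ` carr M n" using u(2) by simp
qed

text \<open>Positive squares vanish on \<open>\<bbbF>\<^sub>2\<close>, so that a single term of the Cartan formula is left.\<close>

lemma tensor_F2_Sq:
  assumes "pre_umod M" "x \<in> carr M n"
  shows "Sq (tensor M F2_umod) i n (pure M F2_umod n x 0 1) = pure M F2_umod (n + i) (Sq M i n x) 0 1"
proof -
  let ?G = "tensor_grade M F2_umod (n + i)"
  interpret comm_group ?G by (rule F2_spaceD(1)[OF F2_space_tensor[OF assms(1) pre_umod_F2]])
  let ?t = "\<lambda>k. pure M F2_umod (n + k) (Sq M k n x) (0 + (i - k)) (Sq F2_umod (i - k) 0 1)"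
  have 1: "pure M F2_umod (n + i) (Sq M i n x) 0 1 \<in> carrier ?G"
    using hom_closed[OF tensor_F2_hom[OF assms(1)] Sq_closed[OF assms]] .
  have t: "?t k = (if i = k then pure M F2_umod (n + k) (Sq M k n x) 0 1 else \<one>\<^bsub>?G\<^esub>)" if "k \<le> i" for k
    using pure_one[OF assms(1) pre_umod_F2 Sq_closed[OF assms, of k], of "i - k"] that
    by (auto simp: F2_umod_simps)
  have "Sq (tensor M F2_umod) i n (pure M F2_umod n x 0 1) = finprod ?G ?t {..i}"
    using Sq_pure[OF assms(1) pre_umod_F2 assms(2), where q = 0 and y = 1 and i = i]
    by (simp add: F2_umod_simps)
  also have "\<dots> = finprod ?G (\<lambda>k. if i = k then pure M F2_umod (n + k) (Sq M k n x) 0 1 else \<one>\<^bsub>?G\<^esub>) {..i}"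
    by (rule finprod_cong') (use 1 t in auto)
  also have "\<dots> = finprod ?G (\<lambda>k. if i = k then pure M F2_umod (n + i) (Sq M i n x) 0 1 else \<one>\<^bsub>?G\<^esub>) {..i}"
    by (rule finprod_cong') (use 1 in auto)
  also have "\<dots> = pure M F2_umod (n + i) (Sq M i n x) 0 1"
    using 1 by (intro finprod_singleton) auto
  finally show ?thesis .
qed

lemma pre_umod_surj:
  assumes "pre_umod X" "\<And>n. F2_space (grade Y n)" "umod_hom X Y f" "\<And>n. f n ` carr X n = carr Y n"
  shows "pre_umod Y"
  unfolding pre_umod_def
proof (intro conjI allI assms(2))
  fix i n
  show "Sq Y i n \<in> hom (grade Y n) (grade Y (n + i))"
  proof (rule homI)
    fix y assume "y \<in> carr Y n"
    then obtain x where x: "x \<in> carr X n" "y = f n x" unfolding assms(4)[symmetric] by blast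
    note S = umod_homD(2)[OF assms(3)] and m = hom_mult[OF umod_homD(1)[OF assms(3)]]
    show "Sq Y i n y \<in> carr Y (n + i)"
      using S[OF x(1), of i] umod_homD(3)[OF assms(3) Sq_closed[OF assms(1) x(1), of i]] x by simp
    fix y' assume "y' \<in> carr Y n"
    then obtain x' where x': "x' \<in> carr X n" "y' = f n x'" unfolding assms(4)[symmetric] by blast
    have "x \<otimes>\<^bsub>grade X n\<^esub> x' \<in> carr X n" using F2_spaceD(6)[OF pre_umodD(1)[OF assms(1)] x(1) x'(1)] .
    then have "Sq Y i n (y \<otimes>\<^bsub>grade Y n\<^esub> y') = f (n + i) (Sq X i n (x \<otimes>\<^bsub>grade X n\<^esub> x'))"
      using S m x x' by simp
    also have "\<dots> = f (n + i) (Sq X i n x) \<otimes>\<^bsub>grade Y (n + i)\<^esub> f (n + i) (Sq X i n x')"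
      using hom_mult[OF pre_umodD(2)[OF assms(1)] x(1) x'(1)] m Sq_closed[OF assms(1)] x x' by simp
    finally show "Sq Y i n (y \<otimes>\<^bsub>grade Y n\<^esub> y') = Sq Y i n y \<otimes>\<^bsub>grade Y (n + i)\<^esub> Sq Y i n y'"
      using S x x' by simp
  qed
qed

lemma umod_hom_tensor_F2:
  assumes "pre_umod M"
  shows "umod_hom M (tensor M F2_umod) (\<lambda>n x. pure M F2_umod n x 0 1)"
  unfolding umod_hom_def by (simp add: tensor_F2_hom[OF assms] tensor_F2_Sq[OF assms] tensor_simps(1))

text \<open>As \<open>M \<otimes> \<bbbF>\<^sub>2\<close> is an image of \<open>M\<close>, the Adem relations for it follow from those for \<open>M\<close>.\<close>

lemma unstable_tensor_F2:
  assumes "unstable_module M"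
  shows "unstable_module (tensor M F2_umod)"
proof -
  have M: "pre_umod M" using assms by (simp add: unstable_module_iff)
  have surj: "(\<lambda>x. pure M F2_umod n x 0 1) ` carr M n = carr (tensor M F2_umod) n" for n
    by (simp add: tensor_F2_surj[OF M] tensor_simps(1))
  have "pre_umod (tensor M F2_umod)"
    by (rule pre_umod_surj[OF M _ umod_hom_tensor_F2[OF M] surj])
      (simp add: tensor_simps(1) F2_space_tensor[OF M pre_umod_F2])
  then show ?thesis
    by (rule unstable_module_image[OF assms _ umod_hom_tensor_F2[OF M] surj])
qed

section \<open>Central elements\<close>

lemma unstable_quot:
  assumes "unstable_module X" "sub_umod X S"
  shows "unstable_module (quot_umod X S)"
proof -
  have X: "pre_umod X" using assms(1) by (simp add: unstable_module_iff)
  show ?thesis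
    by (rule unstable_module_image[OF assms(1) pre_umod_quot[OF X assms(2)] umod_hom_proj[OF X assms(2)]])
      (simp add: carr_quot_umod del: quot_umod_simps)
qed

lemma unstable_T_phi: "unstable_module (T_phi V \<phi> K M)"
proof -
  note X = unstable_tensor_F2[OF unstable_T, of V M]
  then have "pre_umod (tensor (T V M) F2_umod)" using unstable_module_iff by blast
  from unstable_quot[OF X sub_umod_submod[OF this]] show ?thesis
    unfolding T_phi_def T_phi_sub_def .
qed

lemma umod_hom_rho_phi:
  assumes "monoid V" "unstable_module M"
  shows "umod_hom M (T_phi V \<phi> K M) (rho_phi V \<phi> K M)"
proof -
  have X: "pre_umod (tensor (T V M) F2_umod)"
    using unstable_module_iff unstable_tensor_F2[OF unstable_T] by blast
  have "umod_hom M (tensor (T V M) F2_umod) (\<lambda>n x. pure (T V M) F2_umod n (rho V M n x) 0 1)"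
    by (rule umod_hom_comp[OF umod_hom_rho[OF assms] umod_hom_tensor_F2[OF pre_umod_T]])
  from umod_hom_comp[OF this umod_hom_proj[OF X sub_umod_submod[OF X]]]
  show ?thesis by (simp add: T_phi_def T_phi_sub_def rho_phi_def[abs_def])
qed

text \<open>Both sides speak of the same homomorphism between unstable modules, so the criterion
  applies pair by pair.\<close>

lemma M_central_eq:
  assumes "unstable_module M"
  shows "(M_central M K :: ('v monoid \<times> (nat \<Rightarrow> 'a \<Rightarrow> 'v coh)) set) = (\<Inter>k\<in>{1..}. M_central_k k M K)"
proof -
  have iff: "umod_iso M (T_phi W \<phi> K M) (rho_phi W \<phi> K M) \<longleftrightarrow>
      (\<forall>k\<in>{1..}. f_trunc_iso TYPE('v) k M (T_phi W \<phi> K M) (rho_phi W \<phi> K M))"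
    if W: "W \<in> Vf" for W :: "'v monoid" and \<phi>
  proof -
    have "monoid W" using W F2_spaceD(4) by (auto simp: Vf_def)
    then show ?thesis
      by (rule umod_iso_iff_f_trunc_iso[OF W assms unstable_T_phi umod_hom_rho_phi[OF _ assms]])
  qed
  show ?thesis
  proof (rule Set.set_eqI)
    fix z :: "'v monoid \<times> (nat \<Rightarrow> 'a \<Rightarrow> 'v coh)"
    obtain W \<phi> where z: "z = (W, \<phi>)" by (cases z)
    show "z \<in> M_central M K \<longleftrightarrow> z \<in> (\<Inter>k\<in>{1..}. M_central_k k M K)"
    proof (cases "W \<in> Vf")
      case True
      then show ?thesis
        unfolding z M_central_def M_central_k_def INT_iff mem_Collect_eq case_prod_conv iff[OF True]
        by auto
    qed (auto simp: z M_central_def M_central_k_def)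
  qed
qed

theorem proposition5p3:
  fixes K :: "'a ualg" and M :: "('a, 'm) kmod"
  assumes "unstable_algebra K" and "unstable_kmod K M"
  shows "(central K :: (('v::infinite) monoid \<times> (nat \<Rightarrow> 'a \<Rightarrow> 'v coh)) set) = (\<Inter>k\<in>{1..}. central_k k K)
    \<and> (M_central M K :: ('v monoid \<times> (nat \<Rightarrow> 'a \<Rightarrow> 'v coh)) set) = (\<Inter>k\<in>{1..}. M_central_k k M K)"
proof
  have "unstable_module (self_kmod K)"
    using assms(1) unfolding unstable_algebra_def unstable_module_def self_kmod_def adem_rhs_def by simp
  then show "central K = (\<Inter>k\<in>{1..}. central_k k K)"
    unfolding central_def central_k_def by (rule M_central_eq)
  show "M_central M K = (\<Inter>k\<in>{1..}. M_central_k k M K)"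
    using assms(2) by (intro M_central_eq) (simp add: unstable_kmod_def)
qed

end
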